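(* Let $k$ be a $C_1$ field that admits normic forms of every degree. Let $\overline k$ be a separable closure of $k$. Let $N$ be a positive integer, let $\mathbf{n}=(n_1,\dots,n_N)$ and $(m_1,\dots,m_N)$ be $N$-tuples of positive integers, let $\mathbf{a}=(a_{i,l})_{1\leq i\leq N,\,1\leq l\leq m_i}$ be a tuple of positive integers, and let $\mathbb{P}(\mathbf{n},\mathbf{a})$ be a $k$-variety as described in the context. Let $X\subseteq\mathbb{P}(\mathbf{n},\mathbf{a})$ be a subvariety such that $X_{\overline k}$ is an intersection of hypersurfaces $H_1,\dots,H_s$ in $\mathbb{P}(\mathbf{n},\mathbf{a})_{\overline k}$ of weighted multidegrees $(d_{i,j,t})_{1\leq i\leq N,\,1\leq j\leq n_i}$ for $t\in\{1,\dots,s\}$, such that $$\sum_{t=1}^s d_{i,j,t}<\sum_{l=1}^{m_i}a_{i,l}$$ for all $i\in\{1,\dots,N\}$ and all $j\in\{1,\dots,n_i\}$. Assume that for some $1\leq s_1<\dots<s_r:=s$, $s_0:=0$, the hypersurfaces $H_{s_{i-1}+1},\dots,H_{s_i}$ form an orbit under the $\operatorname{Gal}(\overline k/k)$-action on $\mathbb{P}(\mathbf{n},\mathbf{a})_{\overline k}$ for all $i\in\{1,\dots,r\}$. Then $X$ has a $k$-rational point.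
   Context: A field $k$ (of arbitrary characteristic) is $C_1$ if for every $n$ every hypersurface of degree at most $n$ in $\mathbb{P}^n_k$ has a $k$-rational point. A normic form of degree $d$ over $k$ is a homogeneous polynomial of degree $d$ in $d$ variables with coefficients in $k$ whose only zero in $k^d$ is the trivial one; $k$ admits normic forms of every degree if such a form exists for every positive integer $d$. For positive integers $a_1,\dots,a_m$, $\mathbb{P}_{\overline k}(a_1,\dots,a_m)$ is the $(m-1)$-dimensional weighted projective space with weights $a_1,\dots,a_m$. $\mathbb{P}(\mathbf{n},\mathbf{a})$ denotes a $k$-variety such that $$\mathbb{P}(\mathbf{n},\mathbf{a})_{\overline k}\cong\prod_{i=1}^N\prod_{j=1}^{n_i}\mathbb{P}_{\overline k}(a_{i,1},\dots,a_{i,m_i}),$$ where $\operatorname{Gal}(\overline k/k)$ acts by permutation of the factors with exactly $N$ orbits, namely for each $i$ the $n_i$ factors of $\prod_{j=1}^{n_i}\mathbb{P}_{\overline k}(a_{i,1},\dots,a_{i,m_i})$. That is, writing $x_{i,j,1},\dots,x_{i,j,m_i}$ for the weighted coordinates (of weights $a_{i,1},\dots,a_{i,m_i}$) on the $j$-th factor of the $i$-th orbit, $\operatorname{Gal}(\overline k/k)$ acts (semilinearly) on the coordinate ring $\overline k[x_{i,j,l}]$ through its action on $\overline k$ and through permutations of the second index $j$, in such a way that $\{x_{i,1,l},\dots,x_{i,n_i,l}\}$ forms an orbit for all $i\in\{1,\dots,N\}$ and $l\in\{1,\dots,m_i\}$. The weighted multidegree of a hypersurface is that of a weighted multihomogeneous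 polynomial defining it: $d_{i,j,t}$ is the weighted degree of the equation of $H_t$ in the variables $x_{i,j,1},\dots,x_{i,j,m_i}$. *)

theory Defs
  imports
    "HOL-Library.Poly_Mapping"
    "HOL-Computational_Algebra.Polynomial"
    "HOL-Combinatorics.Permutations"
    "HOL-Algebra.Ideal"
begin

text \<open>Multivariate polynomials with variables in \<open>'v\<close>: finitely supported functions from
  monomials (exponent vectors) to coefficients.\<close>

type_synonym ('v, 'a) mpoly = "('v \<Rightarrow>\<^sub>0 nat) \<Rightarrow>\<^sub>0 'a"

definition mvars :: "('v, 'a::zero) mpoly \<Rightarrow> 'v set" where
  "mvars p = (\<Union>\<mu>\<in>Poly_Mapping.keys p. Poly_Mapping.keys \<mu>)"

definition mconst :: "'a::zero \<Rightarrow> ('v, 'a) mpoly" where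
  "mconst c = Poly_Mapping.single 0 c"

definition mvar :: "'v \<Rightarrow> ('v, 'a::zero_neq_one) mpoly" where
  "mvar v = Poly_Mapping.single (Poly_Mapping.single v 1) 1"

definition mpeval :: "('v \<Rightarrow> 'a) \<Rightarrow> ('v, 'a::comm_semiring_1) mpoly \<Rightarrow> 'a" where
  "mpeval x p = (\<Sum>\<mu>\<in>Poly_Mapping.keys p. Poly_Mapping.lookup p \<mu> * (\<Prod>v\<in>Poly_Mapping.keys \<mu>. x v ^ Poly_Mapping.lookup \<mu> v))"

definition homogeneous :: "nat \<Rightarrow> ('v, 'a::zero) mpoly \<Rightarrow> bool" where
  "homogeneous d p \<longleftrightarrow> (\<forall>\<mu>\<in>Poly_Mapping.keys p. (\<Sum>v\<in>Poly_Mapping.keys \<mu>. Poly_Mapping.lookup \<mu> v) = d)"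


section \<open>\<open>C\<^sub>1\<close> fields, normic forms, separable closures\<close>

text \<open>The coordinates on projective \<open>n\<close>-space are indexed by \<open>0, \<dots>, n\<close>.\<close>

definition C1_field :: "'k::field itself \<Rightarrow> bool" where
  "C1_field _ \<longleftrightarrow>
     (\<forall>n d. \<forall>F :: (nat, 'k) mpoly.
        1 \<le> d \<and> d \<le> n \<and> F \<noteq> 0 \<and> homogeneous d F \<and> mvars F \<subseteq> {0..n} \<longrightarrow>
        (\<exists>x. (\<exists>i\<in>{0..n}. x i \<noteq> 0) \<and> mpeval x F = 0))"

definition normic_form :: "nat \<Rightarrow> (nat, 'k::field) mpoly \<Rightarrow> bool" where
  "normic_form d F \<longleftrightarrow>
     homogeneous d F \<and> mvars F \<subseteq> {1..d} \<and>
     (\<forall>x. mpeval x F = 0 \<longrightarrow> (\<forall>i\<in>{1..d}. x i = 0))"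

definition admits_normic_forms :: "'k::field itself \<Rightarrow> bool" where
  "admits_normic_forms _ \<longleftrightarrow> (\<forall>d\<ge>1. \<exists>F :: (nat, 'k) mpoly. normic_form d F)"

definition field_embedding :: "('k::field \<Rightarrow> 'a::field) \<Rightarrow> bool" where
  "field_embedding \<iota> \<longleftrightarrow>
     \<iota> 1 = 1 \<and> (\<forall>x y. \<iota> (x + y) = \<iota> x + \<iota> y) \<and> (\<forall>x y. \<iota> (x * y) = \<iota> x * \<iota> y)"

definition separable_poly :: "'a::field poly \<Rightarrow> bool" where
  "separable_poly p \<longleftrightarrow> coprime p (pderiv p)"

definition separable_closure :: "('k::field \<Rightarrow> 'a::field) \<Rightarrow> bool" where
  "separable_closure \<iota> \<longleftrightarrow>
     field_embedding \<iota> \<and>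
     (\<forall>x. \<exists>p. irreducible p \<and> separable_poly p \<and> poly (map_poly \<iota> p) x = 0) \<and>
     (\<forall>q :: 'a poly. 0 < degree q \<and> separable_poly q \<longrightarrow> (\<exists>x. poly q x = 0))"

definition Gal :: "('k::field \<Rightarrow> 'a::field) \<Rightarrow> ('a \<Rightarrow> 'a) set" where
  "Gal \<iota> = {\<sigma>. field_embedding \<sigma> \<and> bij \<sigma> \<and> (\<forall>c. \<sigma> (\<iota> c) = \<iota> c)}"


section \<open>The product of weighted projective spaces over the separable closure\<close>

text \<open>Coordinates: \<open>(i, j, l)\<close> stands for \<open>x\<^sub>i\<^sub>,\<^sub>j\<^sub>,\<^sub>l\<close>, of weight \<open>a i l\<close>.\<close>

type_synonym coord = "nat \<times> nat \<times> nat"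

definition coords :: "nat \<Rightarrow> (nat \<Rightarrow> nat) \<Rightarrow> (nat \<Rightarrow> nat) \<Rightarrow> coord set" where
  "coords N n m = {(i, j, l). i \<in> {1..N} \<and> j \<in> {1..n i} \<and> l \<in> {1..m i}}"

definition coord_ring ::
    "nat \<Rightarrow> (nat \<Rightarrow> nat) \<Rightarrow> (nat \<Rightarrow> nat) \<Rightarrow> (coord, 'a::field) mpoly ring" where
  "coord_ring N n m =
     \<lparr>carrier = {p. mvars p \<subseteq> coords N n m}, monoid.mult = (*), one = 1, ring.zero = 0, add = (+)\<rparr>"

text \<open>As usual, the zero polynomial counts as multihomogeneous of every multidegree.\<close>

definition multihomogeneous ::
    "nat \<Rightarrow> (nat \<Rightarrow> nat) \<Rightarrow> (nat \<Rightarrow> nat) \<Rightarrow> (nat \<Rightarrow> nat \<Rightarrow> nat) \<Rightarrow>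
     (nat \<Rightarrow> nat \<Rightarrow> nat) \<Rightarrow> (coord, 'a::field) mpoly \<Rightarrow> bool" where
  "multihomogeneous N n m a D p \<longleftrightarrow>
     p \<in> carrier (coord_ring N n m) \<and>
     (\<forall>\<mu>\<in>Poly_Mapping.keys p. \<forall>i\<in>{1..N}. \<forall>j\<in>{1..n i}. (\<Sum>l=1..m i. a i l * Poly_Mapping.lookup \<mu> (i, j, l)) = D i j)"

text \<open>The points of the scheme: the product of weighted projective spaces is the multigraded
  Proj of the coordinate ring, i.e. its points are the prime ideals generated by
  multihomogeneous elements that, for every factor \<open>(i, j)\<close>, miss some coordinate of that
  factor.\<close>

definition wproj_points ::
    "nat \<Rightarrow> (nat \<Rightarrow> nat) \<Rightarrow> (nat \<Rightarrow> nat) \<Rightarrow> (nat \<Rightarrow> nat \<Rightarrow> nat) \<Rightarrow>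
     (coord, 'a::field) mpoly set set" where
  "wproj_points N n m a =
     {P. primeideal P (coord_ring N n m) \<and>
         P = Idl\<^bsub>coord_ring N n m\<^esub> {f \<in> P. \<exists>D. multihomogeneous N n m a D f} \<and>
         (\<forall>i\<in>{1..N}. \<forall>j\<in>{1..n i}. \<exists>l\<in>{1..m i}. mvar (i, j, l) \<notin> P)}"

text \<open>The residue field at \<open>P\<close> consists of the classes of the fractions \<open>f / g\<close> with \<open>f\<close>, \<open>g\<close>
  multihomogeneous of the same multidegree and \<open>g \<notin> P\<close>; the point is rational over the base
  field iff each of these is the class of a constant. Over a separably closed field that is
  imperfect this is more than the nonzero coordinate vectors modulo weighted scaling: on the
  weighted projective line with weights \<open>1, p\<close> (in characteristic \<open>p\<close>) the point
  \<open>x\<^sub>1\<^sup>p = t x\<^sub>2\<close> is rational even if \<open>t\<close> is not a \<open>p\<close>-th power.\<close>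

definition rational_at ::
    "nat \<Rightarrow> (nat \<Rightarrow> nat) \<Rightarrow> (nat \<Rightarrow> nat) \<Rightarrow> (nat \<Rightarrow> nat \<Rightarrow> nat) \<Rightarrow>
     (coord, 'a::field) mpoly set \<Rightarrow> bool" where
  "rational_at N n m a P \<longleftrightarrow>
     (\<forall>D f g. multihomogeneous N n m a D f \<and> multihomogeneous N n m a D g \<and> g \<notin> P \<longrightarrow>
        (\<exists>c. f - mconst c * g \<in> P))"

text \<open>A hypersurface is an equation up to a nonzero scalar, i.e. the principal ideal it
  generates, so that its weighted multidegree is well defined: in the weighted setting
  equations of different multidegrees may cut out the same closed subscheme. Constants are
  not equations of hypersurfaces.\<close>

definition hypersurface_eq ::
    "nat \<Rightarrow> (nat \<Rightarrow> nat) \<Rightarrow> (nat \<Rightarrow> nat) \<Rightarrow> (nat \<Rightarrow> nat \<Rightarrow> nat) \<Rightarrow>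
     (nat \<Rightarrow> nat \<Rightarrow> nat) \<Rightarrow> (coord, 'a::field) mpoly \<Rightarrow> bool" where
  "hypersurface_eq N n m a D f \<longleftrightarrow>
     multihomogeneous N n m a D f \<and> f \<noteq> 0 \<and> f \<notin> range mconst"

definition hypersurface_points ::
    "nat \<Rightarrow> (nat \<Rightarrow> nat) \<Rightarrow> (nat \<Rightarrow> nat) \<Rightarrow> (nat \<Rightarrow> nat \<Rightarrow> nat) \<Rightarrow>
     (coord, 'a::field) mpoly set \<Rightarrow> (coord, 'a) mpoly set set" where
  "hypersurface_points N n m a H = {P \<in> wproj_points N n m a. H \<subseteq> P}"


section \<open>The form over \<open>k\<close> given by a permutation action\<close>

text \<open>\<open>\<pi> \<sigma> i\<close> is the permutation of the \<open>n i\<close> factors of the \<open>i\<close>-th orbit induced by \<open>\<sigma>\<close>. The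
  last condition is continuity for the Krull topology, which holds for every action
  arising from a variety over \<open>k\<close>; as the separable closure is algebraic over \<open>k\<close>, fixing a
  finite set amounts to fixing a finite subextension.\<close>

definition factor_action ::
    "('k::field \<Rightarrow> 'a::field) \<Rightarrow> nat \<Rightarrow> (nat \<Rightarrow> nat) \<Rightarrow> (('a \<Rightarrow> 'a) \<Rightarrow> nat \<Rightarrow> nat \<Rightarrow> nat) \<Rightarrow> bool" where
  "factor_action \<iota> N n \<pi> \<longleftrightarrow>
     (\<forall>\<sigma>\<in>Gal \<iota>. \<forall>i\<in>{1..N}. \<pi> \<sigma> i permutes {1..n i}) \<and>
     (\<forall>\<sigma>\<in>Gal \<iota>. \<forall>\<tau>\<in>Gal \<iota>. \<forall>i\<in>{1..N}. \<pi> (\<sigma> \<circ> \<tau>) i = \<pi> \<sigma> i \<circ> \<pi> \<tau> i) \<and>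
     (\<forall>i\<in>{1..N}. \<forall>j\<in>{1..n i}. \<forall>j'\<in>{1..n i}. \<exists>\<sigma>\<in>Gal \<iota>. \<pi> \<sigma> i j = j') \<and>
     (\<exists>S. finite S \<and> (\<forall>\<sigma>\<in>Gal \<iota>. (\<forall>x\<in>S. \<sigma> x = x) \<longrightarrow> (\<forall>i\<in>{1..N}. \<pi> \<sigma> i = id)))"

text \<open>The semilinear action on polynomials: \<open>\<sigma>\<close> on coefficients, \<open>x\<^sub>i\<^sub>,\<^sub>j\<^sub>,\<^sub>l \<mapsto> x\<^sub>i\<^sub>,\<^sub>\<pi>\<^sub>(\<^sub>j\<^sub>)\<^sub>,\<^sub>l\<close> on
  coordinates.\<close>

definition permute_coord :: "(nat \<Rightarrow> nat \<Rightarrow> nat) \<Rightarrow> coord \<Rightarrow> coord" where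
  "permute_coord \<rho> = (\<lambda>(i, j, l). (i, \<rho> i j, l))"

definition permute_monom :: "(nat \<Rightarrow> nat \<Rightarrow> nat) \<Rightarrow> (coord \<Rightarrow>\<^sub>0 nat) \<Rightarrow> (coord \<Rightarrow>\<^sub>0 nat)" where
  "permute_monom \<rho> \<mu> = (\<Sum>v\<in>Poly_Mapping.keys \<mu>. Poly_Mapping.single (permute_coord \<rho> v) (Poly_Mapping.lookup \<mu> v))"

definition gal_act ::
    "(('a \<Rightarrow> 'a) \<Rightarrow> nat \<Rightarrow> nat \<Rightarrow> nat) \<Rightarrow> ('a \<Rightarrow> 'a) \<Rightarrow> (coord, 'a::field) mpoly \<Rightarrow> (coord, 'a) mpoly" where
  "gal_act \<pi> \<sigma> p = (\<Sum>\<mu>\<in>Poly_Mapping.keys p. Poly_Mapping.single (permute_monom (\<pi> \<sigma>) \<mu>) (\<sigma> (Poly_Mapping.lookup p \<mu>)))"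

text \<open>By Galois descent, a closed subvariety over \<open>k\<close> is a closed subset over the separable
  closure stable under the Galois group, and its \<open>k\<close>-rational points are the Galois-fixed
  rational points over the separable closure.\<close>

definition galois_stable ::
    "('k::field \<Rightarrow> 'a::field) \<Rightarrow> (('a \<Rightarrow> 'a) \<Rightarrow> nat \<Rightarrow> nat \<Rightarrow> nat) \<Rightarrow> (coord, 'a) mpoly set set \<Rightarrow> bool" where
  "galois_stable \<iota> \<pi> X \<longleftrightarrow> (\<forall>\<sigma>\<in>Gal \<iota>. \<forall>P\<in>X. gal_act \<pi> \<sigma> ` P \<in> X)"

definition rational_points ::
    "('k::field \<Rightarrow> 'a::field) \<Rightarrow> nat \<Rightarrow> (nat \<Rightarrow> nat) \<Rightarrow> (nat \<Rightarrow> nat) \<Rightarrow> (nat \<Rightarrow> nat \<Rightarrow> nat) \<Rightarrow>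
     (('a \<Rightarrow> 'a) \<Rightarrow> nat \<Rightarrow> nat \<Rightarrow> nat) \<Rightarrow> (coord, 'a) mpoly set set \<Rightarrow> (coord, 'a) mpoly set set" where
  "rational_points \<iota> N n m a \<pi> X =
     {P \<in> X. rational_at N n m a P \<and> (\<forall>\<sigma>\<in>Gal \<iota>. gal_act \<pi> \<sigma> ` P = P)}"

definition galois_orbit ::
    "('k::field \<Rightarrow> 'a::field) \<Rightarrow> (('a \<Rightarrow> 'a) \<Rightarrow> nat \<Rightarrow> nat \<Rightarrow> nat) \<Rightarrow> (coord, 'a) mpoly set set \<Rightarrow> bool" where
  "galois_orbit \<iota> \<pi> A \<longleftrightarrow> (\<exists>H\<in>A. A = (\<lambda>\<sigma>. gal_act \<pi> \<sigma> ` H) ` Gal \<iota>)"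

end

theory Submission
  imports Defs "HOL-Library.Nat_Bijection"
begin

text \<open>Write \<open>K\<close> for the separable closure of \<open>k\<close>. Coordinates \<open>x\<close> over \<open>K\<close> with
  \<open>\<sigma>(x\<^sub>i\<^sub>,\<^sub>j\<^sub>,\<^sub>l) = x\<^sub>i\<^sub>,\<^sub>\<sigma>\<^sub>j\<^sub>,\<^sub>l\<close> for all Galois automorphisms \<open>\<sigma>\<close> and with a nonzero
  entry in every factor define a \<open>k\<close>-rational point: its homogeneous prime ideal
  (\<open>point_ideal\<close>) is Galois stable and has residue field \<open>K\<close>. The aim is to find such
  coordinates that satisfy all the equations.

  The product of the equations of one Galois orbit of hypersurfaces takes, at equivariant
  coordinates, values that Galois automorphisms only multiply by constants, and if one
  factor of the product vanishes there, all do (\<open>galois_orbit_product\<close>). After division by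
  one nonzero value the product therefore takes values in \<open>k\<close>, because every Galois-invariant
  element of \<open>K\<close> lies in \<open>k\<close> (\<open>Gal_fixed_imp_base\<close>). On a \<open>k\<close>-space of equivariant coordinates
  each orbit of equations thus amounts to one form over \<open>k\<close> (\<open>form_descent\<close>).

  The factors are treated one Galois orbit at a time. If the coordinates of the earlier orbits
  are fixed and those of the later ones are ignored, the equations become equations for the
  \<open>i\<close>-th orbit alone. The equivariant vectors with \<open>n\<^sub>i\<close> entries contain \<open>n\<^sub>i\<close> linearly
  independent ones over \<open>K\<close> (\<open>ex_equivariant_basis\<close>), so that each \<open>x\<^sub>i\<^sub>,\<^sub>l\<close> may be
  described by \<open>n\<^sub>i\<close> elements of \<open>k\<close>. Substituting for each of these a normic form of degree
  \<open>a\<^sub>i\<^sub>,\<^sub>l\<close> in new variables turns the weighted equations into genuine forms over \<open>k\<close>. An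
  orbit of equations of total degree \<open>D\<close> in each of the \<open>n\<^sub>i\<close> factors becomes a form of degree
  \<open>n\<^sub>i D\<close>, and there are \<open>n\<^sub>i \<Sum>\<^sub>l a\<^sub>i\<^sub>,\<^sub>l\<close> variables. By the hypothesis on the degrees
  the number of variables exceeds the sum of the degrees, and over a \<open>C\<^sub>1\<close> field with normic forms of
  every degree such a system has a nontrivial solution by the argument of Lang and Nagata
  (\<open>common_zero_forms\<close>). Normic forms vanish only trivially, so the resulting coordinates are
  not all zero (\<open>solve_factor\<close>). An orbit of equations is solved once the last orbit of factors
  is reached in which it has positive degree; there is such an orbit of factors since the
  equations are not constant.\<close>

section \<open>Field embeddings\<close>

lemma field_embedding_0: "field_embedding f \<Longrightarrow> f 0 = 0"
  unfolding field_embedding_def by (metis add_cancel_right_right)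

lemma field_embedding_add: "field_embedding f \<Longrightarrow> f (x + y) = f x + f y"
  and field_embedding_mult: "field_embedding f \<Longrightarrow> f (x * y) = f x * f y"
  and field_embedding_1: "field_embedding f \<Longrightarrow> f 1 = 1"
  by (auto simp: field_embedding_def)

lemma field_embedding_eq_0_iff:
  assumes "field_embedding f" shows "f x = 0 \<longleftrightarrow> x = 0"
proof (cases "x = 0")
  case False
  then have "f x * f (inverse x) = 1"
    using assms field_embedding_mult[of f x "inverse x"] by (simp add: field_embedding_1)
  then show ?thesis using False by force
qed (simp add: assms field_embedding_0)

lemma field_embedding_uminus:
  assumes "field_embedding f" shows "f (- x) = - f x"
  using field_embedding_add[OF assms, of x "- x"] field_embedding_0[OF assms]
  by (metis add.right_inverse add_eq_0_iff)

lemma field_embedding_diff: "field_embedding f \<Longrightarrow> f (x - y) = f x - f y"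
  using field_embedding_add[of f x "- y"] by (simp add: field_embedding_uminus)

lemma field_embedding_inj: "field_embedding f \<Longrightarrow> inj f"
  by (metis (no_types, lifting) field_embedding_diff field_embedding_eq_0_iff injI right_minus_eq)

lemma field_embedding_inverse:
  assumes "field_embedding f" shows "f (inverse x) = inverse (f x)"
proof (cases "x = 0")
  case False
  then have "f x * f (inverse x) = 1"
    using assms field_embedding_mult[of f x "inverse x"] by (simp add: field_embedding_1)
  then show ?thesis using inverse_unique by metis
qed (simp add: assms field_embedding_0)

lemma field_embedding_power: "field_embedding f \<Longrightarrow> f (x ^ n) = f x ^ n"
  by (induction n) (auto simp: field_embedding_1 field_embedding_mult)

lemma field_embedding_sum: "field_embedding f \<Longrightarrow> f (sum g A) = (\<Sum>a\<in>A. f (g a))"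
  by (induction A rule: infinite_finite_induct) (auto simp: field_embedding_0 field_embedding_add)

lemma field_embedding_prod: "field_embedding f \<Longrightarrow> f (prod g A) = (\<Prod>a\<in>A. f (g a))"
  by (induction A rule: infinite_finite_induct) (auto simp: field_embedding_1 field_embedding_mult)

lemma field_embedding_poly:
  assumes "field_embedding f" shows "f (poly p x) = poly (map_poly f p) (f x)"
  by (induction p)
    (auto simp: map_poly_pCons field_embedding_0[OF assms] field_embedding_add[OF assms]
       field_embedding_mult[OF assms])

lemma map_poly_embedding_add:
  "field_embedding f \<Longrightarrow> map_poly f (p + q) = map_poly f p + map_poly f q"
  by (intro poly_eqI) (simp add: coeff_map_poly field_embedding_0 field_embedding_add)

lemma map_poly_embedding_mult:
  "field_embedding f \<Longrightarrow> map_poly f (p * q) = map_poly f p * map_poly f q"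
  by (intro poly_eqI)
    (simp add: coeff_map_poly field_embedding_0 coeff_mult field_embedding_sum field_embedding_mult)

lemma map_poly_embedding_pderiv:
  assumes "field_embedding f" shows "map_poly f (pderiv p) = pderiv (map_poly f p)"
proof -
  have "f (of_nat n) = of_nat n" for n
    by (induction n) (simp_all add: assms field_embedding_0 field_embedding_1 field_embedding_add)
  then show ?thesis
    by (intro poly_eqI)
      (simp add: coeff_map_poly assms field_embedding_0 coeff_pderiv field_embedding_mult
         del: of_nat_Suc)
qed

lemma map_poly_embedding_eq_0_iff:
  "field_embedding f \<Longrightarrow> map_poly f p = 0 \<longleftrightarrow> p = 0"
  by (auto simp: poly_eq_iff coeff_map_poly field_embedding_0 field_embedding_eq_0_iff)

lemma field_embedding_id: "field_embedding (id :: 'a::field \<Rightarrow> 'a)"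
  by (simp add: field_embedding_def)

lemma field_embedding_comp:
  "field_embedding f \<Longrightarrow> field_embedding g \<Longrightarrow> field_embedding (f \<circ> g)"
  unfolding field_embedding_def by simp

section \<open>Galois automorphisms of a separable closure\<close>

text \<open>An element of least degree in the ideal generated by \<open>p\<close> and \<open>q\<close> divides both of them.\<close>

lemma coprime_poly_bezout:
  fixes p q :: "'k::field poly"
  assumes "coprime p q"
  shows "\<exists>u v. u * p + v * q = 1"
proof -
  define I where "I = {u * p + v * q | u v. True}"
  have "p \<noteq> 0 \<or> q \<noteq> 0" using assms by auto
  moreover have "p \<in> I" "q \<in> I"
  proof -
    have "p = 1 * p + 0 * q" "q = 0 * p + 1 * q" by simp_all
    then show "p \<in> I" "q \<in> I" unfolding I_def by blast+
  qed
  ultimately have ex: "\<exists>g. g \<in> I \<and> g \<noteq> 0" by auto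
  obtain g where g: "g \<in> I" "g \<noteq> 0" and mn: "\<And>h. h \<in> I \<Longrightarrow> h \<noteq> 0 \<Longrightarrow> degree g \<le> degree h"
    using ex_has_least_nat[of "\<lambda>g. g \<in> I \<and> g \<noteq> 0" _ degree] ex by blast
  have dvd: "g dvd h" if "h \<in> I" for h
  proof -
    obtain u v where h: "h = u * p + v * q" using \<open>h \<in> I\<close> unfolding I_def by blast
    obtain u' v' where g': "g = u' * p + v' * q" using g(1) unfolding I_def by blast
    define e where "e = h div g"
    have "h mod g = h - e * g" by (simp add: e_def minus_div_mult_eq_mod)
    also have "\<dots> = (u - e * u') * p + (v - e * v') * q"
      by (simp add: h g' algebra_simps)
    finally have "h mod g \<in> I" unfolding I_def by blast
    then have "h mod g = 0" using mn degree_mod_less'[of g h] g(2) by fastforce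
    then show ?thesis by auto
  qed
  have "g dvd 1" using assms dvd \<open>p \<in> I\<close> \<open>q \<in> I\<close> by (auto simp: coprime_def)
  then obtain h where "1 = g * h" by auto
  moreover obtain u v where "g = u * p + v * q" using g(1) unfolding I_def by blast
  ultimately have "(h * u) * p + (h * v) * q = 1" by (simp add: algebra_simps)
  then show ?thesis by blast
qed

text \<open>Coprimality survives the extension of the field because it is witnessed by a Bezout identity.\<close>

lemma separable_poly_map:
  assumes "field_embedding f" "separable_poly p"
  shows "separable_poly (map_poly f p)"
proof -
  obtain u v where "u * p + v * pderiv p = 1"
    using assms(2) coprime_poly_bezout unfolding separable_poly_def by blast
  then have "map_poly f (u * p + v * pderiv p) = 1"
    by (simp add: field_embedding_1[OF assms(1)] )
  then have "map_poly f u * map_poly f p + map_poly f v * pderiv (map_poly f p) = 1"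
    using assms(1)
    by (simp add: map_poly_embedding_add map_poly_embedding_mult map_poly_embedding_pderiv)
  then show ?thesis unfolding separable_poly_def
    by (metis coprimeI dvd_add dvd_mult)
qed

lemma separable_poly_dvd:
  assumes "separable_poly p" "q dvd p"
  shows "separable_poly q"
  unfolding separable_poly_def
proof (rule coprimeI)
  fix c assume c: "c dvd q" "c dvd pderiv q"
  obtain r where r: "p = q * r" using assms(2) by auto
  have "pderiv p = q * pderiv r + r * pderiv q" by (simp add: r pderiv_mult)
  then have "c dvd p" "c dvd pderiv p" using c by (auto simp: r)
  then show "is_unit c" using assms(1) unfolding separable_poly_def by (meson coprime_common_divisor)
qed

text \<open>An isomorphism between subrings of \<open>'a\<close> is represented by its graph, a subring of the
  product ring; polynomials over its domain and their images become pairs of polynomials whose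
  coefficients are related.\<close>

definition partial_hom :: "('k::field \<Rightarrow> 'a::field) \<Rightarrow> ('a \<times> 'a) set \<Rightarrow> bool" where
  "partial_hom \<iota> g \<longleftrightarrow>
     (\<forall>c. (\<iota> c, \<iota> c) \<in> g) \<and>
     (\<forall>x y x' y'. (x, y) \<in> g \<and> (x', y') \<in> g \<longrightarrow> (x + x', y + y') \<in> g \<and> (x * x', y * y') \<in> g) \<and>
     (\<forall>y. (0, y) \<in> g \<longrightarrow> y = 0)"

definition poly_pair :: "('a \<times> 'a) set \<Rightarrow> 'a::field poly \<Rightarrow> 'a poly \<Rightarrow> bool" where
  "poly_pair g p q \<longleftrightarrow> (\<forall>i. (coeff p i, coeff q i) \<in> g)"

context
  fixes \<iota> :: "'k::field \<Rightarrow> 'a::field" and g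
  assumes emb: "field_embedding \<iota>" and g: "partial_hom \<iota> g"
begin

lemma partial_hom_const: "(\<iota> c, \<iota> c) \<in> g"
  and partial_hom_add: "(x, y) \<in> g \<Longrightarrow> (x', y') \<in> g \<Longrightarrow> (x + x', y + y') \<in> g"
  and partial_hom_mult: "(x, y) \<in> g \<Longrightarrow> (x', y') \<in> g \<Longrightarrow> (x * x', y * y') \<in> g"
  and partial_hom_0D: "(0, z) \<in> g \<Longrightarrow> z = 0"
  using g unfolding partial_hom_def by blast+

lemma partial_hom_0: "(0, 0) \<in> g" and partial_hom_1: "(1, 1) \<in> g"
  using partial_hom_const[of 0] partial_hom_const[of 1] emb
  by (simp_all add: field_embedding_0 field_embedding_1)

lemma partial_hom_uminus: "(x, y) \<in> g \<Longrightarrow> (- x, - y) \<in> g"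
  using partial_hom_mult[OF partial_hom_const[of "-1"]] emb
  by (fastforce simp: field_embedding_uminus field_embedding_1)

lemma partial_hom_diff: "(x, y) \<in> g \<Longrightarrow> (x', y') \<in> g \<Longrightarrow> (x - x', y - y') \<in> g"
  using partial_hom_add[OF _ partial_hom_uminus] by fastforce

lemma partial_hom_unique: "(x, y) \<in> g \<Longrightarrow> (x, z) \<in> g \<Longrightarrow> y = z"
  using partial_hom_diff[of x y x z] partial_hom_0D by force

lemma partial_hom_sum:
  "(\<And>i. i \<in> A \<Longrightarrow> (f i, h i) \<in> g) \<Longrightarrow> (sum f A, sum h A) \<in> g"
  by (induction A rule: infinite_finite_induct) (auto simp: partial_hom_0 partial_hom_add)

lemma partial_hom_power: "(x, y) \<in> g \<Longrightarrow> (x ^ n, y ^ n) \<in> g"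
  by (induction n) (auto simp: partial_hom_1 partial_hom_mult)

lemma partial_hom_poly:
  assumes "poly_pair g p q" "(x, y) \<in> g"
  shows "(poly p x, poly q y) \<in> g"
proof -
  have "poly p x = (\<Sum>i\<le>max (degree p) (degree q). coeff p i * x ^ i)" for x
    unfolding poly_altdef by (rule sum.mono_neutral_left) (auto intro: coeff_eq_0)
  moreover have "poly q y = (\<Sum>i\<le>max (degree p) (degree q). coeff q i * y ^ i)" for y
    unfolding poly_altdef by (rule sum.mono_neutral_left) (auto intro: coeff_eq_0)
  ultimately show ?thesis using assms
    by (auto simp: poly_pair_def intro!: partial_hom_sum partial_hom_mult partial_hom_power)
qed

lemma poly_pair_const: "poly_pair g (map_poly \<iota> p) (map_poly \<iota> p)"
  unfolding poly_pair_def by (simp add: coeff_map_poly emb field_embedding_0 partial_hom_const)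

lemma poly_pair_add: "poly_pair g p q \<Longrightarrow> poly_pair g p' q' \<Longrightarrow> poly_pair g (p + p') (q + q')"
  unfolding poly_pair_def by (simp add: partial_hom_add)

lemma poly_pair_diff: "poly_pair g p q \<Longrightarrow> poly_pair g p' q' \<Longrightarrow> poly_pair g (p - p') (q - q')"
  unfolding poly_pair_def by (simp add: partial_hom_diff)

lemma poly_pair_mult: "poly_pair g p q \<Longrightarrow> poly_pair g p' q' \<Longrightarrow> poly_pair g (p * p') (q * q')"
  unfolding poly_pair_def coeff_mult by (auto intro!: partial_hom_sum partial_hom_mult)

lemma poly_pair_monom: "(x, y) \<in> g \<Longrightarrow> poly_pair g (monom x n) (monom y n)"
  unfolding poly_pair_def by (auto simp: partial_hom_0)

lemma poly_pair_0D: "poly_pair g 0 q \<Longrightarrow> q = 0"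
  unfolding poly_pair_def using partial_hom_0D by (auto intro: poly_eqI)

text \<open>The domain of a partial homomorphism is a field because it is algebraic over the base
  field: the inverse of a root of an irreducible polynomial is a polynomial in that root.\<close>

lemma partial_hom_inverse:
  assumes "irreducible p" "poly (map_poly \<iota> p) x = 0" "(x, y) \<in> g" "x \<noteq> 0"
  shows "\<exists>y'. (inverse x, y') \<in> g"
proof -
  obtain c p1 where p: "p = pCons c p1" by (cases p)
  have eq: "\<iota> c + x * poly (map_poly \<iota> p1) x = 0"
    using assms(2) by (simp add: p map_poly_pCons emb field_embedding_0)
  have "c \<noteq> 0"
  proof
    assume c: "c = 0"
    then have "p = [:0, 1:] * p1" by (simp add: p)
    then have "is_unit p1" using assms(1) irreducible_multD
      by (metis degree_pCons_eq_if is_unit_iff_degree one_neq_zero zero_neq_one mult_zero_left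
          degree_pCons_0 pCons_eq_0_iff degree_1 nat.distinct(1))
    then obtain e where e: "p1 = [:e:]" "e \<noteq> 0" by (metis is_unit_polyE is_unit_pCons_iff)
    then show False using eq c assms(4) emb
      by (auto simp: map_poly_pCons field_embedding_0 field_embedding_eq_0_iff)
  qed
  then have "\<iota> c \<noteq> 0" by (simp add: emb field_embedding_eq_0_iff)
  then have "inverse x = \<iota> (- inverse c) * poly (map_poly \<iota> p1) x"
  proof -
    have "x * poly (map_poly \<iota> p1) x = - \<iota> c" using eq by (simp add: eq_neg_iff_add_eq_0 add.commute)
    then show ?thesis using assms(4) \<open>\<iota> c \<noteq> 0\<close> unfolding field_embedding_uminus[OF emb]
        field_embedding_inverse[OF emb] by (simp add: field_simps)
  qed
  then show ?thesis
    using partial_hom_mult[OF partial_hom_const partial_hom_poly[OF poly_pair_const assms(3)]]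
    by metis
qed

end

lemma separable_closureD:
  fixes \<iota> :: "'k::field \<Rightarrow> 'a::field"
  assumes "separable_closure \<iota>"
  shows "field_embedding \<iota>"
    and "\<exists>p. irreducible p \<and> separable_poly p \<and> poly (map_poly \<iota> p) x = 0"
    and "0 < degree (q :: 'a poly) \<Longrightarrow> separable_poly q \<Longrightarrow> \<exists>x. poly q x = 0"
  using assms unfolding separable_closure_def by blast+

text \<open>The pair below is the minimal polynomial of \<open>z\<close> over the domain of \<open>g\<close>, together with its
  image under the partial homomorphism.\<close>

lemma ex_minimal_poly_pair:
  assumes emb: "field_embedding \<iota>" and g: "partial_hom \<iota> g"
    and alg: "\<And>x. \<exists>p. irreducible p \<and> poly (map_poly \<iota> p) x = 0"
  shows "\<exists>q1 q2. poly_pair g q1 q2 \<and> poly q1 z = 0 \<and> lead_coeff q1 = 1 \<and> degree q2 = degree q1 \<and>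
    (\<forall>h1 h2. poly_pair g h1 h2 \<and> poly h1 z = 0 \<longrightarrow> q2 dvd h2)"
proof -
  define I where "I = (\<lambda>(h1, h2). poly_pair g h1 h2 \<and> poly h1 z = 0 \<and> h1 \<noteq> 0)"
  obtain p where p: "irreducible p" "poly (map_poly \<iota> p) z = 0" using alg by blast
  have "I (map_poly \<iota> p, map_poly \<iota> p)"
    unfolding I_def using p emb irreducible_imp_prime_elem
    by (auto simp: poly_pair_const[OF emb g] map_poly_embedding_eq_0_iff)
  then obtain h where h: "I h" and mn: "\<And>h'. I h' \<Longrightarrow> degree (fst h) \<le> degree (fst h')"
    using ex_has_least_nat[of I _ "\<lambda>h. degree (fst h)"] by blast
  obtain h1 h2 where hh: "h = (h1, h2)" by (cases h)
  have h1: "poly_pair g h1 h2" "poly h1 z = 0" "h1 \<noteq> 0" using h by (auto simp: I_def hh)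
  have lc: "(lead_coeff h1, coeff h2 (degree h1)) \<in> g" using h1(1) by (simp add: poly_pair_def)
  obtain p' where p': "irreducible p'" "poly (map_poly \<iota> p') (lead_coeff h1) = 0" using alg by blast
  obtain e where e: "(inverse (lead_coeff h1), e) \<in> g"
    using partial_hom_inverse[OF emb g p' lc] h1(3) by auto
  define q1 where "q1 = smult (inverse (lead_coeff h1)) h1"
  define q2 where "q2 = smult e h2"
  have q: "poly_pair g q1 q2"
    using poly_pair_mult[OF emb g poly_pair_monom[OF emb g e, of 0] h1(1)]
    by (simp add: q1_def q2_def monom_0)
  have q1: "poly q1 z = 0" "lead_coeff q1 = 1" "degree q1 = degree h1" "q1 \<noteq> 0"
    using h1 by (auto simp: q1_def)
  have q2lc: "coeff q2 (degree q1) = 1"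
  proof -
    have "(1, coeff q2 (degree q1)) \<in> g" using q q1(2) unfolding poly_pair_def by metis
    then show ?thesis using partial_hom_unique[OF emb g partial_hom_1[OF emb g]] by metis
  qed
  have "coeff q2 i = 0" if "i > degree q1" for i
    using q that partial_hom_0D[OF emb g] coeff_eq_0[OF that] unfolding poly_pair_def by metis
  then have deg2: "degree q2 = degree q1"
    using q2lc by (metis degree_le le_antisym le_degree zero_neq_one)
  have dvd: "q2 dvd k2" if "poly_pair g k1 k2" "poly k1 z = 0" for k1 k2
    using that
  proof (induction "degree k1" arbitrary: k1 k2 rule: less_induct)
    case less
    show ?case
    proof (cases "k1 = 0")
      case True
      then have "k2 = 0" using poly_pair_0D[OF emb g less.prems(1)[unfolded True]] by simp
      then show ?thesis by simp
    next
      case False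
      then have "degree q1 \<le> degree k1" using mn[of "(k1, k2)"] less.prems by (simp add: I_def hh q1)
      define n where "n = degree k1 - degree q1"
      have c: "(lead_coeff k1, coeff k2 (degree k1)) \<in> g"
        using less.prems by (simp add: poly_pair_def)
      define m1 where "m1 = monom (lead_coeff k1) n"
      define m2 where "m2 = monom (coeff k2 (degree k1)) n"
      have pp: "poly_pair g (k1 - m1 * q1) (k2 - m2 * q2)"
        unfolding m1_def m2_def
        by (intro poly_pair_diff[OF emb g] poly_pair_mult[OF emb g] poly_pair_monom[OF emb g] q c less.prems)
      have rt: "poly (k1 - m1 * q1) z = 0" using less.prems q1 by simp
      have degm: "degree (m1 * q1) = degree k1"
        using False q1 \<open>degree q1 \<le> degree k1\<close>
        by (auto simp: m1_def degree_mult_eq degree_monom_eq n_def monom_eq_0_iff)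
      have lcm: "coeff (m1 * q1) (degree k1) = lead_coeff k1"
      proof -
        have "lead_coeff (m1 * q1) = lead_coeff m1 * lead_coeff q1" by (rule lead_coeff_mult)
        moreover have "lead_coeff m1 = lead_coeff k1" unfolding m1_def by (rule lead_coeff_monom)
        ultimately show ?thesis using q1(2) degm by simp
      qed
      have "q2 dvd k2 - m2 * q2"
      proof (cases "k1 - m1 * q1 = 0")
        case True
        have "k2 - m2 * q2 = 0" using poly_pair_0D[OF emb g pp[unfolded True]] .
        then show ?thesis by simp
      next
        case nz: False
        have "degree (k1 - m1 * q1) \<le> degree k1" using degm degree_diff_le_max[of k1 "m1 * q1"] by simp
        moreover have "coeff (k1 - m1 * q1) (degree k1) = 0" using lcm by simp
        ultimately have "degree (k1 - m1 * q1) < degree k1"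
          using nz by (metis leading_coeff_0_iff le_neq_implies_less)
        then show ?thesis using less.hyps pp rt by blast
      qed
      then show ?thesis by (metis dvd_diffD dvd_triv_right diff_add_cancel dvd_add)
    qed
  qed
  show ?thesis using q q1 deg2 dvd by blast
qed

definition adjoin_pair :: "('a \<times> 'a) set \<Rightarrow> 'a::field \<Rightarrow> 'a \<Rightarrow> ('a \<times> 'a) set" where
  "adjoin_pair g z z' = {(poly p z, poly q z') | p q. poly_pair g p q}"

text \<open>The graph \<open>adjoin_pair g z z'\<close> is single-valued as soon as \<open>z'\<close> satisfies the image of every
  polynomial relation of \<open>z\<close> over the domain of \<open>g\<close>.\<close>

lemma partial_hom_adjoin:
  assumes emb: "field_embedding \<iota>" and g: "partial_hom \<iota> g"
    and rel: "\<And>p q. poly_pair g p q \<Longrightarrow> poly p z = 0 \<Longrightarrow> poly q z' = 0"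
  shows "partial_hom \<iota> (adjoin_pair g z z')" "g \<subseteq> adjoin_pair g z z'" "(z, z') \<in> adjoin_pair g z z'"
proof -
  show sub: "g \<subseteq> adjoin_pair g z z'"
  proof
    fix xy assume "xy \<in> g"
    then have "poly_pair g [:fst xy:] [:snd xy:]"
      using poly_pair_monom[OF emb g, of "fst xy" "snd xy" 0] by (simp add: monom_0)
    then show "xy \<in> adjoin_pair g z z'" unfolding adjoin_pair_def
      by (intro CollectI exI[of _ "[:fst xy:]"] exI[of _ "[:snd xy:]"]) simp
  qed
  have "poly_pair g [:0, 1:] [:0, 1:]"
    using poly_pair_monom[OF emb g partial_hom_1[OF emb g], of 1]
    by (simp add: monom_altdef)
  then show "(z, z') \<in> adjoin_pair g z z'" unfolding adjoin_pair_def
    by (intro CollectI exI[of _ "[:0, 1:]"]) simp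
  show "partial_hom \<iota> (adjoin_pair g z z')"
    unfolding partial_hom_def
  proof (intro conjI allI impI)
    show "(\<iota> c, \<iota> c) \<in> adjoin_pair g z z'" for c using sub partial_hom_const[OF emb g] by blast
  next
    fix x y x' y' assume "(x, y) \<in> adjoin_pair g z z' \<and> (x', y') \<in> adjoin_pair g z z'"
    then obtain p q p' q' where pq: "poly_pair g p q" "poly_pair g p' q'" "x = poly p z" "y = poly q z'"
      "x' = poly p' z" "y' = poly q' z'" unfolding adjoin_pair_def by blast
    show "(x + x', y + y') \<in> adjoin_pair g z z'" unfolding adjoin_pair_def
      by (intro CollectI exI[of _ "p + p'"] exI[of _ "q + q'"]) (simp add: pq poly_pair_add[OF emb g])
    show "(x * x', y * y') \<in> adjoin_pair g z z'" unfolding adjoin_pair_def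
      by (intro CollectI exI[of _ "p * p'"] exI[of _ "q * q'"]) (simp add: pq poly_pair_mult[OF emb g])
  next
    fix y assume "(0, y) \<in> adjoin_pair g z z'"
    then show "y = 0" unfolding adjoin_pair_def using rel by auto
  qed
qed

text \<open>A maximal extension of the given partial homomorphism is defined everywhere: the image of the
  minimal polynomial of a further element would again divide a separable polynomial over the
  base field, so it would have a root to which the element could be sent. The extension is onto
  since it permutes the finitely many roots of each polynomial over the base field.\<close>

lemma partial_hom_extends_to_Gal:
  assumes sc: "separable_closure \<iota>" and g0: "partial_hom \<iota> g0" and zz: "(z, z') \<in> g0"
  shows "\<exists>\<sigma>\<in>Gal \<iota>. \<sigma> z = z'"
proof -
  note emb = separable_closureD(1)[OF sc]
  define A where "A = {g. partial_hom \<iota> g \<and> g0 \<subseteq> g}"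
  have "\<exists>M\<in>A. \<forall>X\<in>A. M \<subseteq> X \<longrightarrow> X = M"
  proof (rule subset_Zorn_nonempty)
    show "A \<noteq> {}" using g0 by (auto simp: A_def)
  next
    fix \<C> assume ne: "\<C> \<noteq> {}" and ch: "subset.chain A \<C>"
    have C: "\<And>g. g \<in> \<C> \<Longrightarrow> partial_hom \<iota> g \<and> g0 \<subseteq> g" using ch by (auto simp: subset.chain_def A_def)
    have dir: "\<exists>g\<in>\<C>. xy \<in> g \<and> xy' \<in> g" if "xy \<in> \<Union>\<C>" "xy' \<in> \<Union>\<C>" for xy xy'
      using that ch unfolding subset.chain_def by blast
    have "partial_hom \<iota> (\<Union>\<C>)"
      unfolding partial_hom_def
    proof (intro conjI allI impI)
      show "(\<iota> c, \<iota> c) \<in> \<Union>\<C>" for c using ne C unfolding partial_hom_def by blast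
    next
      fix x y x' y' assume "(x, y) \<in> \<Union>\<C> \<and> (x', y') \<in> \<Union>\<C>"
      then obtain g where g: "g \<in> \<C>" "(x, y) \<in> g" "(x', y') \<in> g" using dir by blast
      then have "(x + x', y + y') \<in> g" "(x * x', y * y') \<in> g" using C unfolding partial_hom_def by blast+
      then show "(x + x', y + y') \<in> \<Union>\<C>" "(x * x', y * y') \<in> \<Union>\<C>" using g by blast+
    next
      fix y assume "(0, y) \<in> \<Union>\<C>"
      then show "y = 0" using C unfolding partial_hom_def by blast
    qed
    then show "\<Union>\<C> \<in> A" using ne C by (auto simp: A_def)
  qed
  then obtain M where M: "partial_hom \<iota> M" "g0 \<subseteq> M"
    and mx: "\<And>X. partial_hom \<iota> X \<Longrightarrow> g0 \<subseteq> X \<Longrightarrow> M \<subseteq> X \<Longrightarrow> X = M" unfolding A_def by auto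
  have dom: "\<exists>y. (x, y) \<in> M" for x
  proof -
    obtain q1 q2 where q: "poly_pair M q1 q2" "poly q1 x = 0" "lead_coeff q1 = 1" "degree q2 = degree q1"
      "\<And>h1 h2. poly_pair M h1 h2 \<Longrightarrow> poly h1 x = 0 \<Longrightarrow> q2 dvd h2"
      using ex_minimal_poly_pair[OF emb M(1)] separable_closureD(2)[OF sc] by metis
    obtain p where p: "separable_poly p" "poly (map_poly \<iota> p) x = 0"
      using separable_closureD(2)[OF sc] by blast
    have "q2 dvd map_poly \<iota> p" using q(5) poly_pair_const[OF emb M(1)] p by blast
    then have sep: "separable_poly q2" using separable_poly_dvd separable_poly_map[OF emb p(1)] by blast
    have "degree q1 \<noteq> 0"
    proof
      assume "degree q1 = 0"
      then obtain c where "q1 = [:c:]" by (metis degree_eq_zeroE)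
      then show False using q(2,3) by simp
    qed
    then obtain y where y: "poly q2 y = 0" using separable_closureD(3)[OF sc _ sep] q(4) by auto
    have rel: "poly h2 y = 0" if "poly_pair M h1 h2" "poly h1 x = 0" for h1 h2
      using q(5)[OF that] y by (metis dvd_trans poly_eq_0_iff_dvd)
    have "partial_hom \<iota> (adjoin_pair M x y)" "M \<subseteq> adjoin_pair M x y" and adj: "(x, y) \<in> adjoin_pair M x y"
      by (rule partial_hom_adjoin[OF emb M(1)], rule rel, assumption+)+
    then have "adjoin_pair M x y = M" using mx M(2) by blast
    then show ?thesis using adj by blast
  qed
  define \<sigma> where "\<sigma> x = (SOME y. (x, y) \<in> M)" for x
  have \<sigma>M: "(x, \<sigma> x) \<in> M" for x unfolding \<sigma>_def using dom by (rule someI_ex)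
  have \<sigma>_eq: "\<sigma> x = y" if "(x, y) \<in> M" for x y using partial_hom_unique[OF emb M(1) \<sigma>M that] .
  have \<sigma>emb: "field_embedding \<sigma>" unfolding field_embedding_def
    using \<sigma>_eq \<sigma>M partial_hom_add[OF emb M(1)] partial_hom_mult[OF emb M(1)] partial_hom_1[OF emb M(1)]
    by blast
  have fxd: "\<sigma> (\<iota> c) = \<iota> c" for c by (rule \<sigma>_eq) (rule partial_hom_const[OF emb M(1)])
  have "surj \<sigma>"
  proof -
    have "y \<in> range \<sigma>" for y
    proof -
      obtain p where p: "irreducible p" "poly (map_poly \<iota> p) y = 0"
        using separable_closureD(2)[OF sc] by blast
      have pn: "map_poly \<iota> p \<noteq> 0" using p emb by (auto simp: map_poly_embedding_eq_0_iff)
      let ?Z = "{x. poly (map_poly \<iota> p) x = 0}"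
      have fin: "finite ?Z" using poly_roots_finite[OF pn] .
      have mp: "map_poly \<sigma> (map_poly \<iota> p) = map_poly \<iota> p"
        by (rule poly_eqI) (simp add: coeff_map_poly field_embedding_0 \<sigma>emb emb fxd)
      have "poly (map_poly \<iota> p) (\<sigma> x) = \<sigma> (poly (map_poly \<iota> p) x)" for x
        using field_embedding_poly[OF \<sigma>emb, of "map_poly \<iota> p" x] mp by simp
      then have "\<sigma> ` ?Z \<subseteq> ?Z" by (auto simp: field_embedding_0[OF \<sigma>emb])
      then have "\<sigma> ` ?Z = ?Z"
        using fin endo_inj_surj[OF fin] inj_on_subset[OF field_embedding_inj[OF \<sigma>emb]] by blast
      then show ?thesis using p by blast
    qed
    then show ?thesis by blast
  qed
  then have "\<sigma> \<in> Gal \<iota>" unfolding Gal_def using \<sigma>emb fxd field_embedding_inj[OF \<sigma>emb] by (auto simp: bij_def)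
  moreover have "\<sigma> z = z'" using \<sigma>_eq zz M(2) by blast
  ultimately show ?thesis by blast
qed

text \<open>The minimal polynomial of an element outside the base field has degree at least two and,
  being separable, a second root; a Galois automorphism takes the element there.\<close>

lemma Gal_fixed_imp_base:
  assumes sc: "separable_closure \<iota>" and fx: "\<And>\<sigma>. \<sigma> \<in> Gal \<iota> \<Longrightarrow> \<sigma> x = x"
  shows "x \<in> range \<iota>"
proof (rule ccontr)
  assume nx: "x \<notin> range \<iota>"
  note emb = separable_closureD(1)[OF sc]
  define g where "g = range (\<lambda>c. (\<iota> c, \<iota> c))"
  have g: "partial_hom \<iota> g"
    unfolding partial_hom_def g_def
    by (auto simp: field_embedding_add[OF emb, symmetric] field_embedding_mult[OF emb, symmetric])
  obtain q1 q2 where q: "poly_pair g q1 q2" "poly q1 x = 0" "lead_coeff q1 = 1" "degree q2 = degree q1"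
      "\<And>h1 h2. poly_pair g h1 h2 \<Longrightarrow> poly h1 x = 0 \<Longrightarrow> q2 dvd h2"
    using ex_minimal_poly_pair[OF emb g] separable_closureD(2)[OF sc] by metis
  have q12: "q2 = q1" using q(1) unfolding poly_pair_def g_def by (metis (no_types, lifting) Pair_inject imageE poly_eqI)
  obtain p where p: "separable_poly p" "poly (map_poly \<iota> p) x = 0"
    using separable_closureD(2)[OF sc] by blast
  have "q2 dvd map_poly \<iota> p" using q(5) poly_pair_const[OF emb g] p by blast
  then have sep: "separable_poly q2" using separable_poly_dvd separable_poly_map[OF emb p(1)] by blast
  obtain t where t: "q2 = [:- x, 1:] * t" using q(2) q12 by (metis poly_eq_0_iff_dvd dvdE)
  have "t \<noteq> 0" using q q12 t by auto
  have "degree t \<noteq> 0"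
  proof
    assume "degree t = 0"
    then obtain c where c: "t = [:c:]" by (metis degree_eq_zeroE)
    then have "c = 1" using q(3) \<open>t \<noteq> 0\<close> unfolding q12[symmetric] t by (simp add: c)
    then have "coeff q2 0 = - x" by (simp add: t c)
    moreover have "(coeff q1 0, coeff q2 0) \<in> g" using q(1) unfolding poly_pair_def by blast
    ultimately obtain c' where "- x = \<iota> c'" unfolding g_def by auto
    then have "x = \<iota> (- c')" using field_embedding_uminus[OF emb] by (metis minus_minus)
    then show False using nx by blast
  qed
  moreover have "separable_poly t" using separable_poly_dvd[OF sep] t dvd_triv_right by metis
  ultimately obtain y where y: "poly t y = 0" using separable_closureD(3)[OF sc] by blast
  have "y \<noteq> x"
  proof
    assume "y = x"
    then obtain t' where t': "t = [:- x, 1:] * t'" using y by (metis poly_eq_0_iff_dvd dvdE)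
    have "[:- x, 1:] dvd q2" unfolding t by (rule dvd_triv_left)
    moreover have "[:- x, 1:] dvd pderiv q2" unfolding t t' pderiv_mult
      by (intro dvd_add dvd_mult2 dvd_mult) (rule dvd_refl)+
    ultimately have "is_unit [:- x, 1:]" using sep unfolding separable_poly_def
      by (meson coprime_common_divisor)
    then show False by (simp add: is_unit_pCons_iff)
  qed
  have rel: "poly h2 y = 0" if "poly_pair g h1 h2" "poly h1 x = 0" for h1 h2
    using q(5)[OF that] y t by (metis dvd_trans poly_eq_0_iff_dvd dvd_mult)
  have "partial_hom \<iota> (adjoin_pair g x y)" "(x, y) \<in> adjoin_pair g x y"
    by (rule partial_hom_adjoin[OF emb g], rule rel, assumption+)+
  then obtain \<sigma> where "\<sigma> \<in> Gal \<iota>" "\<sigma> x = y" using partial_hom_extends_to_Gal[OF sc] by blast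
  then show False using fx \<open>y \<noteq> x\<close> by auto
qed

section \<open>Equivariant vectors\<close>

lemma Gal_emb: "\<sigma> \<in> Gal \<iota> \<Longrightarrow> field_embedding \<sigma>"
  and Gal_bij: "\<sigma> \<in> Gal \<iota> \<Longrightarrow> bij \<sigma>"
  and Gal_base: "\<sigma> \<in> Gal \<iota> \<Longrightarrow> \<sigma> (\<iota> c) = \<iota> c"
  by (auto simp: Gal_def)

lemma Gal_id: "id \<in> Gal \<iota>"
  by (simp add: Gal_def field_embedding_def)

lemma Gal_comp: "\<sigma> \<in> Gal \<iota> \<Longrightarrow> \<tau> \<in> Gal \<iota> \<Longrightarrow> \<sigma> \<circ> \<tau> \<in> Gal \<iota>"
  by (auto simp: Gal_def field_embedding_comp bij_comp)

lemma Gal_inv: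
  assumes "\<sigma> \<in> Gal \<iota>" shows "inv_into UNIV \<sigma> \<in> Gal \<iota>"
proof -
  note e = Gal_emb[OF assms] and b = Gal_bij[OF assms]
  have i: "inv_into UNIV \<sigma> y = x" if "\<sigma> x = y" for x y using b that by (auto simp: bij_def)
  have s: "\<sigma> (inv_into UNIV \<sigma> y) = y" for y using b by (simp add: bij_def surj_f_inv_f)
  have "field_embedding (inv_into UNIV \<sigma>)" unfolding field_embedding_def
    by (auto intro!: i simp: field_embedding_1[OF e] field_embedding_add[OF e] field_embedding_mult[OF e] s)
  then show ?thesis using b by (auto simp: Gal_def bij_imp_bij_inv intro!: i Gal_base[OF assms])
qed

lemma finite_conjugates:
  assumes sc: "separable_closure \<iota>"
  shows "finite ((\<lambda>\<sigma>. \<sigma> x) ` Gal \<iota>)"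
proof -
  note emb = separable_closureD(1)[OF sc]
  obtain p where p: "irreducible p" "poly (map_poly \<iota> p) x = 0"
    using separable_closureD(2)[OF sc] by blast
  have pn: "map_poly \<iota> p \<noteq> 0" using p emb by (auto simp: map_poly_embedding_eq_0_iff)
  have "poly (map_poly \<iota> p) (\<sigma> x) = 0" if s: "\<sigma> \<in> Gal \<iota>" for \<sigma>
  proof -
    have mp: "map_poly \<sigma> (map_poly \<iota> p) = map_poly \<iota> p"
      by (rule poly_eqI) (simp add: coeff_map_poly field_embedding_0 Gal_emb[OF s] emb Gal_base[OF s])
    then show ?thesis
      using field_embedding_poly[OF Gal_emb[OF s], of "map_poly \<iota> p" x] p field_embedding_0[OF Gal_emb[OF s]]
      by simp
  qed
  then have "(\<lambda>\<sigma>. \<sigma> x) ` Gal \<iota> \<subseteq> {x. poly (map_poly \<iota> p) x = 0}" by blast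
  then show ?thesis using poly_roots_finite[OF pn] finite_subset by blast
qed

lemma finite_image_factor:
  assumes "finite (f ` A)" "\<And>x y. x \<in> A \<Longrightarrow> y \<in> A \<Longrightarrow> f x = f y \<Longrightarrow> g x = g y"
  shows "finite (g ` A)"
proof -
  have "g ` A \<subseteq> (\<lambda>z. g (SOME x. x \<in> A \<and> f x = z)) ` f ` A"
  proof
    fix y assume "y \<in> g ` A"
    then obtain x where x: "x \<in> A" "y = g x" by auto
    have "(SOME x'. x' \<in> A \<and> f x' = f x) \<in> A \<and> f (SOME x'. x' \<in> A \<and> f x' = f x) = f x"
      by (rule someI[of "\<lambda>x'. x' \<in> A \<and> f x' = f x" x]) (simp add: x)
    then have "y = g (SOME x'. x' \<in> A \<and> f x' = f x)" using assms(2) x by metis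
    then show "y \<in> (\<lambda>z. g (SOME x. x \<in> A \<and> f x = z)) ` f ` A" using x by blast
  qed
  then show ?thesis using assms(1) finite_surj by blast
qed

text \<open>Vectors are represented by polynomials, the coefficients being the entries.\<close>

lemma vector_space_poly: "vector_space (smult :: 'a::field \<Rightarrow> 'a poly \<Rightarrow> 'a poly)"
  by unfold_locales (simp_all add: smult_add_right smult_add_left)

text \<open>For \<open>x\<close> in a suitable subring of \<open>K\<close>, the vector whose entry at \<open>j\<close> is the sum of the
  conjugates \<open>\<gamma> x\<close> over the (classes of) automorphisms \<open>\<gamma>\<close> with \<open>\<gamma> 1 = j\<close> is equivariant. As in the proof that
  distinct characters are linearly independent, these classes are separated by the elements \<open>x\<close>, so that
  \<open>K\<close>-linear combinations of the vectors produce every unit vector. The vectors thus span a space of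
  dimension \<open>n\<close> over \<open>K\<close>, and \<open>n\<close> of them are linearly independent.\<close>

lemma ex_equivariant_basis:
  fixes \<iota> :: "'k::field \<Rightarrow> 'a::field" and \<rho> :: "('a \<Rightarrow> 'a) \<Rightarrow> nat \<Rightarrow> nat"
  assumes sc: "separable_closure \<iota>"
    and perm: "\<And>\<sigma>. \<sigma> \<in> Gal \<iota> \<Longrightarrow> \<rho> \<sigma> permutes {1..n}"
    and hom: "\<And>\<sigma> \<tau>. \<sigma> \<in> Gal \<iota> \<Longrightarrow> \<tau> \<in> Gal \<iota> \<Longrightarrow> \<rho> (\<sigma> \<circ> \<tau>) = \<rho> \<sigma> \<circ> \<rho> \<tau>"
    and trans: "\<And>j. j \<in> {1..n} \<Longrightarrow> \<exists>\<sigma>\<in>Gal \<iota>. \<rho> \<sigma> 1 = j"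
    and S: "finite S" "\<And>\<sigma>. \<sigma> \<in> Gal \<iota> \<Longrightarrow> (\<And>x. x \<in> S \<Longrightarrow> \<sigma> x = x) \<Longrightarrow> \<rho> \<sigma> = id"
    and n: "1 \<le> n"
  shows "\<exists>w :: nat \<Rightarrow> nat \<Rightarrow> 'a.
    (\<forall>u\<in>{1..n}. \<forall>\<sigma>\<in>Gal \<iota>. \<forall>j\<in>{1..n}. \<sigma> (w u j) = w u (\<rho> \<sigma> j)) \<and>
    (\<forall>c. (\<forall>j\<in>{1..n}. (\<Sum>u=1..n. c u * w u j) = 0) \<longrightarrow> (\<forall>u\<in>{1..n}. c u = 0))"
proof -
  interpret vector_space "smult :: 'a \<Rightarrow> 'a poly \<Rightarrow> 'a poly" by (rule vector_space_poly)
  \<comment> \<open>\<open>R\<close> is finite and Galois stable, so only finitely many automorphisms differ on the ring \<open>L\<close>, and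
    each permutation depends only on the restriction of the automorphism to \<open>R\<close>.\<close>
  define R where "R = {\<sigma> x | \<sigma> x. \<sigma> \<in> Gal \<iota> \<and> x \<in> S}"
  define L where "L = {x. \<forall>\<sigma>\<in>Gal \<iota>. (\<forall>r\<in>R. \<sigma> r = r) \<longrightarrow> \<sigma> x = x}"
  have "R = (\<Union>x\<in>S. (\<lambda>\<sigma>. \<sigma> x) ` Gal \<iota>)" unfolding R_def by blast
  then have finR: "finite R" using S(1) finite_conjugates[OF sc] by blast
  have SR: "S \<subseteq> R" unfolding R_def using Gal_id by (metis (mono_tags, lifting) CollectI id_apply subsetI)
  have RL: "R \<subseteq> L" unfolding L_def by blast
  have stab: "\<sigma> r \<in> R" if "\<sigma> \<in> Gal \<iota>" "r \<in> R" for \<sigma> r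
  proof -
    obtain x \<tau> where "x \<in> S" "\<tau> \<in> Gal \<iota>" "r = \<tau> x" using \<open>r \<in> R\<close> unfolding R_def by blast
    then have "\<sigma> r = (\<sigma> \<circ> \<tau>) x" "\<sigma> \<circ> \<tau> \<in> Gal \<iota>" using Gal_comp[OF that(1)] by auto
    then show ?thesis unfolding R_def using \<open>x \<in> S\<close> by blast
  qed
  have agree: "(\<forall>x\<in>L. \<sigma> x = \<tau> x) \<and> \<rho> \<sigma> = \<rho> \<tau>"
    if st: "\<sigma> \<in> Gal \<iota>" "\<tau> \<in> Gal \<iota>" "\<And>r. r \<in> R \<Longrightarrow> \<sigma> r = \<tau> r" for \<sigma> \<tau>
  proof -
    have ii: "inv_into UNIV \<tau> (\<tau> x) = x" "\<tau> (inv_into UNIV \<tau> x) = x" for x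
      using Gal_bij[OF st(2)] by (auto simp: bij_def surj_f_inv_f)
    have g: "inv_into UNIV \<tau> \<circ> \<sigma> \<in> Gal \<iota>" using Gal_comp Gal_inv st by blast
    have fx: "(inv_into UNIV \<tau> \<circ> \<sigma>) r = r" if "r \<in> R" for r using st(3)[OF that] ii by simp
    then have "(inv_into UNIV \<tau> \<circ> \<sigma>) x = x" if "x \<in> L" for x using that g unfolding L_def by blast
    then have a: "\<sigma> x = \<tau> x" if "x \<in> L" for x using that ii by (metis comp_apply)
    have "\<rho> (inv_into UNIV \<tau> \<circ> \<sigma>) = id" using S(2)[OF g] fx SR by blast
    moreover have "\<tau> \<circ> (inv_into UNIV \<tau> \<circ> \<sigma>) = \<sigma>" using ii by auto
    ultimately have "\<rho> \<sigma> = \<rho> \<tau>" using hom[OF st(2) g] by simp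
    then show ?thesis using a by blast
  qed
  \<comment> \<open>The restrictions to \<open>L\<close> are finite in number; each is paired with the image of \<open>1\<close> under its permutation.\<close>
  define G where "G = (\<lambda>\<sigma>. (restrict \<sigma> L, \<rho> \<sigma> 1)) ` Gal \<iota>"
  have finG: "finite G" unfolding G_def
  proof (rule finite_image_factor[where f = "\<lambda>\<sigma>. restrict \<sigma> R"])
    have "(\<lambda>\<sigma>. restrict \<sigma> R) ` Gal \<iota> \<subseteq> PiE R (\<lambda>_. R)" using stab by auto
    then show "finite ((\<lambda>\<sigma>. restrict \<sigma> R) ` Gal \<iota>)"
      using finR finite_PiE by (metis finite_subset)
  next
    fix \<sigma> \<tau> assume st: "\<sigma> \<in> Gal \<iota>" "\<tau> \<in> Gal \<iota>" "restrict \<sigma> R = restrict \<tau> R"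
    then have "\<sigma> r = \<tau> r" if "r \<in> R" for r using that by (metis restrict_apply')
    then have "(\<forall>x\<in>L. \<sigma> x = \<tau> x) \<and> \<rho> \<sigma> = \<rho> \<tau>" using agree[OF st(1,2)] by blast
    then show "(restrict \<sigma> L, \<rho> \<sigma> 1) = (restrict \<tau> L, \<rho> \<tau> 1)" by auto
  qed
  have L1: "1 \<in> L" unfolding L_def using Gal_emb field_embedding_1 by blast
  have Lm: "x * y \<in> L" if "x \<in> L" "y \<in> L" for x y
    using that unfolding L_def by (auto simp: field_embedding_mult[OF Gal_emb])
  have Gsnd: "snd p \<in> {1..n}" if "p \<in> G" for p
    using that n permutes_in_image[OF perm] unfolding G_def by fastforce
  have Gm: "fst p (x * y) = fst p x * fst p y" if "p \<in> G" "x \<in> L" "y \<in> L" for p x y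
    using that Lm unfolding G_def by (auto simp: field_embedding_mult[OF Gal_emb])
  have G1: "fst p 1 = 1" if "p \<in> G" for p
    using that L1 unfolding G_def by (auto simp: field_embedding_1[OF Gal_emb])
  have Gsep: "\<exists>x\<in>L. fst p x \<noteq> fst q x" if pq: "p \<in> G" "q \<in> G" "p \<noteq> q" for p q
  proof (rule ccontr)
    assume eq: "\<not> ?thesis"
    obtain \<sigma> \<tau> where st: "\<sigma> \<in> Gal \<iota>" "\<tau> \<in> Gal \<iota>" "p = (restrict \<sigma> L, \<rho> \<sigma> 1)" "q = (restrict \<tau> L, \<rho> \<tau> 1)"
      using pq unfolding G_def by blast
    then have "\<sigma> x = \<tau> x" if "x \<in> L" for x using eq that by auto
    then have "(\<forall>x\<in>L. \<sigma> x = \<tau> x) \<and> \<rho> \<sigma> = \<rho> \<tau>" using agree[OF st(1,2)] RL by blast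
    then show False using pq(3) st(3,4) by auto
  qed
  define W where "W = {P :: 'a poly. (\<forall>j. j \<notin> {1..n} \<longrightarrow> coeff P j = 0) \<and>
      (\<forall>\<sigma>\<in>Gal \<iota>. \<forall>j\<in>{1..n}. \<sigma> (coeff P j) = coeff P (\<rho> \<sigma> j))}"
  \<comment> \<open>With \<open>h\<close> the evaluation at an element of \<open>L\<close> this is its trace vector.\<close>
  define T where "T h = (\<Sum>p\<in>G. monom (h p) (snd p))" for h :: "('a \<Rightarrow> 'a) \<times> nat \<Rightarrow> 'a"
  have coeffT: "coeff (T h) j = (\<Sum>p\<in>G. if snd p = j then h p else 0)" for h j
    unfolding T_def by (simp add: coeff_sum)
  have TW: "T (\<lambda>p. fst p x) \<in> W" if x: "x \<in> L" for x
  proof -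
    have out: "coeff (T (\<lambda>p. fst p x)) j = 0" if "j \<notin> {1..n}" for j
      unfolding coeffT using that Gsnd by (intro sum.neutral) auto
    have "\<sigma> (coeff (T (\<lambda>p. fst p x)) j) = coeff (T (\<lambda>p. fst p x)) (\<rho> \<sigma> j)"
      if s: "\<sigma> \<in> Gal \<iota>" for \<sigma> j
    proof -
      \<comment> \<open>Left translation by \<open>\<sigma>\<close>.\<close>
      define \<Phi> where "\<Phi> p = (restrict (\<sigma> \<circ> fst p) L, \<rho> \<sigma> (snd p))" for p :: "('a \<Rightarrow> 'a) \<times> nat"
      have "\<Phi> p \<in> G" if pG: "p \<in> G" for p
      proof -
        obtain \<tau> where t: "\<tau> \<in> Gal \<iota>" "p = (restrict \<tau> L, \<rho> \<tau> 1)" using pG unfolding G_def by blast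
        have "\<Phi> p = (restrict (\<sigma> \<circ> \<tau>) L, \<rho> (\<sigma> \<circ> \<tau>) 1)"
          unfolding \<Phi>_def t using hom[OF s t(1)] by (auto simp: restrict_def)
        then show ?thesis unfolding G_def using Gal_comp[OF s t(1)] by blast
      qed
      moreover have inj: "inj_on \<Phi> G"
      proof (rule inj_onI)
        fix p q assume pq: "p \<in> G" "q \<in> G" "\<Phi> p = \<Phi> q"
        have "fst p y = fst q y" if "y \<in> L" for y
        proof -
          have "\<sigma> (fst p y) = \<sigma> (fst q y)" using pq(3) that unfolding \<Phi>_def
            by (metis Pair_inject comp_apply restrict_apply')
          then show ?thesis using Gal_bij[OF s] by (auto simp: bij_def inj_eq)
        qed
        then show "p = q" using Gsep pq(1,2) by blast
      qed
      ultimately have "\<Phi> ` G = G" using finG by (intro endo_inj_surj) blast+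
      then have bij: "bij_betw \<Phi> G G" using inj by (simp add: bij_betw_def)
      have "coeff (T (\<lambda>p. fst p x)) (\<rho> \<sigma> j) = (\<Sum>p\<in>G. if snd (\<Phi> p) = \<rho> \<sigma> j then fst (\<Phi> p) x else 0)"
        unfolding coeffT by (rule sum.reindex_bij_betw[OF bij, symmetric])
      also have "\<dots> = (\<Sum>p\<in>G. if snd p = j then \<sigma> (fst p x) else 0)"
        using permutes_inj[OF perm[OF s]] x by (intro sum.cong) (auto simp: \<Phi>_def inj_eq)
      also have "\<dots> = \<sigma> (coeff (T (\<lambda>p. fst p x)) j)"
        unfolding coeffT field_embedding_sum[OF Gal_emb[OF s]]
        by (intro sum.cong) (auto simp: field_embedding_0[OF Gal_emb[OF s]])
      finally show ?thesis by simp
    qed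
    then show ?thesis unfolding W_def using out by blast
  qed
  have T_add: "T (\<lambda>p. h p - c * h' p) = T h - smult c (T h')" for h h' c
    by (rule poly_eqI) (auto simp: coeffT sum_distrib_left sum_subtractf[symmetric] intro!: sum.cong)
  have interp: "T (\<lambda>p. fst p x * (\<Prod>q\<in>D. fst p (y q) - c q)) \<in> span W"
    if "finite D" "x \<in> L" "\<And>q. q \<in> D \<Longrightarrow> y q \<in> L"
    for x and D :: "(('a \<Rightarrow> 'a) \<times> nat) set" and y c
    using that
  proof (induction D arbitrary: x rule: finite_induct)
    case empty
    then show ?case using TW span_base by simp
  next
    case (insert q D)
    have "T (\<lambda>p. fst p x * (\<Prod>q\<in>insert q D. fst p (y q) - c q)) =
      T (\<lambda>p. fst p (x * y q) * (\<Prod>q\<in>D. fst p (y q) - c q) - c q * (fst p x * (\<Prod>q\<in>D. fst p (y q) - c q)))"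
      unfolding T_def using insert by (intro sum.cong) (auto simp: Gm algebra_simps)
    also have "\<dots> \<in> span W"
      unfolding T_add using insert by (intro span_diff span_scale insert.IH Lm) auto
    finally show ?case .
  qed
  have units: "monom 1 j \<in> span W" if j: "j \<in> {1..n}" for j
  proof -
    obtain p0 where p0: "p0 \<in> G" "snd p0 = j" using trans[OF j] unfolding G_def by force
    have "\<forall>q\<in>G - {p0}. \<exists>x\<in>L. fst p0 x \<noteq> fst q x" using Gsep p0(1) by blast
    then obtain y where y: "\<And>q. q \<in> G - {p0} \<Longrightarrow> y q \<in> L \<and> fst p0 (y q) \<noteq> fst q (y q)" by metis
    define h where "h p = fst p 1 * (\<Prod>q\<in>G - {p0}. fst p (y q) - fst q (y q))" for p :: "('a \<Rightarrow> 'a) \<times> nat"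
    have hs: "T h \<in> span W" unfolding h_def using finG y L1 by (intro interp) auto
    have h0: "h p = 0" if "p \<in> G" "p \<noteq> p0" for p using that finG unfolding h_def by auto
    have h1: "h p0 \<noteq> 0" using G1[OF p0(1)] y finG unfolding h_def by auto
    have "T h = monom (h p0) j" unfolding T_def using h0 p0 finG
      by (subst sum.remove[OF finG p0(1)]) (simp add: sum.neutral)
    then have "monom 1 j = smult (inverse (h p0)) (T h)" using h1 by (simp add: smult_monom)
    then show ?thesis using hs span_scale by metis
  qed
  obtain B where B: "B \<subseteq> W" "independent B" "W \<subseteq> span B" using maximal_independent_subset by blast
  define E where "E = (\<lambda>j. monom (1::'a) j) ` {1..n}"
  have injm: "inj (\<lambda>j. monom (1::'a) j)" by (auto intro!: injI) (metis degree_monom_eq one_neq_zero)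
  have cardE: "card E = n" unfolding E_def using injm by (subst card_image) (auto intro: inj_on_subset)
  have "E \<subseteq> span B" unfolding E_def using units span_mono[OF B(3)] by (auto simp: span_span)
  moreover have "independent E"
  proof
    assume "dependent E"
    then obtain t u where t: "finite t" "t \<subseteq> E" "(\<Sum>v\<in>t. smult (u v) v) = 0" "\<exists>v\<in>t. u v \<noteq> 0"
      unfolding dependent_explicit by blast
    then obtain j where j: "monom 1 j \<in> t" "u (monom 1 j) \<noteq> 0" unfolding E_def by blast
    have "0 = coeff (\<Sum>v\<in>t. smult (u v) v) j" using t(3) by simp
    also have "\<dots> = (\<Sum>v\<in>t. u v * coeff v j)" by (simp add: coeff_sum)
    also have "\<dots> = u (monom 1 j)"
    proof -
      have "coeff v j = 0" if "v \<in> t - {monom 1 j}" for v using that t(2) unfolding E_def by auto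
      then show ?thesis by (subst sum.remove[OF t(1) j(1)]) simp
    qed
    finally show False using j(2) by simp
  qed
  ultimately have "finite B \<Longrightarrow> n \<le> card B" using independent_span_bound cardE by blast
  then obtain B' where B': "B' \<subseteq> B" "finite B'" "card B' = n"
    using infinite_arbitrarily_large[of B n] obtain_subset_with_card_n by (metis)
  obtain v where v: "bij_betw v {1..n} B'"
    using B' by (metis card_atLeastAtMost diff_Suc_1 finite_atLeastAtMost finite_same_card_bij)
  define w where "w u j = coeff (v u) j" for u j
  have vW: "v u \<in> W" if "u \<in> {1..n}" for u using bij_betwE[OF v] that B'(1) B(1) by blast
  show ?thesis
  proof (intro exI[of _ w] conjI ballI allI impI)
    show "\<sigma> (w u j) = w u (\<rho> \<sigma> j)" if "u \<in> {1..n}" "\<sigma> \<in> Gal \<iota>" "j \<in> {1..n}" for u \<sigma> j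
      using vW[OF that(1)] that unfolding W_def w_def by blast
  next
    fix c u assume c: "\<forall>j\<in>{1..n}. (\<Sum>u=1..n. c u * w u j) = 0" and u: "u \<in> {1..n}"
    have "(\<Sum>u=1..n. smult (c u) (v u)) = 0"
    proof (rule poly_eqI)
      fix j
      show "coeff (\<Sum>u=1..n. smult (c u) (v u)) j = coeff 0 j"
      proof (cases "j \<in> {1..n}")
        case True
        then show ?thesis using c by (simp add: coeff_sum w_def)
      next
        case False
        then have "coeff (v u) j = 0" if "u \<in> {1..n}" for u using vW[OF that] unfolding W_def by blast
        then show ?thesis by (simp add: coeff_sum)
      qed
    qed
    moreover have "(\<Sum>x\<in>B'. smult (c (inv_into {1..n} v x)) x) = (\<Sum>u=1..n. smult (c u) (v u))"
      unfolding sum.reindex_bij_betw[OF v, symmetric]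
      using v by (intro sum.cong) (auto simp: bij_betw_def inv_into_f_f)
    ultimately have "(\<Sum>x\<in>B'. smult (c (inv_into {1..n} v x)) x) = 0" by simp
    then have "c (inv_into {1..n} v (v u)) = 0"
      using independentD[OF B(2) B'(2) B'(1), of "\<lambda>x. c (inv_into {1..n} v x)" "v u"] bij_betwE[OF v] u
      by blast
    then show "c u = 0" using v u by (simp add: bij_betw_def inv_into_f_f)
  qed
qed

section \<open>Systems of forms over a \<open>C\<^sub>1\<close> field\<close>

text \<open>Forms are treated as functions: the \<open>C\<^sub>1\<close> property and normic forms are only about values, and
  substitution becomes composition of functions. The variables range over the base field, the
  coefficients over an extension; a term is a coefficient with the list of its variables. The zero function is
  a form of every degree.\<close>

definition form :: "('k::field \<Rightarrow> 'a::field) \<Rightarrow> 'v set \<Rightarrow> nat \<Rightarrow> (('v \<Rightarrow> 'k) \<Rightarrow> 'a) \<Rightarrow> bool" where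
  "form \<iota> V d F \<longleftrightarrow> (\<exists>T. (\<forall>(c, vs)\<in>set T. set vs \<subseteq> V \<and> length vs = d) \<and>
     F = (\<lambda>y. \<Sum>(c, vs)\<leftarrow>T. c * (\<Prod>v\<leftarrow>vs. \<iota> (y v))))"

lemma form_0: "form \<iota> V d (\<lambda>_. 0)"
  unfolding form_def by (rule exI[of _ "[]"]) simp

lemma form_const: "form \<iota> V 0 (\<lambda>_. c)"
  unfolding form_def by (rule exI[of _ "[(c, [])]"]) simp

lemma form_var: "v \<in> V \<Longrightarrow> form \<iota> V 1 (\<lambda>y. \<iota> (y v))"
  unfolding form_def by (rule exI[of _ "[(1, [v])]"]) simp

lemma form_var_id: "v \<in> V \<Longrightarrow> form id V 1 (\<lambda>y. y v)"
  using form_var[of v V id] by simp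

lemma form_add:
  assumes "form \<iota> V d F" "form \<iota> V d G" shows "form \<iota> V d (\<lambda>y. F y + G y)"
proof -
  obtain T T' where "\<forall>(c, vs)\<in>set T. set vs \<subseteq> V \<and> length vs = d"
      "F = (\<lambda>y. \<Sum>(c, vs)\<leftarrow>T. c * (\<Prod>v\<leftarrow>vs. \<iota> (y v)))"
      "\<forall>(c, vs)\<in>set T'. set vs \<subseteq> V \<and> length vs = d"
      "G = (\<lambda>y. \<Sum>(c, vs)\<leftarrow>T'. c * (\<Prod>v\<leftarrow>vs. \<iota> (y v)))"
    using assms unfolding form_def by blast
  then show ?thesis unfolding form_def by (intro exI[of _ "T @ T'"]) auto
qed

lemma form_mult:
  assumes "form \<iota> V d F" "form \<iota> V e G" shows "form \<iota> V (d + e) (\<lambda>y. F y * G y)"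
proof -
  obtain T T' where T: "\<forall>(c, vs)\<in>set T. set vs \<subseteq> V \<and> length vs = d"
      "F = (\<lambda>y. \<Sum>(c, vs)\<leftarrow>T. c * (\<Prod>v\<leftarrow>vs. \<iota> (y v)))"
      "\<forall>(c, vs)\<in>set T'. set vs \<subseteq> V \<and> length vs = e"
      "G = (\<lambda>y. \<Sum>(c, vs)\<leftarrow>T'. c * (\<Prod>v\<leftarrow>vs. \<iota> (y v)))"
    using assms unfolding form_def by blast
  let ?P = "concat (map (\<lambda>(c, vs). map (\<lambda>(c', vs'). (c * c', vs @ vs')) T') T)"
  have "(\<Sum>(c, vs)\<leftarrow>T. c * (\<Prod>v\<leftarrow>vs. \<iota> (y v))) * (\<Sum>(c, vs)\<leftarrow>T'. c * (\<Prod>v\<leftarrow>vs. \<iota> (y v)))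
      = (\<Sum>(c, vs)\<leftarrow>?P. c * (\<Prod>v\<leftarrow>vs. \<iota> (y v)))" for y
    by (induction T)
      (auto simp: sum_list_const_mult[symmetric] o_def case_prod_unfold algebra_simps distrib_right)
  moreover have "\<forall>(c, vs)\<in>set ?P. set vs \<subseteq> V \<and> length vs = d + e"
    using T(1,3) by fastforce
  ultimately show ?thesis unfolding form_def T(2,4) by (intro exI[of _ ?P]) simp
qed

lemma form_scale: "form \<iota> V d F \<Longrightarrow> form \<iota> V d (\<lambda>y. c * F y)"
  using form_mult[OF form_const] by fastforce

lemma form_sum: "(\<And>i. i \<in> A \<Longrightarrow> form \<iota> V d (F i)) \<Longrightarrow> form \<iota> V d (\<lambda>y. \<Sum>i\<in>A. F i y)"
  by (induction A rule: infinite_finite_induct) (auto simp: form_0 form_add)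

lemma form_prod:
  "(\<And>i. i \<in> A \<Longrightarrow> form \<iota> V (d i) (F i)) \<Longrightarrow> form \<iota> V (\<Sum>i\<in>A. d i) (\<lambda>y. \<Prod>i\<in>A. F i y)"
  by (induction A rule: infinite_finite_induct) (auto simp: form_const form_mult)

lemma form_power: "form \<iota> V d F \<Longrightarrow> form \<iota> V (n * d) (\<lambda>y. F y ^ n)"
  by (induction n) (auto simp: form_const form_mult)

lemma form_compose:
  fixes F :: "('w \<Rightarrow> 'k::field) \<Rightarrow> 'k"
  assumes F: "form id W d F" and h: "\<And>w. w \<in> W \<Longrightarrow> form id V e (h w)"
  shows "form id V (d * e) (\<lambda>y. F (\<lambda>w. h w y))"
proof -
  obtain T where T: "\<forall>(c, vs)\<in>set T. set vs \<subseteq> W \<and> length vs = d"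
      "F = (\<lambda>y. \<Sum>(c, vs)\<leftarrow>T. c * (\<Prod>v\<leftarrow>vs. id (y v)))"
    using F unfolding form_def by blast
  have prod: "form id V (length vs * e) (\<lambda>y. \<Prod>v\<leftarrow>vs. id (h v y))" if "set vs \<subseteq> W" for vs
    using that by (induction vs) (auto simp: form_const intro: form_mult h)
  have "form id V (d * e) (\<lambda>y. \<Sum>(c, vs)\<leftarrow>T'. c * (\<Prod>v\<leftarrow>vs. id (h v y)))" if "set T' \<subseteq> set T" for T'
    using that
  proof (induction T')
    case Nil
    show ?case by (simp add: form_0)
  next
    case (Cons cvs T')
    obtain c vs where cvs: "cvs = (c, vs)" by (cases cvs)
    have "form id V (d * e) (\<lambda>y. c * (\<Prod>v\<leftarrow>vs. id (h v y)))"
      using T(1) Cons.prems prod[of vs] form_scale unfolding cvs by fastforce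
    from form_add[OF this Cons.IH] Cons.prems show ?case by (simp add: cvs)
  qed
  then show ?thesis unfolding T(2) by blast
qed

lemma form_embed:
  fixes \<iota> :: "'k::field \<Rightarrow> 'a::field" and F :: "('v \<Rightarrow> 'k) \<Rightarrow> 'k"
  assumes F: "form id V d F" and emb: "field_embedding \<iota>"
  shows "form \<iota> V d (\<lambda>y. \<iota> (F y))"
proof -
  obtain T where T: "\<forall>(c, vs)\<in>set T. set vs \<subseteq> V \<and> length vs = d"
      "F = (\<lambda>y. \<Sum>(c, vs)\<leftarrow>T. c * (\<Prod>v\<leftarrow>vs. id (y v)))"
    using F unfolding form_def by blast
  have p: "\<iota> (\<Prod>v\<leftarrow>vs. y v) = (\<Prod>v\<leftarrow>vs. \<iota> (y v))" for vs and y :: "'v \<Rightarrow> 'k"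
    by (induction vs) (auto simp: field_embedding_1[OF emb] field_embedding_mult[OF emb])
  have "\<iota> (\<Sum>(c, vs)\<leftarrow>T. c * (\<Prod>v\<leftarrow>vs. id (y v))) =
    (\<Sum>(c, vs)\<leftarrow>map (\<lambda>(c, vs). (\<iota> c, vs)) T. c * (\<Prod>v\<leftarrow>vs. \<iota> (y v)))" for y
    by (induction T)
      (auto simp: p field_embedding_0[OF emb] field_embedding_mult[OF emb] field_embedding_add[OF emb])
  then show ?thesis unfolding form_def T(2) using T(1)
    by (intro exI[of _ "map (\<lambda>(c, vs). (\<iota> c, vs)) T"]) auto
qed

text \<open>The linear map extends \<open>1 \<mapsto> 1\<close> from the independent set \<open>{1}\<close> to the whole space.\<close>

lemma ex_linear_retraction:
  assumes emb: "field_embedding (\<iota> :: 'k::field \<Rightarrow> 'a::field)"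
  shows "\<exists>r. (\<forall>x y. r (x + y) = r x + r y) \<and> (\<forall>c x. r (\<iota> c * x) = c * r x) \<and> r 1 = 1"
proof -
  interpret p: vector_space_pair "\<lambda>c x. \<iota> c * x" "(*) :: 'k \<Rightarrow> 'k \<Rightarrow> 'k"
    by unfold_locales
      (auto simp: field_embedding_add[OF emb] field_embedding_mult[OF emb] field_embedding_1[OF emb] algebra_simps)
  have "p.vs1.independent {1}"
    using field_embedding_eq_0_iff[OF emb] by (simp add: p.vs1.dependent_single)
  then obtain r where "Vector_Spaces.linear (\<lambda>c x. \<iota> c * x) (*) r" "r 1 = 1"
    using p.linear_independent_extend[of "{1}" "\<lambda>_. 1"] by auto
  then show ?thesis
    by (intro exI[of _ r]) (auto simp: Vector_Spaces.linear_iff)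
qed

text \<open>A linear map over the base field may be applied to the coefficients, because the variables take values there.\<close>

lemma form_retract:
  fixes \<iota> :: "'k::field \<Rightarrow> 'a::field"
  assumes F: "form \<iota> V d F" and emb: "field_embedding \<iota>"
    and r: "\<And>x y. r (x + y) = r x + r y" "\<And>c x. r (\<iota> c * x) = c * r x"
  shows "form id V d (\<lambda>y. r (F y))"
proof -
  obtain T where T: "\<forall>(c, vs)\<in>set T. set vs \<subseteq> V \<and> length vs = d"
      "F = (\<lambda>y. \<Sum>(c, vs)\<leftarrow>T. c * (\<Prod>v\<leftarrow>vs. \<iota> (y v)))"
    using F unfolding form_def by blast
  have r0: "r 0 = 0" using r(1)[of 0 0] by (metis add.right_neutral add_left_cancel)
  have p: "r (c * (\<Prod>v\<leftarrow>vs. \<iota> (y v))) = r c * (\<Prod>v\<leftarrow>vs. y v)" for c vs y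
  proof -
    have "(\<Prod>v\<leftarrow>vs. \<iota> (y v)) = \<iota> (\<Prod>v\<leftarrow>vs. y v)"
      by (induction vs) (auto simp: field_embedding_1[OF emb] field_embedding_mult[OF emb])
    then show ?thesis using r(2)[of "\<Prod>v\<leftarrow>vs. y v" c] by (simp add: mult.commute)
  qed
  have "r (\<Sum>(c, vs)\<leftarrow>T. c * (\<Prod>v\<leftarrow>vs. \<iota> (y v))) =
    (\<Sum>(c, vs)\<leftarrow>map (\<lambda>(c, vs). (r c, vs)) T. c * (\<Prod>v\<leftarrow>vs. id (y v)))" for y
    by (induction T) (auto simp: p r0 r(1))
  then show ?thesis unfolding form_def T(2) using T(1)
    by (intro exI[of _ "map (\<lambda>(c, vs). (r c, vs)) T"]) auto
qed

definition meval :: "('v \<Rightarrow> 'a::comm_semiring_1) \<Rightarrow> ('v \<Rightarrow>\<^sub>0 nat) \<Rightarrow> 'a" where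
  "meval x \<mu> = (\<Prod>v\<in>Poly_Mapping.keys \<mu>. x v ^ Poly_Mapping.lookup \<mu> v)"

lemma meval_superset:
  "finite A \<Longrightarrow> Poly_Mapping.keys \<mu> \<subseteq> A \<Longrightarrow> meval x \<mu> = (\<Prod>v\<in>A. x v ^ Poly_Mapping.lookup \<mu> v)"
  unfolding meval_def by (rule prod.mono_neutral_left) (auto simp: in_keys_iff)

lemma meval_0: "meval x 0 = 1" by (simp add: meval_def)

lemma meval_add: "meval x (\<mu> + \<nu>) = meval x \<mu> * meval x \<nu>"
proof -
  let ?A = "Poly_Mapping.keys \<mu> \<union> Poly_Mapping.keys \<nu>"
  have "meval x \<xi> = (\<Prod>v\<in>?A. x v ^ Poly_Mapping.lookup \<xi> v)" if "Poly_Mapping.keys \<xi> \<subseteq> ?A" for \<xi>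
    using that by (intro meval_superset) auto
  then show ?thesis using keys_add[of \<mu> \<nu>]
    by (simp add: lookup_add power_add prod.distrib)
qed

lemma meval_single: "meval x (Poly_Mapping.single v n) = x v ^ n"
  by (cases "n = 0") (auto simp: meval_def)

lemma mpeval_superset:
  "finite A \<Longrightarrow> Poly_Mapping.keys p \<subseteq> A \<Longrightarrow>
    mpeval x p = (\<Sum>\<mu>\<in>A. Poly_Mapping.lookup p \<mu> * meval x \<mu>)"
  unfolding mpeval_def meval_def by (rule sum.mono_neutral_left) (auto simp: in_keys_iff)

lemma mpeval_add: "mpeval x (p + q) = mpeval x p + mpeval x q"
proof -
  let ?A = "Poly_Mapping.keys p \<union> Poly_Mapping.keys q"
  have "mpeval x f = (\<Sum>\<mu>\<in>?A. Poly_Mapping.lookup f \<mu> * meval x \<mu>)" if "Poly_Mapping.keys f \<subseteq> ?A" for f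
    using that by (intro mpeval_superset) auto
  then show ?thesis using keys_add[of p q]
    by (simp add: lookup_add distrib_right sum.distrib)
qed

lemma mpeval_0: "mpeval x 0 = 0" by (simp add: mpeval_def)

lemma mpeval_single: "mpeval x (Poly_Mapping.single \<mu> c) = c * meval x \<mu>"
  by (cases "c = 0") (auto simp: mpeval_def meval_def)

lemma form_imp_mpoly:
  fixes F :: "('v \<Rightarrow> 'k::field) \<Rightarrow> 'k"
  assumes "form id V d F"
  shows "\<exists>p. homogeneous d p \<and> mvars p \<subseteq> V \<and> (\<forall>x. mpeval x p = F x)"
proof -
  obtain T where T: "\<forall>(c, vs)\<in>set T. set vs \<subseteq> V \<and> length vs = d"
      "F = (\<lambda>y. \<Sum>(c, vs)\<leftarrow>T. c * (\<Prod>v\<leftarrow>vs. id (y v)))"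
    using assms unfolding form_def by blast
  define mon where "mon vs = (\<Sum>v\<leftarrow>vs. Poly_Mapping.single v (1::nat))" for vs :: "'v list"
  have keys_mon: "Poly_Mapping.keys (mon vs) \<subseteq> set vs" for vs
  proof (induction vs)
    case (Cons v vs)
    then show ?case using keys_add[of "Poly_Mapping.single v 1" "mon vs"] by (auto simp: mon_def split: if_splits)
  qed (simp add: mon_def)
  have meval_mon: "meval x (mon vs) = (\<Prod>v\<leftarrow>vs. x v)" for x :: "'v \<Rightarrow> 'k" and vs
    by (induction vs) (auto simp: mon_def meval_0 meval_add meval_single)
  have deg_mon: "(\<Sum>v\<in>Poly_Mapping.keys (mon vs). Poly_Mapping.lookup (mon vs) v) = length vs" for vs
  proof -
    have "(\<Sum>v\<in>Poly_Mapping.keys (mon vs). Poly_Mapping.lookup (mon vs) v) = (\<Sum>v\<in>set vs. Poly_Mapping.lookup (mon vs) v)"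
      using keys_mon by (intro sum.mono_neutral_left) (auto simp: in_keys_iff)
    also have "(\<Sum>v\<in>A. Poly_Mapping.lookup (mon vs) v) = length vs" if "finite A" "set vs \<subseteq> A" for A
      using that by (induction vs) (auto simp: mon_def lookup_add sum.distrib lookup_single when_def)
    from this[of "set vs"] have "(\<Sum>v\<in>set vs. Poly_Mapping.lookup (mon vs) v) = length vs" by simp
    finally show ?thesis .
  qed
  have "\<exists>p. homogeneous d p \<and> mvars p \<subseteq> V \<and> (\<forall>x. mpeval x p = (\<Sum>(c, vs)\<leftarrow>T'. c * (\<Prod>v\<leftarrow>vs. id (x v))))"
    if "set T' \<subseteq> set T" for T'
    using that
  proof (induction T')
    case Nil
    show ?case by (intro exI[of _ 0]) (auto simp: homogeneous_def mvars_def mpeval_0)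
  next
    case (Cons cvs T')
    obtain c vs where cvs: "cvs = (c, vs)" by (cases cvs)
    have vs: "set vs \<subseteq> V" "length vs = d" using Cons.prems T(1) unfolding cvs by auto
    obtain p where p: "homogeneous d p" "mvars p \<subseteq> V"
      "\<And>x. mpeval x p = (\<Sum>(c, vs)\<leftarrow>T'. c * (\<Prod>v\<leftarrow>vs. id (x v)))" using Cons by auto
    let ?p = "Poly_Mapping.single (mon vs) c + p"
    have k: "Poly_Mapping.keys ?p \<subseteq> insert (mon vs) (Poly_Mapping.keys p)"
      using keys_add[of "Poly_Mapping.single (mon vs) c" p] by (auto split: if_splits)
    have "homogeneous d ?p" using p(1) k deg_mon[of vs] vs(2) unfolding homogeneous_def by blast
    moreover have "mvars ?p \<subseteq> V" using p(2) k keys_mon[of vs] vs(1) unfolding mvars_def by blast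
    ultimately show ?case
      by (intro exI[of _ ?p]) (simp add: cvs mpeval_add mpeval_single p(3) meval_mon)
  qed
  from this[of T] show ?thesis unfolding T(2) by simp
qed

lemma mpoly_imp_form:
  fixes p :: "('v, 'k::field) mpoly"
  assumes "homogeneous d p" "mvars p \<subseteq> V"
  shows "form id V d (\<lambda>x. mpeval x p)"
proof -
  have "form id V d (\<lambda>x. Poly_Mapping.lookup p \<mu> * (\<Prod>v\<in>Poly_Mapping.keys \<mu>. x v ^ Poly_Mapping.lookup \<mu> v))"
    if mu: "\<mu> \<in> Poly_Mapping.keys p" for \<mu>
  proof -
    have "form id V (Poly_Mapping.lookup \<mu> v * 1) (\<lambda>x. x v ^ Poly_Mapping.lookup \<mu> v)"
      if "v \<in> Poly_Mapping.keys \<mu>" for v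
      using form_power[OF form_var[of v V id]] that mu assms(2) unfolding mvars_def by fastforce
    then have "form id V (\<Sum>v\<in>Poly_Mapping.keys \<mu>. Poly_Mapping.lookup \<mu> v)
       (\<lambda>x. \<Prod>v\<in>Poly_Mapping.keys \<mu>. x v ^ Poly_Mapping.lookup \<mu> v)"
      by (intro form_prod) simp
    then show ?thesis using form_scale assms(1) mu unfolding homogeneous_def by metis
  qed
  then show ?thesis unfolding mpeval_def by (rule form_sum)
qed

lemma C1_zero:
  fixes F :: "('v \<Rightarrow> 'k::field) \<Rightarrow> 'k"
  assumes C1: "C1_field TYPE('k)" and F: "form id V d F" and V: "finite V" "1 \<le> d" "d < card V"
  shows "\<exists>y. (\<exists>v\<in>V. y v \<noteq> 0) \<and> F y = 0"
proof -
  define n where "n = card V - 1"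
  have "card {0..n} = card V" using V by (simp add: n_def)
  then obtain h where h: "bij_betw h V {0..n}" using V(1) finite_same_card_bij[of V "{0..n}"] by auto
  have "form id {0..n} (d * 1) (\<lambda>x. F (\<lambda>v. x (h v)))"
    using F by (rule form_compose) (intro form_var_id, use bij_betwE[OF h] in blast)
  then obtain p where p: "homogeneous d p" "mvars p \<subseteq> {0..n}" "\<And>x. mpeval x p = F (\<lambda>v. x (h v))"
    using form_imp_mpoly[of "{0..n}" "d * 1" "\<lambda>x. F (\<lambda>v. x (h v))"] by auto
  show ?thesis
  proof (cases "p = 0")
    case True
    have "V \<noteq> {}" using V by auto
    moreover have "F (\<lambda>_. 1) = 0" using p(3)[of "\<lambda>_. 1"] True by (simp add: mpeval_0)
    ultimately show ?thesis by (intro exI[of _ "\<lambda>_. 1"]) auto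
  next
    case False
    have "d \<le> n" using V by (simp add: n_def)
    then obtain x i where x: "i \<in> {0..n}" "x i \<noteq> 0" "mpeval x p = 0"
      using C1 p(1,2) False V(2) unfolding C1_field_def by blast
    obtain v where "v \<in> V" "i = h v" using bij_betw_imp_surj_on[OF h] x(1) by blast
    then show ?thesis using x p(3) by (intro exI[of _ "\<lambda>v. x (h v)"]) auto
  qed
qed

lemma normic_zero:
  assumes ad: "admits_normic_forms TYPE('k::field)" and W: "finite W" "W \<noteq> {}"
  shows "\<exists>\<nu> :: ('w \<Rightarrow> 'k) \<Rightarrow> 'k. form id W (card W) \<nu> \<and> (\<forall>z. \<nu> z = 0 \<longrightarrow> (\<forall>w\<in>W. z w = 0))"
proof -
  let ?d = "card W"
  have d: "1 \<le> ?d" using W by (simp add: Suc_leI card_gt_0_iff)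
  obtain p :: "(nat, 'k) mpoly" where p: "normic_form ?d p" using ad d unfolding admits_normic_forms_def by blast
  obtain h where h: "bij_betw h {1..?d} W" using W finite_same_card_bij[of "{1..?d}" W] by auto
  have "form id {1..?d} ?d (\<lambda>x. mpeval x p)"
    using p mpoly_imp_form unfolding normic_form_def by blast
  then have "form id W (?d * 1) (\<lambda>z. mpeval (\<lambda>i. z (h i)) p)"
    by (rule form_compose) (intro form_var_id, use bij_betwE[OF h] in blast)
  moreover have "\<forall>w\<in>W. z w = 0" if "mpeval (\<lambda>i. z (h i)) p = 0" for z
  proof
    fix w assume "w \<in> W"
    then obtain i where "i \<in> {1..?d}" "w = h i" using bij_betw_imp_surj_on[OF h] by blast
    then show "z w = 0" using p that unfolding normic_form_def by blast
  qed
  ultimately show ?thesis by (intro exI[of _ "\<lambda>z. mpeval (\<lambda>i. z (h i)) p"]) auto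
qed

text \<open>A normic form in \<open>card Q\<close> variables, applied to the given forms, yields one form of degree
  \<open>card Q * e\<close> that vanishes only at the common zeros.\<close>

lemma common_zero_same_degree:
  fixes g :: "'q \<Rightarrow> ('v \<Rightarrow> 'k::field) \<Rightarrow> 'k"
  assumes C1: "C1_field TYPE('k)" and ad: "admits_normic_forms TYPE('k)"
    and fin: "finite Q" "finite V" and e: "1 \<le> e" "card Q * e < card V"
    and g: "\<And>q. q \<in> Q \<Longrightarrow> form id V e (g q)"
  shows "\<exists>y. (\<exists>v\<in>V. y v \<noteq> 0) \<and> (\<forall>q\<in>Q. g q y = 0)"
proof (cases "Q = {}")
  case True
  then show ?thesis using e(2) by (intro exI[of _ "\<lambda>_. 1"]) (auto simp: card_gt_0_iff)
next
  case False
  then obtain \<nu> :: "('q \<Rightarrow> 'k) \<Rightarrow> 'k" where \<nu>: "form id Q (card Q) \<nu>" "\<And>z. \<nu> z = 0 \<Longrightarrow> \<forall>q\<in>Q. z q = 0"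
    using normic_zero[OF ad fin(1)] by metis
  have "form id V (card Q * e) (\<lambda>y. \<nu> (\<lambda>q. g q y))" using form_compose[OF \<nu>(1), of V e g] g by blast
  moreover have "1 \<le> card Q * e" using False fin(1) e(1) by (simp add: Suc_leI card_gt_0_iff)
  ultimately obtain y where "\<exists>v\<in>V. y v \<noteq> 0" "\<nu> (\<lambda>q. g q y) = 0"
    using C1_zero[OF C1 _ fin(2) _ e(2)] by blast
  then show ?thesis using \<nu>(2) by blast
qed

text \<open>Let \<open>E\<close> be the product of the degrees and take \<open>E\<close> copies of the variables. For a form of degree \<open>e\<close>,
  a normic form of degree \<open>E / e\<close> combines its values at \<open>E / e\<close> of the copies into one form of degree \<open>E\<close>, and
  \<open>e\<close> such forms use up all the copies. These forms have equal degree \<open>E\<close>, their number is the sum of the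
  original degrees, and the number of variables has been multiplied by \<open>E\<close>, so that the case of
  equal degrees applies. Each copy of a common zero is a common zero of the original forms, and one copy is nonzero.\<close>

lemma common_zero_forms:
  fixes g :: "'q \<Rightarrow> ('v \<Rightarrow> 'k::field) \<Rightarrow> 'k"
  assumes C1: "C1_field TYPE('k)" and ad: "admits_normic_forms TYPE('k)"
    and fin: "finite Q" "finite V" and e: "\<And>q. q \<in> Q \<Longrightarrow> 1 \<le> e q" "(\<Sum>q\<in>Q. e q) < card V"
    and g: "\<And>q. q \<in> Q \<Longrightarrow> form id V (e q) (g q)"
  shows "\<exists>y. (\<exists>v\<in>V. y v \<noteq> 0) \<and> (\<forall>q\<in>Q. g q y = 0)"
proof -
  define E where "E = (\<Prod>q\<in>Q. e q)"
  define c where "c q = E div e q" for q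
  have E1: "1 \<le> E" unfolding E_def using e(1) by (intro prod_ge_1) auto
  have ec: "e q * c q = E" if "q \<in> Q" for q
    unfolding c_def E_def using dvd_prodI[OF fin(1) that, of e] by simp
  have c1: "0 < c q" if "q \<in> Q" for q using ec[OF that] E1 by (cases "c q") auto
  have "\<exists>\<nu> :: (nat \<Rightarrow> 'k) \<Rightarrow> 'k. form id {..<c q} (c q) \<nu> \<and> (\<forall>z. \<nu> z = 0 \<longrightarrow> (\<forall>w\<in>{..<c q}. z w = 0))"
    if "q \<in> Q" for q using normic_zero[OF ad, of "{..<c q}"] c1[OF that] by auto
  then obtain \<nu> :: "'q \<Rightarrow> (nat \<Rightarrow> 'k) \<Rightarrow> 'k" where \<nu>: "\<And>q. q \<in> Q \<Longrightarrow> form id {..<c q} (c q) (\<nu> q)"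
    "\<And>q z w. q \<in> Q \<Longrightarrow> \<nu> q z = 0 \<Longrightarrow> w < c q \<Longrightarrow> z w = 0" by (metis lessThan_iff)
  define U where "U = V \<times> {..<E}"
  define G where "G = (\<lambda>(q, b) y. \<nu> q (\<lambda>h. g q (\<lambda>v. y (v, b * c q + h))))"
  define Q' where "Q' = Sigma Q (\<lambda>q. {..<e q})"
  have lt: "b * c q + h < E" if "q \<in> Q" "b < e q" "h < c q" for q b h
  proof -
    have "b * c q + h < Suc b * c q" using that by simp
    also have "\<dots> \<le> e q * c q" using that by (intro mult_right_mono) auto
    finally show ?thesis using ec[OF that(1)] by simp
  qed
  have "form id U E (G qb)" if qbQ: "qb \<in> Q'" for qb
  proof -
    obtain q b where qb: "qb = (q, b)" "q \<in> Q" "b < e q" using qbQ unfolding Q'_def by auto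
    have "form id U (e q * 1) (\<lambda>y. g q (\<lambda>v. y (v, b * c q + h)))" if "h < c q" for h
      by (rule form_compose[OF g[OF qb(2)]])
        (intro form_var_id, use lt[OF qb(2,3) that] in \<open>simp add: U_def\<close>)
    then have "form id U (c q * e q) (G qb)"
      unfolding G_def qb(1)
      using form_compose[OF \<nu>(1)[OF qb(2)], of U "e q" "\<lambda>h y. g q (\<lambda>v. y (v, b * c q + h))"] by simp
    then show ?thesis using ec[OF qb(2)] by (simp add: mult.commute)
  qed
  moreover have "card Q' * E < card U"
    unfolding U_def Q'_def using e(2) E1 fin by (simp add: card_cartesian_product)
  ultimately obtain y where y: "\<exists>v\<in>U. y v \<noteq> 0" "\<forall>qb\<in>Q'. G qb y = 0"
    using common_zero_same_degree[OF C1 ad _ _ E1, of Q' U G] fin by (auto simp: U_def Q'_def)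
  then obtain v u where vu: "v \<in> V" "u < E" "y (v, u) \<noteq> 0" unfolding U_def by auto
  have "g q (\<lambda>v. y (v, u)) = 0" if q: "q \<in> Q" for q
  proof -
    have "u div c q < e q" using vu(2) ec[OF q] c1[OF q] by (simp add: div_less_iff_less_mult)
    then have "G (q, u div c q) y = 0" using y(2) q unfolding Q'_def by auto
    then have "\<nu> q (\<lambda>h. g q (\<lambda>v. y (v, (u div c q) * c q + h))) = 0" unfolding G_def by simp
    from \<nu>(2)[OF q this, of "u mod c q"] have "g q (\<lambda>v. y (v, (u div c q) * c q + u mod c q)) = 0"
      using c1[OF q] by simp
    then show ?thesis by simp
  qed
  then show ?thesis using vu by (intro exI[of _ "\<lambda>v. y (v, u)"]) auto
qed

section \<open>Homomorphisms of polynomial rings and the coordinate ring\<close>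

text \<open>For additive \<open>\<phi>\<close> and multiplicative \<open>\<chi>\<close>, the homomorphism that is \<open>\<theta>\<close> on coefficients and maps a monomial \<open>\<mu>\<close> to \<open>\<chi> \<mu>\<close> times the monomial
  \<open>\<phi> \<mu>\<close>. Both the Galois action and the map defining the ideal of a point have this shape.\<close>

definition monomial_hom :: "('a::zero \<Rightarrow> 'b::comm_semiring_1) \<Rightarrow> ('m \<Rightarrow> 'n) \<Rightarrow> ('m \<Rightarrow> 'b) \<Rightarrow> ('m \<Rightarrow>\<^sub>0 'a) \<Rightarrow> ('n \<Rightarrow>\<^sub>0 'b)" where
  "monomial_hom \<theta> \<phi> \<chi> p =
     (\<Sum>\<mu>\<in>Poly_Mapping.keys p. Poly_Mapping.single (\<phi> \<mu>) (\<theta> (Poly_Mapping.lookup p \<mu>) * \<chi> \<mu>))"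

lemma poly_mapping_eq_sum_single:
  assumes "finite A" "Poly_Mapping.keys p \<subseteq> A"
  shows "(\<Sum>\<mu>\<in>A. Poly_Mapping.single \<mu> (Poly_Mapping.lookup p \<mu>)) = p"
proof (rule poly_mapping_eqI)
  fix \<nu>
  have "(\<Sum>\<mu>\<in>A. (Poly_Mapping.lookup p \<mu> when \<mu> = \<nu>)) = Poly_Mapping.lookup p \<nu>"
  proof (cases "\<nu> \<in> A")
    case True
    then show ?thesis using assms(1) by (simp add: when_def)
  next
    case False
    then show ?thesis using assms by (auto simp: when_def in_keys_iff intro!: sum.neutral)
  qed
  then show "Poly_Mapping.lookup (\<Sum>\<mu>\<in>A. Poly_Mapping.single \<mu> (Poly_Mapping.lookup p \<mu>)) \<nu> =
      Poly_Mapping.lookup p \<nu>" by (simp add: lookup_sum lookup_single)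
qed

context
  fixes \<theta> :: "'a::field \<Rightarrow> 'b::field" and \<phi> :: "'m::comm_monoid_add \<Rightarrow> 'n::comm_monoid_add" and \<chi> :: "'m \<Rightarrow> 'b"
  assumes emb: "field_embedding \<theta>"
begin

lemma monomial_hom_superset:
  "finite A \<Longrightarrow> Poly_Mapping.keys p \<subseteq> A \<Longrightarrow>
    monomial_hom \<theta> \<phi> \<chi> p = (\<Sum>\<mu>\<in>A. Poly_Mapping.single (\<phi> \<mu>) (\<theta> (Poly_Mapping.lookup p \<mu>) * \<chi> \<mu>))"
  unfolding monomial_hom_def by (rule sum.mono_neutral_left) (auto simp: in_keys_iff field_embedding_0[OF emb])

lemma monomial_hom_0: "monomial_hom \<theta> \<phi> \<chi> 0 = 0"
  by (simp add: monomial_hom_def)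

lemma monomial_hom_single: "monomial_hom \<theta> \<phi> \<chi> (Poly_Mapping.single \<mu> c) = Poly_Mapping.single (\<phi> \<mu>) (\<theta> c * \<chi> \<mu>)"
  by (subst monomial_hom_superset[of "{\<mu>}"]) auto

lemma monomial_hom_add: "monomial_hom \<theta> \<phi> \<chi> (p + q) = monomial_hom \<theta> \<phi> \<chi> p + monomial_hom \<theta> \<phi> \<chi> q"
proof -
  let ?A = "Poly_Mapping.keys p \<union> Poly_Mapping.keys q"
  have "monomial_hom \<theta> \<phi> \<chi> f = (\<Sum>\<mu>\<in>?A. Poly_Mapping.single (\<phi> \<mu>) (\<theta> (Poly_Mapping.lookup f \<mu>) * \<chi> \<mu>))"
    if "Poly_Mapping.keys f \<subseteq> ?A" for f
    using that by (intro monomial_hom_superset) auto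
  then show ?thesis using keys_add[of p q]
    by (simp add: lookup_add field_embedding_add[OF emb] distrib_right single_add sum.distrib)
qed

lemma monomial_hom_sum: "monomial_hom \<theta> \<phi> \<chi> (\<Sum>i\<in>A. f i) = (\<Sum>i\<in>A. monomial_hom \<theta> \<phi> \<chi> (f i))"
  by (induction A rule: infinite_finite_induct) (auto simp: monomial_hom_0 monomial_hom_add)

lemma monomial_hom_mult:
  assumes "\<And>\<mu> \<nu>. \<phi> (\<mu> + \<nu>) = \<phi> \<mu> + \<phi> \<nu>" "\<And>\<mu> \<nu>. \<chi> (\<mu> + \<nu>) = \<chi> \<mu> * \<chi> \<nu>"
  shows "monomial_hom \<theta> \<phi> \<chi> (p * q) = monomial_hom \<theta> \<phi> \<chi> p * monomial_hom \<theta> \<phi> \<chi> q"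
proof -
  have "p * q = (\<Sum>\<mu>\<in>Poly_Mapping.keys p. \<Sum>\<nu>\<in>Poly_Mapping.keys q.
      Poly_Mapping.single (\<mu> + \<nu>) (Poly_Mapping.lookup p \<mu> * Poly_Mapping.lookup q \<nu>))"
    by (simp add: mult_single[symmetric] sum_product[symmetric] poly_mapping_eq_sum_single)
  then show ?thesis
    by (simp add: monomial_hom_sum monomial_hom_single)
      (simp add: monomial_hom_def sum_product mult_single assms field_embedding_mult[OF emb] mult_ac)
qed

end

lemma ex_key: "p \<noteq> 0 \<Longrightarrow> \<exists>\<mu>. \<mu> \<in> Poly_Mapping.keys p"
  by (metis lookup_not_eq_zero_eq_in_keys lookup_zero poly_mapping_eqI)

lemma mpeval_sum: "mpeval x (\<Sum>i\<in>A. f i) = (\<Sum>i\<in>A. mpeval x (f i))"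
  by (induction A rule: infinite_finite_induct) (auto simp: mpeval_0 mpeval_add)

lemma keys_mconst_mult: "Poly_Mapping.keys (mconst c * (p :: ('v, 'a::field) mpoly)) \<subseteq> Poly_Mapping.keys p"
proof -
  have "Poly_Mapping.keys (mconst c * p) \<subseteq> {\<mu> + \<nu> | \<mu> \<nu>. \<mu> \<in> Poly_Mapping.keys (mconst c :: ('v, 'a) mpoly) \<and> \<nu> \<in> Poly_Mapping.keys p}"
    by (rule keys_mult)
  then show ?thesis by (auto simp: mconst_def split: if_splits)
qed

lemma mpeval_mconst_mult: "mpeval x (mconst c * p) = c * mpeval x (p :: ('v, 'a::field) mpoly)"
proof -
  have "mconst c * p = (\<Sum>\<mu>\<in>Poly_Mapping.keys p. Poly_Mapping.single \<mu> (c * Poly_Mapping.lookup p \<mu>))"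
    unfolding mconst_def
    by (subst poly_mapping_eq_sum_single[of "Poly_Mapping.keys p" p, symmetric])
      (simp_all add: sum_distrib_left mult_single)
  then show ?thesis by (simp add: mpeval_sum mpeval_single) (simp add: mpeval_def meval_def sum_distrib_left mult.assoc)
qed

lemma keys_minus_subset: "Poly_Mapping.keys (p - q) \<subseteq> Poly_Mapping.keys p \<union> Poly_Mapping.keys (q :: ('v, 'a::field) mpoly)"
  by (auto simp: in_keys_iff lookup_minus)

lemma mpeval_minus: "mpeval x (p - q) = mpeval x p - mpeval x (q :: ('v, 'a::field) mpoly)"
  using mpeval_add[of x "p - q" q] by simp

lemma mvars_iff: "mvars p \<subseteq> V \<longleftrightarrow> (\<forall>\<mu>\<in>Poly_Mapping.keys p. Poly_Mapping.keys \<mu> \<subseteq> V)"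
  unfolding mvars_def by blast

lemma mvars_0: "mvars 0 = {}" and mvars_1: "mvars (1 :: ('v, 'a::field) mpoly) = {}"
  by (simp_all add: mvars_def)

lemma mvars_add: "mvars p \<subseteq> V \<Longrightarrow> mvars q \<subseteq> V \<Longrightarrow> mvars (p + q) \<subseteq> V"
  using keys_add[of p q] unfolding mvars_iff by blast

lemma mvars_uminus: "mvars (- p :: ('v, 'a::field) mpoly) = mvars p"
proof -
  have "Poly_Mapping.keys (- p) = Poly_Mapping.keys p" by (auto simp: in_keys_iff)
  then show ?thesis by (simp add: mvars_def)
qed

lemma mvars_mult:
  fixes p q :: "('v, 'a::field) mpoly"
  assumes "mvars p \<subseteq> V" "mvars q \<subseteq> V" shows "mvars (p * q) \<subseteq> V"
  unfolding mvars_iff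
proof
  fix \<mu> assume "\<mu> \<in> Poly_Mapping.keys (p * q)"
  then obtain \<alpha> \<beta> where "\<mu> = \<alpha> + \<beta>" "\<alpha> \<in> Poly_Mapping.keys p" "\<beta> \<in> Poly_Mapping.keys q"
    using keys_mult[of p q] by blast
  then show "Poly_Mapping.keys \<mu> \<subseteq> V" using assms keys_add[of \<alpha> \<beta>] unfolding mvars_iff by blast
qed

lemma coord_ring_simps [simp]:
  "p \<in> carrier (coord_ring N n m) \<longleftrightarrow> mvars p \<subseteq> coords N n m"
  "p \<otimes>\<^bsub>coord_ring N n m\<^esub> q = p * q" "p \<oplus>\<^bsub>coord_ring N n m\<^esub> q = p + q"
  "\<one>\<^bsub>coord_ring N n m\<^esub> = 1" "\<zero>\<^bsub>coord_ring N n m\<^esub> = 0"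
  by (simp_all add: coord_ring_def)

lemma cring_coord_ring: "cring (coord_ring N n m :: (coord, 'a::field) mpoly ring)"
proof (rule cringI)
  show "abelian_group (coord_ring N n m :: (coord, 'a) mpoly ring)"
  proof (rule abelian_groupI)
    fix x :: "(coord, 'a) mpoly" assume "x \<in> carrier (coord_ring N n m)"
    then show "\<exists>y\<in>carrier (coord_ring N n m). y \<oplus>\<^bsub>coord_ring N n m\<^esub> x = \<zero>\<^bsub>coord_ring N n m\<^esub>"
      by (intro bexI[of _ "- x"]) (auto simp: mvars_uminus)
  qed (auto simp: mvars_0 add_ac intro: mvars_add[THEN subsetD])
  show "Group.comm_monoid (coord_ring N n m :: (coord, 'a) mpoly ring)"
    by unfold_locales (auto simp: mvars_1 mult_ac intro: mvars_mult[THEN subsetD])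
qed (auto simp: distrib_right)

section \<open>The Galois action on polynomials\<close>

lemma permute_monom_superset:
  "finite A \<Longrightarrow> Poly_Mapping.keys \<mu> \<subseteq> A \<Longrightarrow> permute_monom \<rho> \<mu> =
    (\<Sum>v\<in>A. Poly_Mapping.single (permute_coord \<rho> v) (Poly_Mapping.lookup \<mu> v))"
  unfolding permute_monom_def by (rule sum.mono_neutral_left) (auto simp: in_keys_iff)

lemma permute_monom_add: "permute_monom \<rho> (\<mu> + \<nu>) = permute_monom \<rho> \<mu> + permute_monom \<rho> \<nu>"
proof -
  let ?A = "Poly_Mapping.keys \<mu> \<union> Poly_Mapping.keys \<nu>"
  have "permute_monom \<rho> \<xi> = (\<Sum>v\<in>?A. Poly_Mapping.single (permute_coord \<rho> v) (Poly_Mapping.lookup \<xi> v))"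
    if "Poly_Mapping.keys \<xi> \<subseteq> ?A" for \<xi> using that by (intro permute_monom_superset) auto
  then show ?thesis using keys_add[of \<mu> \<nu>] by (simp add: lookup_add single_add sum.distrib)
qed

lemma permute_monom_single:
  "permute_monom \<rho> (Poly_Mapping.single v k) = Poly_Mapping.single (permute_coord \<rho> v) k"
  by (subst permute_monom_superset[of "{v}"]) auto

lemma permute_monom_sum: "permute_monom \<rho> (\<Sum>i\<in>A. f i) = (\<Sum>i\<in>A. permute_monom \<rho> (f i))"
  by (induction A rule: infinite_finite_induct) (auto simp: permute_monom_add, simp_all add: permute_monom_def)

lemma meval_sum: "meval x (\<Sum>i\<in>A. f i) = (\<Prod>i\<in>A. meval x (f i))"
  by (induction A rule: infinite_finite_induct) (auto simp: meval_0 meval_add)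

lemma meval_permute_monom:
  "meval x (permute_monom \<rho> \<mu>) = (\<Prod>v\<in>Poly_Mapping.keys \<mu>. x (permute_coord \<rho> v) ^ Poly_Mapping.lookup \<mu> v)"
  unfolding permute_monom_def by (simp add: meval_sum meval_single)

lemma keys_permute_monom: "Poly_Mapping.keys (permute_monom \<rho> \<mu>) \<subseteq> permute_coord \<rho> ` Poly_Mapping.keys \<mu>"
  unfolding permute_monom_def
  by (rule order.trans[OF keys_sum]) (auto split: if_splits)

lemma gal_act_monomial_hom: "gal_act \<pi> \<sigma> = monomial_hom \<sigma> (permute_monom (\<pi> \<sigma>)) (\<lambda>_. 1)"
  by (rule ext) (simp add: gal_act_def monomial_hom_def)

lemma gal_act_mult: "field_embedding \<sigma> \<Longrightarrow> gal_act \<pi> \<sigma> (p * q) = gal_act \<pi> \<sigma> p * gal_act \<pi> \<sigma> q"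
  unfolding gal_act_monomial_hom by (rule monomial_hom_mult) (auto simp: permute_monom_add)

lemma keys_gal_act:
  "Poly_Mapping.keys (gal_act \<pi> \<sigma> p) \<subseteq> permute_monom (\<pi> \<sigma>) ` Poly_Mapping.keys p"
  unfolding gal_act_def by (rule order.trans[OF keys_sum]) (auto split: if_splits)

lemma mpeval_gal_act:
  assumes s: "field_embedding \<sigma>" and p: "mvars p \<subseteq> V"
    and x: "\<And>v. v \<in> V \<Longrightarrow> x (permute_coord (\<pi> \<sigma>) v) = \<sigma> (x v)"
  shows "mpeval x (gal_act \<pi> \<sigma> p) = \<sigma> (mpeval x p)"
proof -
  have "meval x (permute_monom (\<pi> \<sigma>) \<mu>) = \<sigma> (meval x \<mu>)" if mu: "\<mu> \<in> Poly_Mapping.keys p" for \<mu>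
  proof -
    have "x (permute_coord (\<pi> \<sigma>) v) = \<sigma> (x v)" if "v \<in> Poly_Mapping.keys \<mu>" for v
      using p that mu x unfolding mvars_iff by blast
    then show ?thesis
      unfolding meval_permute_monom meval_def[of x \<mu>] field_embedding_prod[OF s]
      by (intro prod.cong) (simp_all only: field_embedding_power[OF s])
  qed
  then show ?thesis unfolding gal_act_def
    by (simp add: mpeval_sum mpeval_single)
      (simp add: mpeval_def meval_def field_embedding_sum[OF s] field_embedding_mult[OF s])
qed

context
  fixes \<iota> :: "'k::field \<Rightarrow> 'a::field" and N :: nat and n m :: "nat \<Rightarrow> nat" and \<pi>
  assumes act: "factor_action \<iota> N n \<pi>"
begin

lemma action_permutes: "\<sigma> \<in> Gal \<iota> \<Longrightarrow> i \<in> {1..N} \<Longrightarrow> \<pi> \<sigma> i permutes {1..n i}"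
  and action_comp: "\<sigma> \<in> Gal \<iota> \<Longrightarrow> \<tau> \<in> Gal \<iota> \<Longrightarrow> i \<in> {1..N} \<Longrightarrow> \<pi> (\<sigma> \<circ> \<tau>) i = \<pi> \<sigma> i \<circ> \<pi> \<tau> i"
  and action_trans: "i \<in> {1..N} \<Longrightarrow> j \<in> {1..n i} \<Longrightarrow> j' \<in> {1..n i} \<Longrightarrow> \<exists>\<sigma>\<in>Gal \<iota>. \<pi> \<sigma> i j = j'"
  using act unfolding factor_action_def by blast+

lemma permute_coord_coords:
  assumes "\<sigma> \<in> Gal \<iota>" "v \<in> coords N n m" shows "permute_coord (\<pi> \<sigma>) v \<in> coords N n m"
proof -
  obtain i j l where "v = (i, j, l)" "i \<in> {1..N}" "j \<in> {1..n i}" "l \<in> {1..m i}"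
    using assms(2) unfolding coords_def by blast
  then show ?thesis using permutes_in_image[OF action_permutes[OF assms(1)]]
    unfolding coords_def permute_coord_def by fastforce
qed

lemma gal_act_carrier:
  assumes "\<sigma> \<in> Gal \<iota>" "mvars p \<subseteq> coords N n m"
  shows "mvars (gal_act \<pi> \<sigma> p) \<subseteq> coords N n m"
  using keys_gal_act[of \<pi> \<sigma> p] keys_permute_monom permute_coord_coords[OF assms(1)] assms(2)
  unfolding mvars_iff by (smt (verit, ccfv_SIG) imageE subset_iff)

lemma permute_coord_inv:
  assumes "\<sigma> \<in> Gal \<iota>" "v \<in> coords N n m"
  shows "permute_coord (\<pi> \<sigma>) (permute_coord (\<pi> (inv_into UNIV \<sigma>)) v) = v"
proof -
  obtain i j l where v: "v = (i, j, l)" "i \<in> {1..N}" using assms(2) unfolding coords_def by blast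
  have "\<sigma> \<circ> inv_into UNIV \<sigma> = id" using Gal_bij[OF assms(1)] by (auto simp: bij_def surj_iff)
  then have "\<pi> id i = \<pi> \<sigma> i \<circ> \<pi> (inv_into UNIV \<sigma>) i"
    using action_comp[OF assms(1) Gal_inv[OF assms(1)] v(2)] by simp
  moreover have "\<pi> id i = id"
  proof -
    have "\<pi> id i \<circ> \<pi> id i = \<pi> id i" using action_comp[OF Gal_id Gal_id v(2)] by simp
    moreover have "inj (\<pi> id i)" using permutes_inj[OF action_permutes[OF Gal_id v(2)]] .
    ultimately show ?thesis by (metis comp_apply eq_id_iff injD)
  qed
  ultimately have "\<pi> \<sigma> i (\<pi> (inv_into UNIV \<sigma>) i j) = j" by (metis comp_apply id_apply)
  then show ?thesis by (simp add: v permute_coord_def)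
qed

lemma gal_act_inv:
  assumes s: "\<sigma> \<in> Gal \<iota>" and p: "mvars p \<subseteq> coords N n m"
  shows "gal_act \<pi> \<sigma> (gal_act \<pi> (inv_into UNIV \<sigma>) p) = p"
proof -
  have pm: "permute_monom (\<pi> \<sigma>) (permute_monom (\<pi> (inv_into UNIV \<sigma>)) \<mu>) = \<mu>"
    if "\<mu> \<in> Poly_Mapping.keys p" for \<mu>
  proof -
    have "permute_monom (\<pi> \<sigma>) (permute_monom (\<pi> (inv_into UNIV \<sigma>)) \<mu>) =
      (\<Sum>v\<in>Poly_Mapping.keys \<mu>. Poly_Mapping.single v (Poly_Mapping.lookup \<mu> v))"
      unfolding permute_monom_def[of "\<pi> (inv_into UNIV \<sigma>)"] permute_monom_sum permute_monom_single
      using p that permute_coord_inv[OF s] unfolding mvars_iff by (intro sum.cong) (auto simp: subset_iff)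
    then show ?thesis by (simp add: poly_mapping_eq_sum_single)
  qed
  have ss: "\<sigma> (inv_into UNIV \<sigma> y) = y" for y using Gal_bij[OF s] by (simp add: bij_def surj_f_inv_f)
  have "gal_act \<pi> \<sigma> (gal_act \<pi> (inv_into UNIV \<sigma>) p) =
    (\<Sum>\<mu>\<in>Poly_Mapping.keys p. Poly_Mapping.single \<mu> (Poly_Mapping.lookup p \<mu>))"
    unfolding gal_act_monomial_hom monomial_hom_def[of "inv_into UNIV \<sigma>"] monomial_hom_sum[OF Gal_emb[OF s]]
    by (intro sum.cong) (auto simp: monomial_hom_single[OF Gal_emb[OF s]] pm ss)
  then show ?thesis by (simp add: poly_mapping_eq_sum_single)
qed

lemma lookup_permute_monom:
  assumes "\<sigma> \<in> Gal \<iota>" "i \<in> {1..N}"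
  shows "Poly_Mapping.lookup (permute_monom (\<pi> \<sigma>) \<mu>) (i, \<pi> \<sigma> i j, l) = Poly_Mapping.lookup \<mu> (i, j, l)"
proof -
  have eq: "permute_coord (\<pi> \<sigma>) v = (i, \<pi> \<sigma> i j, l) \<longleftrightarrow> v = (i, j, l)" for v
    using permutes_inj[OF action_permutes[OF assms]] by (auto simp: permute_coord_def inj_eq split: prod.splits)
  have "Poly_Mapping.lookup (permute_monom (\<pi> \<sigma>) \<mu>) (i, \<pi> \<sigma> i j, l) =
    (\<Sum>v\<in>Poly_Mapping.keys \<mu>. Poly_Mapping.lookup \<mu> v when v = (i, j, l))"
    unfolding permute_monom_def by (simp add: lookup_sum lookup_single eq)
  then show ?thesis by (simp add: when_def in_keys_iff)
qed

text \<open>The automorphism moves the degree in the \<open>j\<close>-th factor to the factor to which it moves \<open>j\<close>.\<close>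

lemma multihomogeneous_gal_act:
  assumes s: "\<sigma> \<in> Gal \<iota>" and p: "multihomogeneous N n m a D p"
    and D': "\<And>i j. i \<in> {1..N} \<Longrightarrow> j \<in> {1..n i} \<Longrightarrow> D' i (\<pi> \<sigma> i j) = D i j"
  shows "multihomogeneous N n m a D' (gal_act \<pi> \<sigma> p)"
  unfolding multihomogeneous_def
proof (intro conjI ballI)
  show "gal_act \<pi> \<sigma> p \<in> carrier (coord_ring N n m)"
    using gal_act_carrier[OF s] p by (simp add: multihomogeneous_def)
  fix \<kappa> i j assume k: "\<kappa> \<in> Poly_Mapping.keys (gal_act \<pi> \<sigma> p)" and i: "i \<in> {1..N}" and j: "j \<in> {1..n i}"
  obtain \<mu> where mu: "\<mu> \<in> Poly_Mapping.keys p" "\<kappa> = permute_monom (\<pi> \<sigma>) \<mu>" using k keys_gal_act by blast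
  obtain j0 where j0: "j0 \<in> {1..n i}" "j = \<pi> \<sigma> i j0"
    using j permutes_image[OF action_permutes[OF s i]] by blast
  have "(\<Sum>l=1..m i. a i l * Poly_Mapping.lookup \<kappa> (i, j, l)) = (\<Sum>l=1..m i. a i l * Poly_Mapping.lookup \<mu> (i, j0, l))"
    unfolding mu(2) j0(2) lookup_permute_monom[OF s i] ..
  also have "\<dots> = D i j0" using p mu(1) i j0(1) unfolding multihomogeneous_def by blast
  finally show "(\<Sum>l=1..m i. a i l * Poly_Mapping.lookup \<kappa> (i, j, l)) = D' i j" using D'[OF i j0(1)] j0(2) by simp
qed

end

text \<open>As \<open>f\<close> and \<open>g\<close> divide each other, they have the same total weighted degree. All weights being
  positive, the nonconstant monomials of the quotient \<open>h\<close> contribute to \<open>h * f\<close> only in higher degrees,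
  where \<open>g\<close> has no terms.\<close>

lemma associated_multihomogeneous:
  fixes f g :: "(coord, 'a::field) mpoly"
  assumes a: "\<And>i l. i \<in> {1..N} \<Longrightarrow> l \<in> {1..m i} \<Longrightarrow> 1 \<le> a i l"
    and f: "multihomogeneous N n m a D f" and g: "multihomogeneous N n m a D' g" "g \<noteq> 0"
    and h: "mvars h \<subseteq> coords N n m" "g = h * f" and h': "f = h' * g"
  shows "\<exists>c. c \<noteq> 0 \<and> g = mconst c * f"
proof -
  define wt where "wt \<mu> = (\<Sum>i=1..N. \<Sum>j=1..n i. \<Sum>l=1..m i. a i l * Poly_Mapping.lookup \<mu> (i, j, l))"
    for \<mu> :: "coord \<Rightarrow>\<^sub>0 nat"
  have wt_add: "wt (\<mu> + \<nu>) = wt \<mu> + wt \<nu>" for \<mu> \<nu>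
    by (simp add: wt_def lookup_add distrib_left sum.distrib)
  define e where "e = (\<Sum>i=1..N. \<Sum>j=1..n i. D i j)"
  define e' where "e' = (\<Sum>i=1..N. \<Sum>j=1..n i. D' i j)"
  have wf: "wt \<mu> = e" if "\<mu> \<in> Poly_Mapping.keys f" for \<mu>
    using f that unfolding wt_def e_def multihomogeneous_def by (intro sum.cong) auto
  have wg: "wt \<mu> = e'" if "\<mu> \<in> Poly_Mapping.keys g" for \<mu>
    using g that unfolding wt_def e'_def multihomogeneous_def by (intro sum.cong) auto
  have f0: "f \<noteq> 0" using g(2) h(2) by auto
  obtain \<kappa> where k: "\<kappa> \<in> Poly_Mapping.keys g" using ex_key[OF g(2)] by blast
  obtain \<kappa>' where k': "\<kappa>' \<in> Poly_Mapping.keys f" using ex_key[OF f0] by blast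
  have "e \<le> e'"
    using k keys_mult[of h f] wg[OF k] wf unfolding h(2) by (auto simp: wt_add dest!: subsetD)
  moreover have "e' \<le> e"
    using k' keys_mult[of h' g] wf[OF k'] wg unfolding h'[symmetric] by (auto simp: wt_add dest!: subsetD)
  ultimately have ee: "e' = e" by simp
  define c where "c = Poly_Mapping.lookup h 0"
  define h1 where "h1 = h - mconst c"
  have g_eq: "g = mconst c * f + h1 * f" unfolding h1_def h(2) by (simp add: algebra_simps)
  have h1: "0 < wt \<mu>" if mu: "\<mu> \<in> Poly_Mapping.keys h1" for \<mu>
  proof -
    have ne: "\<mu> \<noteq> 0" using mu by (auto simp: h1_def in_keys_iff lookup_minus mconst_def c_def)
    then have "\<mu> \<in> Poly_Mapping.keys h"
      using mu by (auto simp: h1_def in_keys_iff lookup_minus mconst_def lookup_single)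
    then have sub: "Poly_Mapping.keys \<mu> \<subseteq> coords N n m" using h(1) by (auto simp: mvars_iff)
    obtain v where v: "v \<in> Poly_Mapping.keys \<mu>" using ex_key[OF ne] by blast
    obtain i j l where ijl: "v = (i, j, l)" "i \<in> {1..N}" "j \<in> {1..n i}" "l \<in> {1..m i}"
      using v sub unfolding coords_def by blast
    have "0 < a i l * Poly_Mapping.lookup \<mu> (i, j, l)"
      using v a[OF ijl(2,4)] by (auto simp: in_keys_iff ijl)
    also have "\<dots> \<le> (\<Sum>l=1..m i. a i l * Poly_Mapping.lookup \<mu> (i, j, l))"
      using ijl by (intro member_le_sum) auto
    also have "\<dots> \<le> (\<Sum>j=1..n i. \<Sum>l=1..m i. a i l * Poly_Mapping.lookup \<mu> (i, j, l))"
      using member_le_sum[of j "{1..n i}" "\<lambda>j. \<Sum>l=1..m i. a i l * Poly_Mapping.lookup \<mu> (i, j, l)"] ijl by auto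
    also have "\<dots> \<le> wt \<mu>" unfolding wt_def
      using member_le_sum[of i "{1..N}" "\<lambda>i. \<Sum>j=1..n i. \<Sum>l=1..m i. a i l * Poly_Mapping.lookup \<mu> (i, j, l)"] ijl by auto
    finally show ?thesis .
  qed
  have "h1 * f = 0"
  proof (rule ccontr)
    assume "h1 * f \<noteq> 0"
    then obtain \<mu> where mu: "\<mu> \<in> Poly_Mapping.keys (h1 * f)" using ex_key by blast
    then obtain \<alpha> \<beta> where ab: "\<mu> = \<alpha> + \<beta>" "\<alpha> \<in> Poly_Mapping.keys h1" "\<beta> \<in> Poly_Mapping.keys f"
      using keys_mult[of h1 f] by blast
    have big: "wt \<mu> > e" using h1[OF ab(2)] wf[OF ab(3)] by (simp add: ab wt_add)
    have "h1 * f = g - mconst c * f" using g_eq by simp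
    then have "\<mu> \<in> Poly_Mapping.keys g \<or> \<mu> \<in> Poly_Mapping.keys (mconst c * f)"
      using mu by (auto simp: in_keys_iff lookup_minus)
    then have "wt \<mu> = e" using wg ee wf keys_mconst_mult[of c f] by blast
    then show False using big by simp
  qed
  then have "g = mconst c * f" using g_eq by simp
  moreover have "c \<noteq> 0" using calculation g(2) by (auto simp: mconst_def)
  ultimately show ?thesis by blast
qed

section \<open>The point with given coordinates\<close>

text \<open>Factors \<open>(i, j)\<close> are encoded as natural numbers to order multidegrees
  linearly; polynomials with multidegrees as exponents then form an integral domain.\<close>

definition mdeg :: "(nat \<Rightarrow> nat \<Rightarrow> nat) \<Rightarrow> (coord \<Rightarrow>\<^sub>0 nat) \<Rightarrow> (nat \<Rightarrow>\<^sub>0 nat)" where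
  "mdeg a \<mu> = (\<Sum>(i, j, l)\<in>Poly_Mapping.keys \<mu>. Poly_Mapping.single (prod_encode (i, j)) (a i l * Poly_Mapping.lookup \<mu> (i, j, l)))"

lemma mdeg_superset:
  "finite A \<Longrightarrow> Poly_Mapping.keys \<mu> \<subseteq> A \<Longrightarrow> mdeg a \<mu> =
    (\<Sum>(i, j, l)\<in>A. Poly_Mapping.single (prod_encode (i, j)) (a i l * Poly_Mapping.lookup \<mu> (i, j, l)))"
  unfolding mdeg_def by (rule sum.mono_neutral_left) (auto simp: in_keys_iff)

lemma mdeg_add: "mdeg a (\<mu> + \<nu>) = mdeg a \<mu> + mdeg a \<nu>"
proof -
  let ?A = "Poly_Mapping.keys \<mu> \<union> Poly_Mapping.keys \<nu>"
  have "mdeg a \<xi> = (\<Sum>(i, j, l)\<in>?A. Poly_Mapping.single (prod_encode (i, j)) (a i l * Poly_Mapping.lookup \<xi> (i, j, l)))"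
    if "Poly_Mapping.keys \<xi> \<subseteq> ?A" for \<xi> using that by (intro mdeg_superset) auto
  then show ?thesis using keys_add[of \<mu> \<nu>]
    by (simp add: lookup_add distrib_left single_add sum.distrib case_prod_unfold)
qed

lemma finite_coords: "finite (coords N n m)"
proof -
  have "coords N n m = (SIGMA i:{1..N}. {1..n i} \<times> {1..m i})" by (auto simp: coords_def)
  then show ?thesis by simp
qed

lemma mdeg_eq_sum:
  assumes "Poly_Mapping.keys \<mu> \<subseteq> coords N n m"
  shows "mdeg a \<mu> = (\<Sum>i=1..N. \<Sum>j=1..n i.
    Poly_Mapping.single (prod_encode (i, j)) (\<Sum>l=1..m i. a i l * Poly_Mapping.lookup \<mu> (i, j, l)))"
proof -
  have c: "coords N n m = (SIGMA i:{1..N}. {1..n i} \<times> {1..m i})" by (auto simp: coords_def)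
  have s: "Poly_Mapping.single v (\<Sum>l\<in>A. h l) = (\<Sum>l\<in>A. Poly_Mapping.single v (h l :: nat))" for v :: nat and h and A :: "nat set"
    by (induction A rule: infinite_finite_induct) (auto simp: single_add)
  show ?thesis unfolding mdeg_superset[OF finite_coords assms] c
    by (subst sum.Sigma[symmetric]) (simp_all add: sum.cartesian_product[symmetric] s)
qed

lemma lookup_mdeg:
  assumes "Poly_Mapping.keys \<mu> \<subseteq> coords N n m" "i \<in> {1..N}" "j \<in> {1..n i}"
  shows "Poly_Mapping.lookup (mdeg a \<mu>) (prod_encode (i, j)) = (\<Sum>l=1..m i. a i l * Poly_Mapping.lookup \<mu> (i, j, l))"
proof -
  have "Poly_Mapping.lookup (mdeg a \<mu>) (prod_encode (i, j)) =
    (\<Sum>i'=1..N. \<Sum>j'=1..n i'. (\<Sum>l=1..m i'. a i' l * Poly_Mapping.lookup \<mu> (i', j', l)) when (i' = i \<and> j' = j))"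
    unfolding mdeg_eq_sum[OF assms(1)] by (simp add: lookup_sum lookup_single)
  also have "\<dots> = (\<Sum>i'=1..N. if i' = i then (\<Sum>l=1..m i'. a i' l * Poly_Mapping.lookup \<mu> (i', j, l)) else 0)"
  proof (rule sum.cong[OF refl])
    fix i'
    show "(\<Sum>j'=1..n i'. (\<Sum>l=1..m i'. a i' l * Poly_Mapping.lookup \<mu> (i', j', l)) when (i' = i \<and> j' = j))
      = (if i' = i then (\<Sum>l=1..m i'. a i' l * Poly_Mapping.lookup \<mu> (i', j, l)) else 0)"
      using assms(3) by (simp add: when_def)
  qed
  also have "\<dots> = (\<Sum>l=1..m i. a i l * Poly_Mapping.lookup \<mu> (i, j, l))" using assms(2) by simp
  finally show ?thesis .
qed

lemma multihomogeneous_mdeg: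
  assumes "multihomogeneous N n m a D f" "\<mu> \<in> Poly_Mapping.keys f"
  shows "mdeg a \<mu> = (\<Sum>i=1..N. \<Sum>j=1..n i. Poly_Mapping.single (prod_encode (i, j)) (D i j))"
proof -
  have "Poly_Mapping.keys \<mu> \<subseteq> coords N n m" using assms by (auto simp: multihomogeneous_def mvars_iff)
  then show ?thesis using assms unfolding multihomogeneous_def
    by (subst mdeg_eq_sum) (auto intro!: sum.cong)
qed

text \<open>The kernel of \<open>x\<^sub>i\<^sub>,\<^sub>j\<^sub>,\<^sub>l \<mapsto> x(i, j, l) T\<^sub>i\<^sub>,\<^sub>j ^ a\<^sub>i\<^sub>,\<^sub>l\<close>, i.e. the polynomials all
  of whose multihomogeneous components vanish at \<open>x\<close>.\<close>

definition point_ideal ::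
    "nat \<Rightarrow> (nat \<Rightarrow> nat) \<Rightarrow> (nat \<Rightarrow> nat) \<Rightarrow> (nat \<Rightarrow> nat \<Rightarrow> nat) \<Rightarrow> (coord \<Rightarrow> 'a::field) \<Rightarrow> (coord, 'a) mpoly set" where
  "point_ideal N n m a x = {p. mvars p \<subseteq> coords N n m \<and> monomial_hom id (mdeg a) (meval x) p = 0}"

lemma monomial_hom_multihomogeneous:
  assumes "multihomogeneous N n m a D f"
  shows "monomial_hom id (mdeg a) (meval x) f =
    Poly_Mapping.single (\<Sum>i=1..N. \<Sum>j=1..n i. Poly_Mapping.single (prod_encode (i, j)) (D i j)) (mpeval x f)"
proof -
  have s: "Poly_Mapping.single v (\<Sum>l\<in>A. h l) = (\<Sum>l\<in>A. Poly_Mapping.single v (h l))"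
    for v :: "nat \<Rightarrow>\<^sub>0 nat" and h :: "(coord \<Rightarrow>\<^sub>0 nat) \<Rightarrow> 'a" and A
    by (induction A rule: infinite_finite_induct) (auto simp: single_add)
  show ?thesis unfolding monomial_hom_def mpeval_def meval_def[symmetric] s
    by (intro sum.cong) (simp_all add: multihomogeneous_mdeg[OF assms])
qed

lemma point_ideal_iff:
  assumes "multihomogeneous N n m a D f"
  shows "f \<in> point_ideal N n m a x \<longleftrightarrow> mpeval x f = 0"
proof -
  have "Poly_Mapping.single v c = 0 \<longleftrightarrow> c = 0" for v :: "nat \<Rightarrow>\<^sub>0 nat" and c :: 'a
    by (metis lookup_single_eq lookup_zero single_zero)
  then show ?thesis using assms monomial_hom_multihomogeneous[OF assms, of x]
    by (simp add: point_ideal_def multihomogeneous_def)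
qed

text \<open>The homomorphism has values in an integral domain.\<close>

lemma point_ideal_primeideal: "primeideal (point_ideal N n m a x) (coord_ring N n m)"
proof -
  let ?R = "coord_ring N n m :: (coord, 'a::field) mpoly ring" and ?P = "point_ideal N n m a x"
  let ?t = "monomial_hom id (mdeg a) (meval x)"
  interpret R: cring ?R by (rule cring_coord_ring)
  have tm: "?t (p * q) = ?t p * ?t q" for p q
    by (rule monomial_hom_mult[OF field_embedding_id]) (simp_all add: mdeg_add meval_add)
  have ta: "?t (p + q) = ?t p + ?t q" for p q by (rule monomial_hom_add[OF field_embedding_id])
  have t0: "?t 0 = 0" by (rule monomial_hom_0[OF field_embedding_id])
  have t1: "?t 1 = 1"
    using monomial_hom_single[OF field_embedding_id, of "mdeg a" "meval x" 0 1] by (simp add: mdeg_def meval_0)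
  have tu: "?t (- p) = - ?t p" for p using ta[of p "- p"] t0 by (simp add: eq_neg_iff_add_eq_0 add.commute)
  have inv: "inv\<^bsub>add_monoid ?R\<^esub> p = - p" if "p \<in> carrier ?R" for p
    using that by (intro group.inv_equality[OF R.a_group]) (auto simp: mvars_uminus)
  have sg: "subgroup ?P (add_monoid ?R)"
  proof (rule subgroup.intro)
    show "?P \<subseteq> carrier (add_monoid ?R)" by (auto simp: point_ideal_def)
    show "p \<otimes>\<^bsub>add_monoid ?R\<^esub> q \<in> ?P" if "p \<in> ?P" "q \<in> ?P" for p q
      using that mvars_add[of p "coords N n m" q] by (simp add: point_ideal_def ta)
    show "\<one>\<^bsub>add_monoid ?R\<^esub> \<in> ?P" by (simp add: point_ideal_def t0 mvars_0)
    show "inv\<^bsub>add_monoid ?R\<^esub> p \<in> ?P" if "p \<in> ?P" for p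
      using that inv[of p] by (simp add: point_ideal_def tu mvars_uminus)
  qed
  have lc: "q * p \<in> ?P" if "p \<in> ?P" "q \<in> carrier ?R" for p q
    using that mvars_mult[of q "coords N n m" p] by (simp add: point_ideal_def tm)
  have "ideal ?P ?R"
    by (rule idealI[OF R.ring_axioms sg]) (use lc in \<open>simp_all add: mult.commute\<close>)
  moreover have "carrier ?R \<noteq> ?P"
  proof -
    have "1 \<in> carrier ?R" "1 \<notin> ?P" by (auto simp: mvars_1 point_ideal_def t1)
    then show ?thesis by blast
  qed
  ultimately show ?thesis
    by (intro primeidealI R.cring_axioms) (simp_all add: point_ideal_def tm)
qed

definition component :: "(nat \<Rightarrow> nat \<Rightarrow> nat) \<Rightarrow> (nat \<Rightarrow>\<^sub>0 nat) \<Rightarrow> (coord, 'a::field) mpoly \<Rightarrow> (coord, 'a) mpoly" where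
  "component a \<delta> p = (\<Sum>\<mu>\<in>{\<mu> \<in> Poly_Mapping.keys p. mdeg a \<mu> = \<delta>}. Poly_Mapping.single \<mu> (Poly_Mapping.lookup p \<mu>))"

lemma sum_components: "(\<Sum>\<delta>\<in>mdeg a ` Poly_Mapping.keys p. component a \<delta> p) = p"
  unfolding component_def
  using sum.image_gen[of "Poly_Mapping.keys p" "\<lambda>\<mu>. Poly_Mapping.single \<mu> (Poly_Mapping.lookup p \<mu>)" "mdeg a"]
  by (simp add: poly_mapping_eq_sum_single)

lemma keys_component: "Poly_Mapping.keys (component a \<delta> p) \<subseteq> {\<mu> \<in> Poly_Mapping.keys p. mdeg a \<mu> = \<delta>}"
  unfolding component_def by (rule order.trans[OF keys_sum]) (auto split: if_splits)

lemma component_multihomogeneous: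
  assumes "mvars p \<subseteq> coords N n m"
  shows "multihomogeneous N n m a (\<lambda>i j. Poly_Mapping.lookup \<delta> (prod_encode (i, j))) (component a \<delta> p)"
  using keys_component[of a \<delta> p] assms lookup_mdeg[of _ N n m]
  unfolding multihomogeneous_def by (fastforce simp: mvars_iff)

lemma mpeval_component: "mpeval x (component a \<delta> p) = Poly_Mapping.lookup (monomial_hom id (mdeg a) (meval x) p) \<delta>"
  unfolding component_def monomial_hom_def
  by (simp add: mpeval_sum mpeval_single lookup_sum lookup_single when_def sum.If_cases Int_def conj_commute)

lemma component_in_point_ideal:
  assumes "p \<in> point_ideal N n m a x" shows "component a \<delta> p \<in> point_ideal N n m a x"
  using assms component_multihomogeneous[of p N n m a \<delta>]
  by (subst point_ideal_iff) (auto simp: mpeval_component point_ideal_def)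

lemma ideal_sum_closed:
  assumes "ideal I (coord_ring N n m)" "\<And>i. i \<in> A \<Longrightarrow> (f i :: (coord, 'a::field) mpoly) \<in> I"
  shows "(\<Sum>i\<in>A. f i) \<in> I"
proof -
  interpret ideal I "coord_ring N n m" by (rule assms(1))
  have "0 \<in> I" using additive_subgroup.zero_closed[OF additive_subgroup_axioms] by simp
  moreover have "p + q \<in> I" if "p \<in> I" "q \<in> I" for p q using additive_subgroup.a_closed[OF additive_subgroup_axioms that] by simp
  ultimately show ?thesis using assms(2) by (induction A rule: infinite_finite_induct) auto
qed

lemma point_ideal_homogeneous:
  fixes x :: "coord \<Rightarrow> 'a::field"
  shows "point_ideal N n m a x =
    Idl\<^bsub>coord_ring N n m\<^esub> {f \<in> point_ideal N n m a x. \<exists>D. multihomogeneous N n m a D f}"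
    (is "?P = Idl\<^bsub>?R\<^esub> ?S")
proof
  interpret R: cring ?R by (rule cring_coord_ring)
  interpret P: primeideal ?P ?R by (rule point_ideal_primeideal)
  show "Idl\<^bsub>?R\<^esub> ?S \<subseteq> ?P" by (rule R.genideal_minimal[OF P.ideal_axioms]) blast
  have S: "?S \<subseteq> carrier ?R" by (auto simp: point_ideal_def)
  show "?P \<subseteq> Idl\<^bsub>?R\<^esub> ?S"
  proof
    fix p assume p: "p \<in> ?P"
    then have v: "mvars p \<subseteq> coords N n m" by (simp add: point_ideal_def)
    have "(\<Sum>\<delta>\<in>mdeg a ` Poly_Mapping.keys p. component a \<delta> p) \<in> Idl\<^bsub>?R\<^esub> ?S"
    proof (rule ideal_sum_closed[OF R.genideal_ideal[OF S]])
      fix \<delta>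
      have "component a \<delta> p \<in> ?S"
        using component_in_point_ideal[OF p] component_multihomogeneous[OF v] by blast
      then show "component a \<delta> p \<in> Idl\<^bsub>?R\<^esub> ?S" using R.genideal_self[OF S] by blast
    qed
    then show "p \<in> Idl\<^bsub>?R\<^esub> ?S" by (simp add: sum_components)
  qed
qed

lemma point_ideal_wproj:
  assumes "\<And>i j. i \<in> {1..N} \<Longrightarrow> j \<in> {1..n i} \<Longrightarrow> \<exists>l\<in>{1..m i}. x (i, j, l) \<noteq> 0"
  shows "point_ideal N n m a x \<in> wproj_points N n m a"
  unfolding wproj_points_def
proof (intro CollectI conjI ballI point_ideal_primeideal point_ideal_homogeneous)
  fix i j assume ij: "i \<in> {1..N}" "j \<in> {1..n i}"
  then obtain l where l: "l \<in> {1..m i}" "x (i, j, l) \<noteq> 0" using assms by blast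
  have "monomial_hom id (mdeg a) (meval x) (mvar (i, j, l)) =
     Poly_Mapping.single (mdeg a (Poly_Mapping.single (i, j, l) 1)) (x (i, j, l))"
    unfolding mvar_def by (simp add: monomial_hom_single[OF field_embedding_id] meval_single)
  then have "monomial_hom id (mdeg a) (meval x) (mvar (i, j, l)) \<noteq> 0"
    using l(2) by (metis lookup_single_eq lookup_zero)
  then show "\<exists>l\<in>{1..m i}. mvar (i, j, l) \<notin> point_ideal N n m a x" using l(1) by (auto simp: point_ideal_def)
qed

text \<open>The constant is the quotient of the values at \<open>x\<close>.\<close>

lemma point_ideal_rational_at:
  fixes x :: "coord \<Rightarrow> 'a::field"
  shows "rational_at N n m a (point_ideal N n m a x)"
  unfolding rational_at_def
proof (intro allI impI)
  fix D and f g :: "(coord, 'a) mpoly"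
  assume fg: "multihomogeneous N n m a D f \<and> multihomogeneous N n m a D g \<and> g \<notin> point_ideal N n m a x"
  define c where "c = mpeval x f / mpeval x g"
  have g: "mpeval x g \<noteq> 0" using fg point_ideal_iff by blast
  have k: "Poly_Mapping.keys (f - mconst c * g) \<subseteq> Poly_Mapping.keys f \<union> Poly_Mapping.keys g"
    using keys_minus_subset[of f "mconst c * g"] keys_mconst_mult[of c g] by blast
  have "multihomogeneous N n m a D (f - mconst c * g)"
    unfolding multihomogeneous_def coord_ring_simps mvars_iff
    using fg k unfolding multihomogeneous_def coord_ring_simps mvars_iff by blast
  moreover have "mpeval x (f - mconst c * g) = 0"
    using g by (simp add: mpeval_minus mpeval_mconst_mult c_def)
  ultimately show "\<exists>c. f - mconst c * g \<in> point_ideal N n m a x" using point_ideal_iff by blast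
qed

definition equivariant :: "('k::field \<Rightarrow> 'a::field) \<Rightarrow> nat \<Rightarrow> (nat \<Rightarrow> nat) \<Rightarrow> (nat \<Rightarrow> nat) \<Rightarrow>
    (('a \<Rightarrow> 'a) \<Rightarrow> nat \<Rightarrow> nat \<Rightarrow> nat) \<Rightarrow> (coord \<Rightarrow> 'a) \<Rightarrow> bool" where
  "equivariant \<iota> N n m \<pi> x \<longleftrightarrow> (\<forall>\<sigma>\<in>Gal \<iota>. \<forall>v\<in>coords N n m. x (permute_coord (\<pi> \<sigma>) v) = \<sigma> (x v))"

text \<open>The ideal is generated by its multihomogeneous elements, and for these membership means vanishing
  at \<open>x\<close>, which the action preserves because \<open>x\<close> is equivariant.\<close>

lemma point_ideal_Gal:
  assumes act: "factor_action \<iota> N n \<pi>" and x: "equivariant \<iota> N n m \<pi> x" and s: "\<sigma> \<in> Gal \<iota>"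
  shows "gal_act \<pi> \<sigma> ` point_ideal N n m a x = point_ideal N n m a x" (is "_ ` ?P = _")
proof -
  have sub: "gal_act \<pi> \<tau> p \<in> ?P" if t: "\<tau> \<in> Gal \<iota>" and p: "p \<in> ?P" for \<tau> p
  proof -
    have v: "mvars p \<subseteq> coords N n m" using p by (simp add: point_ideal_def)
    have "gal_act \<pi> \<tau> p = gal_act \<pi> \<tau> (\<Sum>\<delta>\<in>mdeg a ` Poly_Mapping.keys p. component a \<delta> p)"
      by (simp add: sum_components)
    also have "\<dots> = (\<Sum>\<delta>\<in>mdeg a ` Poly_Mapping.keys p. gal_act \<pi> \<tau> (component a \<delta> p))"
      unfolding gal_act_monomial_hom by (rule monomial_hom_sum[OF Gal_emb[OF t]])
    also have "\<dots> \<in> ?P"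
    proof (rule ideal_sum_closed[OF primeideal.axioms(1)[OF point_ideal_primeideal]])
      fix \<delta> :: "nat \<Rightarrow>\<^sub>0 nat"
      define D where "D i j = Poly_Mapping.lookup \<delta> (prod_encode (i, j))" for i j
      have mh: "multihomogeneous N n m a D (component a \<delta> p)"
        unfolding D_def using component_multihomogeneous[OF v] .
      have "multihomogeneous N n m a (\<lambda>i j. D i (inv_into UNIV (\<pi> \<tau> i) j)) (gal_act \<pi> \<tau> (component a \<delta> p))"
        by (rule multihomogeneous_gal_act[OF act t mh])
          (simp add: permutes_inverses(2)[OF action_permutes[OF act t]])
      moreover have "mpeval x (gal_act \<pi> \<tau> (component a \<delta> p)) = \<tau> (mpeval x (component a \<delta> p))"
        using x mh t by (intro mpeval_gal_act[OF Gal_emb[OF t]]) (auto simp: multihomogeneous_def equivariant_def)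
      moreover have "mpeval x (component a \<delta> p) = 0"
        using component_in_point_ideal[OF p] point_ideal_iff[OF mh] by blast
      ultimately show "gal_act \<pi> \<tau> (component a \<delta> p) \<in> ?P"
        using point_ideal_iff field_embedding_0[OF Gal_emb[OF t]] by metis
    qed
    finally show ?thesis .
  qed
  show ?thesis
  proof
    show "gal_act \<pi> \<sigma> ` ?P \<subseteq> ?P" using sub[OF s] by blast
    show "?P \<subseteq> gal_act \<pi> \<sigma> ` ?P"
    proof
      fix p assume p: "p \<in> ?P"
      then have "p = gal_act \<pi> \<sigma> (gal_act \<pi> (inv_into UNIV \<sigma>) p)"
        using gal_act_inv[OF act s, where p = p and m = m] by (simp add: point_ideal_def)
      then show "p \<in> gal_act \<pi> \<sigma> ` ?P" using sub[OF Gal_inv[OF s] p] by blast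
    qed
  qed
qed

section \<open>Solving the equations one factor at a time\<close>

lemma gal_act_comp:
  assumes act: "factor_action \<iota> N n \<pi>" and s: "\<sigma> \<in> Gal \<iota>" and t: "\<tau> \<in> Gal \<iota>"
    and p: "mvars p \<subseteq> coords N n m"
  shows "gal_act \<pi> \<sigma> (gal_act \<pi> \<tau> p) = gal_act \<pi> (\<sigma> \<circ> \<tau>) p"
proof -
  have pc: "permute_coord (\<pi> \<sigma>) (permute_coord (\<pi> \<tau>) v) = permute_coord (\<pi> (\<sigma> \<circ> \<tau>)) v"
    if "v \<in> coords N n m" for v
    using that action_comp[OF act s t] by (auto simp: coords_def permute_coord_def)
  have pm: "permute_monom (\<pi> \<sigma>) (permute_monom (\<pi> \<tau>) \<mu>) = permute_monom (\<pi> (\<sigma> \<circ> \<tau>)) \<mu>"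
    if mu: "\<mu> \<in> Poly_Mapping.keys p" for \<mu>
  proof -
    have "v \<in> coords N n m" if "v \<in> Poly_Mapping.keys \<mu>" for v using p that mu unfolding mvars_iff by blast
    then show ?thesis
      unfolding permute_monom_def[of "\<pi> \<tau>"] permute_monom_def[of "\<pi> (\<sigma> \<circ> \<tau>)"] permute_monom_sum permute_monom_single
      by (intro sum.cong) (simp_all add: pc)
  qed
  show ?thesis
    unfolding gal_act_monomial_hom monomial_hom_def[of "\<tau>"] monomial_hom_def[of "\<sigma> \<circ> \<tau>"] monomial_hom_sum[OF Gal_emb[OF s]]
    by (intro sum.cong) (auto simp: monomial_hom_single[OF Gal_emb[OF s]] pm)
qed

text \<open>The quotient of \<open>F\<close> by one of its nonzero values is Galois invariant, so its values lie in the base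
  field. A linear retraction onto the base field leaves these values unchanged, and applied to the
  coefficients it gives a form over the base field.\<close>

lemma form_descent:
  fixes \<iota> :: "'k::field \<Rightarrow> 'a::field"
  assumes sc: "separable_closure \<iota>" and F: "form \<iota> V d F"
    and inv: "\<And>\<sigma>. \<sigma> \<in> Gal \<iota> \<Longrightarrow> \<exists>C. C \<noteq> 0 \<and> (\<forall>y. F y = C * \<sigma> (F y))"
  shows "\<exists>G. form id V d G \<and> (\<forall>y. G y = 0 \<longrightarrow> F y = 0)"
proof (cases "\<exists>y. F y \<noteq> 0")
  case False
  then show ?thesis using form_0 by blast
next
  case True
  then obtain y0 where y0: "F y0 \<noteq> 0" by blast
  note emb = separable_closureD(1)[OF sc]
  obtain r :: "'a \<Rightarrow> 'k" where r: "\<And>x y. r (x + y) = r x + r y" "\<And>c x. r (\<iota> c * x) = c * r x" "r 1 = 1"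
    using ex_linear_retraction[OF emb] by metis
  have G: "form id V d (\<lambda>y. r (inverse (F y0) * F y))"
    using form_retract[OF form_scale[OF F] emb r(1,2)] .
  have "F y = 0" if z: "r (inverse (F y0) * F y) = 0" for y
  proof -
    have "inverse (F y0) * F y \<in> range \<iota>"
    proof (rule Gal_fixed_imp_base[OF sc])
      fix \<sigma> assume s: "\<sigma> \<in> Gal \<iota>"
      obtain C where C: "C \<noteq> 0" "\<And>y. F y = C * \<sigma> (F y)" using inv[OF s] by blast
      have "\<sigma> (inverse (F y0) * F y) = inverse (C * \<sigma> (F y0)) * (C * \<sigma> (F y))"
        using C(1) by (simp add: field_embedding_mult[OF Gal_emb[OF s]] field_embedding_inverse[OF Gal_emb[OF s]])
      then show "\<sigma> (inverse (F y0) * F y) = inverse (F y0) * F y" using C(2) by metis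
    qed
    then obtain c where c: "inverse (F y0) * F y = \<iota> c" by auto
    have "c = 0" using z c r(2)[of c 1] r(3) by simp
    then show ?thesis using c y0 field_embedding_0[OF emb] by simp
  qed
  then show ?thesis using G by blast
qed

text \<open>In each monomial of \<open>f\<close> the coordinates of the \<open>i\<close>-th orbit of factors become forms of degree equal
  to their weight, and the other coordinates are constants. The degree of the result is therefore
  the sum of the weighted degrees of \<open>f\<close> in these factors.\<close>

lemma mpeval_form:
  fixes X :: "('v \<Rightarrow> 'k::field) \<Rightarrow> coord \<Rightarrow> 'a::field"
  assumes f: "multihomogeneous N n m a D f" and i: "i \<in> {1..N}"
    and X: "\<And>j l. j \<in> {1..n i} \<Longrightarrow> l \<in> {1..m i} \<Longrightarrow> form \<iota> V (a i l) (\<lambda>y. X y (i, j, l))"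
    and X0: "\<And>v y. fst v \<noteq> i \<Longrightarrow> X y v = x0 v"
  shows "form \<iota> V (\<Sum>j=1..n i. D i j) (\<lambda>y. mpeval (X y) f)"
proof -
  let ?C = "coords N n m"
  define e where "e v = (if fst v = i then a i (snd (snd v)) else 0)" for v :: coord
  have Xe: "form \<iota> V (e v) (\<lambda>y. X y v)" if v: "v \<in> ?C" for v
  proof (cases "fst v = i")
    case True
    then obtain j l where "v = (i, j, l)" "j \<in> {1..n i}" "l \<in> {1..m i}"
      using v unfolding coords_def by force
    then show ?thesis using X by (simp add: e_def)
  next
    case False
    then show ?thesis using form_const[of \<iota> V "x0 v"] by (simp add: e_def X0)
  qed
  have c: "?C = (SIGMA i:{1..N}. {1..n i} \<times> {1..m i})" by (auto simp: coords_def)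
  have "form \<iota> V (\<Sum>j=1..n i. D i j) (\<lambda>y. Poly_Mapping.lookup f \<mu> * meval (X y) \<mu>)"
    if mu: "\<mu> \<in> Poly_Mapping.keys f" for \<mu>
  proof -
    have sub: "Poly_Mapping.keys \<mu> \<subseteq> ?C" using f mu by (auto simp: multihomogeneous_def mvars_iff)
    have "(\<Sum>v\<in>?C. Poly_Mapping.lookup \<mu> v * e v) =
        (\<Sum>i'=1..N. \<Sum>j=1..n i'. \<Sum>l=1..m i'. if i' = i then a i l * Poly_Mapping.lookup \<mu> (i, j, l) else 0)"
      unfolding c sum.cartesian_product
      by (subst sum.Sigma) (auto simp: e_def intro!: sum.cong)
    also have "\<dots> = (\<Sum>i'=1..N. if i' = i then \<Sum>j=1..n i. \<Sum>l=1..m i. a i l * Poly_Mapping.lookup \<mu> (i, j, l) else 0)"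
      by (intro sum.cong) auto
    also have "\<dots> = (\<Sum>j=1..n i. \<Sum>l=1..m i. a i l * Poly_Mapping.lookup \<mu> (i, j, l))" using i by simp
    also have "\<dots> = (\<Sum>j=1..n i. D i j)"
      using f mu i unfolding multihomogeneous_def by (intro sum.cong) auto
    finally have deg: "(\<Sum>v\<in>?C. Poly_Mapping.lookup \<mu> v * e v) = (\<Sum>j=1..n i. D i j)" .
    have "form \<iota> V (\<Sum>v\<in>?C. Poly_Mapping.lookup \<mu> v * e v) (\<lambda>y. meval (X y) \<mu>)"
      unfolding meval_superset[OF finite_coords sub] by (intro form_prod form_power Xe)
    then show ?thesis unfolding deg by (rule form_scale)
  qed
  then show ?thesis unfolding mpeval_def meval_def[symmetric] by (rule form_sum)
qed

text \<open>Put \<open>x\<^sub>i\<^sub>,\<^sub>j\<^sub>,\<^sub>l = \<Sum>\<^sub>u w\<^sub>u(j) \<nu>\<^sub>l(y\<^sub>l\<^sub>,\<^sub>u)\<close> with independent equivariant vectors \<open>w\<^sub>u\<close>, a normic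
  form \<open>\<nu>\<^sub>l\<close> of degree \<open>a\<^sub>i\<^sub>,\<^sub>l\<close>, and \<open>a\<^sub>i\<^sub>,\<^sub>l\<close> new variables for each pair \<open>(l, u)\<close>. This is
  equivariant for all values of the variables in the base field, it is zero only if all the variables
  are, and it is of degree \<open>a\<^sub>i\<^sub>,\<^sub>l\<close>. The products become forms of degree \<open>n\<^sub>i D\<^sub>q\<close> over the
  base field in \<open>n\<^sub>i \<Sum>\<^sub>l a\<^sub>i\<^sub>,\<^sub>l\<close> variables.\<close>

lemma solve_factor:
  fixes \<iota> :: "'k::field \<Rightarrow> 'a::field"
  assumes C1: "C1_field TYPE('k)" and ad: "admits_normic_forms TYPE('k)"
    and sc: "separable_closure \<iota>" and act: "factor_action \<iota> N n \<pi>"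
    and i: "i \<in> {1..N}" and ni: "1 \<le> n i" and a: "\<And>l. l \<in> {1..m i} \<Longrightarrow> 1 \<le> a i l"
    and x0: "equivariant \<iota> N n m \<pi> x0"
    and Q: "finite Q" and f: "\<And>q t. q \<in> Q \<Longrightarrow> t \<in> T q \<Longrightarrow> multihomogeneous N n m a (d t) (f t)"
    and D: "\<And>q j. q \<in> Q \<Longrightarrow> j \<in> {1..n i} \<Longrightarrow> (\<Sum>t\<in>T q. d t i j) = D q" "\<And>q. q \<in> Q \<Longrightarrow> 1 \<le> D q"
    and lt: "(\<Sum>q\<in>Q. D q) < (\<Sum>l=1..m i. a i l)"
    and inv: "\<And>q \<sigma>. q \<in> Q \<Longrightarrow> \<sigma> \<in> Gal \<iota> \<Longrightarrow> \<exists>C. C \<noteq> 0 \<and> (\<forall>x. equivariant \<iota> N n m \<pi> x \<longrightarrow>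
          (\<Prod>t\<in>T q. mpeval x (f t)) = C * \<sigma> (\<Prod>t\<in>T q. mpeval x (f t)))"
  shows "\<exists>x. equivariant \<iota> N n m \<pi> x \<and> (\<forall>v. fst v \<noteq> i \<longrightarrow> x v = x0 v) \<and>
     (\<exists>j\<in>{1..n i}. \<exists>l\<in>{1..m i}. x (i, j, l) \<noteq> 0) \<and> (\<forall>q\<in>Q. (\<Prod>t\<in>T q. mpeval x (f t)) = 0)"
proof -
  note emb = separable_closureD(1)[OF sc]
  have "\<exists>S. finite S \<and> (\<forall>\<sigma>\<in>Gal \<iota>. (\<forall>x\<in>S. \<sigma> x = x) \<longrightarrow> (\<forall>i\<in>{1..N}. \<pi> \<sigma> i = id))"
    using act unfolding factor_action_def by (elim conjE)
  then obtain S where "finite S" "\<forall>\<sigma>\<in>Gal \<iota>. (\<forall>x\<in>S. \<sigma> x = x) \<longrightarrow> (\<forall>i\<in>{1..N}. \<pi> \<sigma> i = id)"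
    by (elim exE conjE)
  then have S: "finite S" "\<And>\<sigma>. \<sigma> \<in> Gal \<iota> \<Longrightarrow> (\<And>x. x \<in> S \<Longrightarrow> \<sigma> x = x) \<Longrightarrow> \<pi> \<sigma> i = id"
    using i by auto
  have "\<exists>w :: nat \<Rightarrow> nat \<Rightarrow> 'a.
    (\<forall>u\<in>{1..n i}. \<forall>\<sigma>\<in>Gal \<iota>. \<forall>j\<in>{1..n i}. \<sigma> (w u j) = w u (\<pi> \<sigma> i j)) \<and>
    (\<forall>c. (\<forall>j\<in>{1..n i}. (\<Sum>u=1..n i. c u * w u j) = 0) \<longrightarrow> (\<forall>u\<in>{1..n i}. c u = 0))"
    by (rule ex_equivariant_basis[OF sc, where S = S and \<rho> = "\<lambda>\<sigma>. \<pi> \<sigma> i"])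
      (use action_permutes[OF act _ i] action_comp[OF act _ _ i] action_trans[OF act i, of 1] S ni in \<open>simp_all\<close>)
  then obtain w :: "nat \<Rightarrow> nat \<Rightarrow> 'a" where
    w: "\<And>u \<sigma> j. u \<in> {1..n i} \<Longrightarrow> \<sigma> \<in> Gal \<iota> \<Longrightarrow> j \<in> {1..n i} \<Longrightarrow> \<sigma> (w u j) = w u (\<pi> \<sigma> i j)"
    and indep: "\<And>c u. (\<And>j. j \<in> {1..n i} \<Longrightarrow> (\<Sum>u=1..n i. c u * w u j) = 0) \<Longrightarrow> u \<in> {1..n i} \<Longrightarrow> c u = 0"
    by blast
  have "\<exists>\<nu> :: (nat \<Rightarrow> 'k) \<Rightarrow> 'k. form id {..<a i l} (a i l) \<nu> \<and> (\<forall>z. \<nu> z = 0 \<longrightarrow> (\<forall>h\<in>{..<a i l}. z h = 0))"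
    if "l \<in> {1..m i}" for l
  proof -
    have "{..<a i l} \<noteq> {}" using a[OF that] by (auto simp: lessThan_empty_iff)
    then show ?thesis using normic_zero[OF ad, of "{..<a i l}"] by simp
  qed
  then obtain \<nu> :: "nat \<Rightarrow> (nat \<Rightarrow> 'k) \<Rightarrow> 'k" where
    \<nu>: "\<And>l. l \<in> {1..m i} \<Longrightarrow> form id {..<a i l} (a i l) (\<nu> l)"
      "\<And>l z h. l \<in> {1..m i} \<Longrightarrow> \<nu> l z = 0 \<Longrightarrow> h < a i l \<Longrightarrow> z h = 0"
    by (metis lessThan_iff)
  define V where "V = (SIGMA l:{1..m i}. {1..n i} \<times> {..<a i l})"
  have finV: "finite V" unfolding V_def by simp
  have cardV: "card V = n i * (\<Sum>l=1..m i. a i l)"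
    unfolding V_def by (simp add: sum_distrib_left)
  define X where "X y = (\<lambda>(i', j, l). if i' = i then \<Sum>u=1..n i. w u j * \<iota> (\<nu> l (\<lambda>h. y (l, u, h))) else x0 (i', j, l))"
    for y :: "nat \<times> nat \<times> nat \<Rightarrow> 'k"
  have Xe: "equivariant \<iota> N n m \<pi> (X y)" for y
    unfolding equivariant_def
  proof (intro ballI)
    fix \<sigma> v assume s: "\<sigma> \<in> Gal \<iota>" and v: "v \<in> coords N n m"
    obtain i' j l where ijl: "v = (i', j, l)" "j \<in> {1..n i'}" using v unfolding coords_def by blast
    show "X y (permute_coord (\<pi> \<sigma>) v) = \<sigma> (X y v)"
    proof (cases "i' = i")
      case True
      then show ?thesis using ijl(2)
        by (simp add: ijl(1) X_def permute_coord_def field_embedding_sum[OF Gal_emb[OF s]]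
            field_embedding_mult[OF Gal_emb[OF s]] Gal_base[OF s] w[OF _ s])
    next
      case False
      have "x0 (permute_coord (\<pi> \<sigma>) v) = \<sigma> (x0 v)" using x0 s v unfolding equivariant_def by blast
      then show ?thesis using False by (simp add: ijl(1) X_def permute_coord_def)
    qed
  qed
  have Xf: "form \<iota> V (a i l) (\<lambda>y. X y (i, j, l))" if l: "l \<in> {1..m i}" for j l
  proof -
    have "form id V (a i l * 1) (\<lambda>y. \<nu> l (\<lambda>h. y (l, u, h)))" if u: "u \<in> {1..n i}" for u
      by (rule form_compose[OF \<nu>(1)[OF l]]) (intro form_var_id, use l u in \<open>simp add: V_def\<close>)
    then have "form \<iota> V (a i l) (\<lambda>y. w u j * \<iota> (\<nu> l (\<lambda>h. y (l, u, h))))" if "u \<in> {1..n i}" for u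
      using form_scale[OF form_embed[OF _ emb]] that by fastforce
    then have "form \<iota> V (a i l) (\<lambda>y. \<Sum>u=1..n i. w u j * \<iota> (\<nu> l (\<lambda>h. y (l, u, h))))"
      by (rule form_sum)
    then show ?thesis by (simp add: X_def)
  qed
  have "\<exists>G. form id V (n i * D q) G \<and> (\<forall>y. G y = 0 \<longrightarrow> (\<Prod>t\<in>T q. mpeval (X y) (f t)) = 0)"
    if q: "q \<in> Q" for q
  proof (rule form_descent[OF sc])
    have "form \<iota> V (\<Sum>j=1..n i. d t i j) (\<lambda>y. mpeval (X y) (f t))" if "t \<in> T q" for t
      by (rule mpeval_form[where ?x0.0 = x0, OF f[OF q that] i Xf]) (auto simp: X_def)
    then have "form \<iota> V (\<Sum>t\<in>T q. \<Sum>j=1..n i. d t i j) (\<lambda>y. \<Prod>t\<in>T q. mpeval (X y) (f t))"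
      by (rule form_prod)
    moreover have "(\<Sum>t\<in>T q. \<Sum>j=1..n i. d t i j) = n i * D q"
      by (subst sum.swap) (simp add: D(1)[OF q])
    ultimately show "form \<iota> V (n i * D q) (\<lambda>y. \<Prod>t\<in>T q. mpeval (X y) (f t))" by simp
    show "\<exists>C. C \<noteq> 0 \<and> (\<forall>y. (\<Prod>t\<in>T q. mpeval (X y) (f t)) = C * \<sigma> (\<Prod>t\<in>T q. mpeval (X y) (f t)))"
      if "\<sigma> \<in> Gal \<iota>" for \<sigma> using inv[OF q that] Xe by blast
  qed
  then obtain G where G: "\<And>q. q \<in> Q \<Longrightarrow> form id V (n i * D q) (G q)"
    "\<And>q y. q \<in> Q \<Longrightarrow> G q y = 0 \<Longrightarrow> (\<Prod>t\<in>T q. mpeval (X y) (f t)) = 0" by metis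
  have "\<exists>y. (\<exists>v\<in>V. y v \<noteq> 0) \<and> (\<forall>q\<in>Q. G q y = 0)"
  proof (rule common_zero_forms[OF C1 ad Q finV _ _ G(1)])
    show "1 \<le> n i * D q" if "q \<in> Q" for q using ni D(2)[OF that] by simp
    show "(\<Sum>q\<in>Q. n i * D q) < card V"
      using lt ni unfolding cardV sum_distrib_left[symmetric] by simp
  qed
  then obtain y v where y: "v \<in> V" "y v \<noteq> 0" "\<And>q. q \<in> Q \<Longrightarrow> G q y = 0" by blast
  obtain l u h where v: "v = (l, u, h)" "l \<in> {1..m i}" "u \<in> {1..n i}" "h < a i l"
    using y(1) unfolding V_def by auto
  have "\<iota> (\<nu> l (\<lambda>h. y (l, u, h))) \<noteq> 0"
    using \<nu>(2)[OF v(2) _ v(4), of "\<lambda>h. y (l, u, h)"] y(2) field_embedding_eq_0_iff[OF emb] by (auto simp: v(1))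
  moreover have "\<iota> (\<nu> l (\<lambda>h. y (l, u, h))) = 0" if "\<And>j. j \<in> {1..n i} \<Longrightarrow> X y (i, j, l) = 0"
  proof (rule indep[of "\<lambda>u. \<iota> (\<nu> l (\<lambda>h. y (l, u, h)))", OF _ v(3)])
    show "(\<Sum>u=1..n i. \<iota> (\<nu> l (\<lambda>h. y (l, u, h))) * w u j) = 0" if "j \<in> {1..n i}" for j
      using \<open>\<And>j. j \<in> {1..n i} \<Longrightarrow> X y (i, j, l) = 0\<close>[OF that] by (simp add: X_def mult.commute)
  qed
  ultimately have "\<exists>j\<in>{1..n i}. X y (i, j, l) \<noteq> 0" by blast
  moreover have "\<forall>v. fst v \<noteq> i \<longrightarrow> X y v = x0 v" by (auto simp: X_def)
  ultimately show ?thesis using Xe[of y] v(2) G(2) y(3) by blast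
qed

section \<open>Galois orbits of hypersurfaces\<close>

text \<open>As all weights are positive, a monomial of degree zero in every factor is constant.\<close>

lemma nonconstant_degree:
  assumes a: "\<And>i l. i \<in> {1..N} \<Longrightarrow> l \<in> {1..m i} \<Longrightarrow> 1 \<le> a i l"
    and f: "hypersurface_eq N n m a D f"
  shows "\<exists>i\<in>{1..N}. \<exists>j\<in>{1..n i}. D i j \<noteq> 0"
proof (rule ccontr)
  assume "\<not> ?thesis"
  then have D0: "\<And>i j. i \<in> {1..N} \<Longrightarrow> j \<in> {1..n i} \<Longrightarrow> D i j = 0" by blast
  have mh: "multihomogeneous N n m a D f" using f by (simp add: hypersurface_eq_def)
  have "\<mu> = 0" if mu: "\<mu> \<in> Poly_Mapping.keys f" for \<mu>
  proof (rule ccontr)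
    assume "\<mu> \<noteq> 0"
    then obtain v where v: "v \<in> Poly_Mapping.keys \<mu>" using ex_key by blast
    then have "v \<in> coords N n m" using mh mu by (auto simp: multihomogeneous_def mvars_iff)
    then obtain i j l where ijl: "v = (i, j, l)" "i \<in> {1..N}" "j \<in> {1..n i}" "l \<in> {1..m i}"
      unfolding coords_def by blast
    have "(\<Sum>l=1..m i. a i l * Poly_Mapping.lookup \<mu> (i, j, l)) = 0"
      using mh mu ijl D0 unfolding multihomogeneous_def by auto
    then have "a i l * Poly_Mapping.lookup \<mu> (i, j, l) = 0" using ijl(4) by simp
    then show False using a[OF ijl(2,4)] v by (auto simp: ijl(1) in_keys_iff)
  qed
  then have "f = mconst (Poly_Mapping.lookup f 0)"
    unfolding mconst_def by (intro poly_mapping_eqI) (auto simp: lookup_single when_def in_keys_iff)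
  then show False using f unfolding hypersurface_eq_def by blast
qed

text \<open>Equations generating the same principal ideal divide each other, and being multihomogeneous they
  differ by a constant; so they have the same degree in each factor.\<close>

lemma gal_act_hypersurface_eq:
  assumes act: "factor_action \<iota> N n \<pi>" and s: "\<sigma> \<in> Gal \<iota>"
    and a: "\<And>i l. i \<in> {1..N} \<Longrightarrow> l \<in> {1..m i} \<Longrightarrow> 1 \<le> a i l"
    and f: "hypersurface_eq N n m a D f" and g: "hypersurface_eq N n m a D' g"
    and eq: "gal_act \<pi> \<sigma> ` (PIdl\<^bsub>coord_ring N n m\<^esub> f) = PIdl\<^bsub>coord_ring N n m\<^esub> g"
  shows "\<exists>c. c \<noteq> 0 \<and> g = mconst c * gal_act \<pi> \<sigma> f"
    and "\<And>i j. i \<in> {1..N} \<Longrightarrow> j \<in> {1..n i} \<Longrightarrow> D' i (\<pi> \<sigma> i j) = D i j"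
proof -
  have mf: "multihomogeneous N n m a D f" and mg: "multihomogeneous N n m a D' g" "g \<noteq> 0"
    using f g by (auto simp: hypersurface_eq_def)
  have pid: "PIdl\<^bsub>coord_ring N n m\<^esub> p = {h * p | h. mvars h \<subseteq> coords N n m}" for p :: "(coord, 'b) mpoly"
    by (simp add: cgenideal_def)
  define E where "E i j = D i (inv_into UNIV (\<pi> \<sigma> i) j)" for i j
  have E: "E i (\<pi> \<sigma> i j) = D i j" if "i \<in> {1..N}" for i j
    using permutes_inverses(2)[OF action_permutes[OF act s that]] by (simp add: E_def)
  have ms: "multihomogeneous N n m a E (gal_act \<pi> \<sigma> f)"
    by (rule multihomogeneous_gal_act[OF act s mf]) (simp add: E)
  have "g = 1 * g" "f = 1 * f" "mvars (1 :: (coord, 'b) mpoly) \<subseteq> coords N n m" by (simp_all add: mvars_1)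
  then have mem: "g \<in> PIdl\<^bsub>coord_ring N n m\<^esub> g" "f \<in> PIdl\<^bsub>coord_ring N n m\<^esub> f" unfolding pid by blast+
  have "g \<in> gal_act \<pi> \<sigma> ` (PIdl\<^bsub>coord_ring N n m\<^esub> f)" unfolding eq by (rule mem(1))
  then obtain k where k: "k \<in> PIdl\<^bsub>coord_ring N n m\<^esub> f" "g = gal_act \<pi> \<sigma> k" by (rule imageE)
  obtain h where h0: "k = h * f" "mvars h \<subseteq> coords N n m" using k(1) unfolding pid by blast
  have h: "mvars h \<subseteq> coords N n m" "g = gal_act \<pi> \<sigma> (h * f)" using h0 k(2) by simp_all
  then have gh: "mvars (gal_act \<pi> \<sigma> h) \<subseteq> coords N n m" "g = gal_act \<pi> \<sigma> h * gal_act \<pi> \<sigma> f"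
    using gal_act_carrier[OF act s] gal_act_mult[OF Gal_emb[OF s]] by auto
  have "gal_act \<pi> \<sigma> f \<in> PIdl\<^bsub>coord_ring N n m\<^esub> g"
    unfolding eq[symmetric] by (rule imageI) (rule mem(2))
  then obtain h' where h': "gal_act \<pi> \<sigma> f = h' * g" unfolding pid by blast
  obtain c where c: "c \<noteq> 0" "g = mconst c * gal_act \<pi> \<sigma> f"
    using associated_multihomogeneous[where N = N and m = m and a = a, OF a ms mg gh h'] by blast
  then show "\<exists>c. c \<noteq> 0 \<and> g = mconst c * gal_act \<pi> \<sigma> f" by blast
  fix i j assume ij: "i \<in> {1..N}" "j \<in> {1..n i}"
  obtain \<kappa> where k: "\<kappa> \<in> Poly_Mapping.keys g" using ex_key[OF mg(2)] by blast
  then have k': "\<kappa> \<in> Poly_Mapping.keys (gal_act \<pi> \<sigma> f)" using c(2) keys_mconst_mult by blast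
  have j': "\<pi> \<sigma> i j \<in> {1..n i}" using permutes_in_image[OF action_permutes[OF act s ij(1)]] ij(2) by blast
  have "(\<Sum>l=1..m i. a i l * Poly_Mapping.lookup \<kappa> (i, \<pi> \<sigma> i j, l)) = D' i (\<pi> \<sigma> i j)"
    using mg(1) k ij(1) j' unfolding multihomogeneous_def by blast
  moreover have "(\<Sum>l=1..m i. a i l * Poly_Mapping.lookup \<kappa> (i, \<pi> \<sigma> i j, l)) = E i (\<pi> \<sigma> i j)"
    using ms k' ij(1) j' unfolding multihomogeneous_def by blast
  ultimately show "D' i (\<pi> \<sigma> i j) = D i j" using E[OF ij(1)] by simp
qed

text \<open>The hypersurfaces \<open>H t\<close> need not be distinct; \<open>T\<close> contains one index for each of them. An automorphism
  permutes the indices in \<open>T\<close> and maps equations to constant multiples of equations. This makes the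
  product semi-invariant and its degree constant along each orbit of factors. At equivariant
  coordinates it also transports the vanishing of one equation to all of them.\<close>

lemma galois_orbit_product:
  fixes f :: "nat \<Rightarrow> (coord, 'a::field) mpoly"
  assumes act: "factor_action \<iota> N n \<pi>"
    and a: "\<And>i l. i \<in> {1..N} \<Longrightarrow> l \<in> {1..m i} \<Longrightarrow> 1 \<le> a i l"
    and fin: "finite B"
    and f: "\<And>t. t \<in> B \<Longrightarrow> hypersurface_eq N n m a (d t) (f t)"
    and H: "\<And>t. t \<in> B \<Longrightarrow> H t = PIdl\<^bsub>coord_ring N n m\<^esub> (f t)"
    and orb: "galois_orbit \<iota> \<pi> (H ` B)"
  shows "\<exists>T. T \<subseteq> B \<and> T \<noteq> {} \<and>
    (\<forall>i\<in>{1..N}. \<forall>j\<in>{1..n i}. \<forall>j'\<in>{1..n i}. (\<Sum>t\<in>T. d t i j) = (\<Sum>t\<in>T. d t i j')) \<and>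
    (\<forall>\<sigma>\<in>Gal \<iota>. \<exists>C. C \<noteq> 0 \<and> (\<forall>x. equivariant \<iota> N n m \<pi> x \<longrightarrow>
          (\<Prod>t\<in>T. mpeval x (f t)) = C * \<sigma> (\<Prod>t\<in>T. mpeval x (f t)))) \<and>
    (\<forall>x. equivariant \<iota> N n m \<pi> x \<longrightarrow> (\<Prod>t\<in>T. mpeval x (f t)) = 0 \<longrightarrow> (\<forall>t\<in>B. mpeval x (f t) = 0))"
proof -
  have Hc: "H t \<subseteq> {p. mvars p \<subseteq> coords N n m}" if "t \<in> B" for t
  proof -
    have "f t \<in> carrier (coord_ring N n m)" using f[OF that] by (simp add: hypersurface_eq_def multihomogeneous_def)
    then have "mvars (h * f t) \<subseteq> coords N n m" if "mvars h \<subseteq> coords N n m" for h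
      using mvars_mult[OF that] by simp
    then show ?thesis unfolding H[OF that] cgenideal_def by fastforce
  qed
  obtain T where T: "T \<subseteq> B" "inj_on H T" "H ` T = H ` B"
    using subset_image_inj[of "H ` B" H B] by auto
  have finT: "finite T" using T(1) fin finite_subset by blast
  obtain H0 where H0: "H0 \<in> H ` B" "H ` B = (\<lambda>\<sigma>. gal_act \<pi> \<sigma> ` H0) ` Gal \<iota>"
    using orb unfolding galois_orbit_def by blast
  obtain t0 where t0: "t0 \<in> B" "H0 = H t0" using H0(1) by blast
  have closed: "gal_act \<pi> \<sigma> ` H t \<in> H ` T" if s: "\<sigma> \<in> Gal \<iota>" and t: "t \<in> B" for \<sigma> t
  proof -
    obtain \<tau> where \<tau>: "\<tau> \<in> Gal \<iota>" "H t = gal_act \<pi> \<tau> ` H0" using H0(2) t by blast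
    have "gal_act \<pi> \<sigma> ` H t = gal_act \<pi> (\<sigma> \<circ> \<tau>) ` H0"
      unfolding \<tau>(2) image_image using gal_act_comp[OF act s \<tau>(1)] Hc[OF t0(1)] t0(2) by (intro image_cong) auto
    then show ?thesis unfolding T(3) H0(2) using Gal_comp[OF s \<tau>(1)] by blast
  qed
  have tr: "(\<exists>c. c \<noteq> 0 \<and> f t' = mconst c * gal_act \<pi> \<sigma> (f t)) \<and>
      (\<forall>i\<in>{1..N}. \<forall>j\<in>{1..n i}. d t' i (\<pi> \<sigma> i j) = d t i j)"
    if "\<sigma> \<in> Gal \<iota>" "t \<in> B" "t' \<in> B" "gal_act \<pi> \<sigma> ` H t = H t'" for \<sigma> t t'
    using gal_act_hypersurface_eq[where a = a and m = m, OF act that(1) a f[OF that(2)] f[OF that(3)] that(4)[unfolded H[OF that(2)] H[OF that(3)]]]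
    by blast
  have ev: "mpeval x (gal_act \<pi> \<sigma> (f t)) = \<sigma> (mpeval x (f t))"
    if "\<sigma> \<in> Gal \<iota>" "t \<in> B" "equivariant \<iota> N n m \<pi> x" for \<sigma> t x
    using that f[OF that(2)] by (intro mpeval_gal_act[OF Gal_emb[OF that(1)], where V = "coords N n m"])
      (auto simp: hypersurface_eq_def multihomogeneous_def equivariant_def)
  have perm: "\<exists>p. bij_betw p T T \<and> (\<forall>t\<in>T. gal_act \<pi> \<sigma> ` H t = H (p t))" if s: "\<sigma> \<in> Gal \<iota>" for \<sigma>
  proof -
    have "\<forall>t\<in>T. \<exists>t'\<in>T. gal_act \<pi> \<sigma> ` H t = H t'" using closed[OF s] T(1) by blast
    then obtain p where p: "\<And>t. t \<in> T \<Longrightarrow> p t \<in> T \<and> gal_act \<pi> \<sigma> ` H t = H (p t)" by metis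
    have undo: "gal_act \<pi> (inv_into UNIV \<sigma>) ` gal_act \<pi> \<sigma> ` H t = H t" if "t \<in> B" for t
    proof -
      have "inv_into UNIV (inv_into UNIV \<sigma>) = \<sigma>" using Gal_bij[OF s] by (rule inv_inv_eq)
      then have "gal_act \<pi> (inv_into UNIV \<sigma>) (gal_act \<pi> \<sigma> q) = q" if "q \<in> H t" for q
        using gal_act_inv[OF act Gal_inv[OF s], where p = q and m = m] Hc[OF \<open>t \<in> B\<close>] that by auto
      then show ?thesis by (force simp: image_image)
    qed
    have "inj_on p T"
    proof (rule inj_onI)
      fix t t' assume tt: "t \<in> T" "t' \<in> T" "p t = p t'"
      then have "gal_act \<pi> \<sigma> ` H t = gal_act \<pi> \<sigma> ` H t'" using p by metis
      then have "H t = H t'" using undo T(1) tt by (metis subsetD)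
      then show "t = t'" using T(2) tt by (meson inj_onD)
    qed
    moreover have "p ` T \<subseteq> T" using p by blast
    ultimately have "bij_betw p T T" using endo_inj_surj[OF finT] by (simp add: bij_betw_def)
    then show ?thesis using p by blast
  qed
  show ?thesis
  proof (intro exI[of _ T] conjI ballI allI impI)
    show "T \<subseteq> B" by (rule T(1))
    show "T \<noteq> {}" using T(3) t0(1) by auto
  next
    fix i j j' assume ij: "i \<in> {1..N}" "j \<in> {1..n i}" "j' \<in> {1..n i}"
    obtain \<sigma> where s: "\<sigma> \<in> Gal \<iota>" "\<pi> \<sigma> i j = j'" using action_trans[OF act ij] by blast
    obtain p where p: "bij_betw p T T" "\<And>t. t \<in> T \<Longrightarrow> gal_act \<pi> \<sigma> ` H t = H (p t)" using perm[OF s(1)] by blast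
    have "(\<Sum>t\<in>T. d t i j) = (\<Sum>t\<in>T. d (p t) i j')"
    proof (rule sum.cong[OF refl])
      fix t assume t: "t \<in> T"
      then have "p t \<in> B" "t \<in> B" using T(1) bij_betwE[OF p(1)] by auto
      then show "d t i j = d (p t) i j'" using tr[OF s(1) _ _ p(2)[OF t]] ij s(2) by metis
    qed
    also have "\<dots> = (\<Sum>t\<in>T. d t i j')" by (rule sum.reindex_bij_betw[OF p(1)])
    finally show "(\<Sum>t\<in>T. d t i j) = (\<Sum>t\<in>T. d t i j')" .
  next
    fix \<sigma> assume s: "\<sigma> \<in> Gal \<iota>"
    obtain p where p: "bij_betw p T T" "\<And>t. t \<in> T \<Longrightarrow> gal_act \<pi> \<sigma> ` H t = H (p t)" using perm[OF s(1)] by blast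
    have "\<exists>c. c \<noteq> 0 \<and> f (p t) = mconst c * gal_act \<pi> \<sigma> (f t)" if t: "t \<in> T" for t
    proof -
      have "p t \<in> B" "t \<in> B" using t T(1) bij_betwE[OF p(1)] by auto
      then show ?thesis using tr[OF s _ _ p(2)[OF t]] by blast
    qed
    then obtain c where c: "\<And>t. t \<in> T \<Longrightarrow> c t \<noteq> 0 \<and> f (p t) = mconst (c t) * gal_act \<pi> \<sigma> (f t)" by metis
    show "\<exists>C. C \<noteq> 0 \<and> (\<forall>x. equivariant \<iota> N n m \<pi> x \<longrightarrow>
          (\<Prod>t\<in>T. mpeval x (f t)) = C * \<sigma> (\<Prod>t\<in>T. mpeval x (f t)))"
    proof (intro exI[of _ "\<Prod>t\<in>T. c t"] conjI allI impI)
      show "(\<Prod>t\<in>T. c t) \<noteq> 0" using c finT by simp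
      fix x assume x: "equivariant \<iota> N n m \<pi> x"
      have "(\<Prod>t\<in>T. mpeval x (f t)) = (\<Prod>t\<in>T. mpeval x (f (p t)))"
        by (rule prod.reindex_bij_betw[OF p(1), symmetric])
      also have "\<dots> = (\<Prod>t\<in>T. c t * \<sigma> (mpeval x (f t)))"
      proof (rule prod.cong[OF refl])
        fix t assume t: "t \<in> T"
        then have "t \<in> B" using T(1) by blast
        then show "mpeval x (f (p t)) = c t * \<sigma> (mpeval x (f t))"
          using c[OF t] ev[OF s _ x] by (simp add: mpeval_mconst_mult)
      qed
      also have "\<dots> = (\<Prod>t\<in>T. c t) * \<sigma> (\<Prod>t\<in>T. mpeval x (f t))"
        by (simp add: prod.distrib field_embedding_prod[OF Gal_emb[OF s]])
      finally show "(\<Prod>t\<in>T. mpeval x (f t)) = (\<Prod>t\<in>T. c t) * \<sigma> (\<Prod>t\<in>T. mpeval x (f t))" .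
    qed
  next
    fix x t assume x: "equivariant \<iota> N n m \<pi> x" and z: "(\<Prod>t\<in>T. mpeval x (f t)) = 0" and t: "t \<in> B"
    have link: "\<exists>\<sigma>\<in>Gal \<iota>. \<exists>c. c \<noteq> 0 \<and> mpeval x (f t) = c * \<sigma> (mpeval x (f t0))" if t: "t \<in> B" for t
    proof -
      have "H t \<in> (\<lambda>\<sigma>. gal_act \<pi> \<sigma> ` H0) ` Gal \<iota>" using imageI[OF t, of H] unfolding H0(2) .
      then obtain \<tau> where \<tau>: "\<tau> \<in> Gal \<iota>" "H t = gal_act \<pi> \<tau> ` H t0"
        unfolding t0(2) by (rule imageE)
      obtain c where "c \<noteq> 0" "f t = mconst c * gal_act \<pi> \<tau> (f t0)"
        using tr[OF \<tau>(1) t0(1) t \<tau>(2)[symmetric]] by blast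
      then show ?thesis using ev[OF \<tau>(1) t0(1) x] \<tau>(1) by (auto simp: mpeval_mconst_mult)
    qed
    obtain t1 where t1: "t1 \<in> T" "mpeval x (f t1) = 0" using z finT by auto
    then obtain \<sigma> where "\<sigma> \<in> Gal \<iota>" "\<sigma> (mpeval x (f t0)) = 0" using link[of t1] T(1) by auto
    then have "mpeval x (f t0) = 0" using field_embedding_eq_0_iff[OF Gal_emb] by blast
    then show "mpeval x (f t) = 0" using link[OF t] field_embedding_0[OF Gal_emb] by force
  qed
qed

section \<open>Existence of a rational point\<close>

lemma consecutive_blocks:
  fixes b :: "nat \<Rightarrow> nat" and r s :: nat
  assumes b: "strict_mono_on {0..r} b" "b 0 = 0" "b r = s"
  shows "(\<Union>q\<in>{1..r}. {b (q - 1) + 1..b q}) = {1..s}"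
    and "\<And>q q'. q \<in> {1..r} \<Longrightarrow> q' \<in> {1..r} \<Longrightarrow> q \<noteq> q' \<Longrightarrow>
      {b (q - 1) + 1..b q} \<inter> {b (q' - 1) + 1..b q'} = {}"
proof -
  have mono: "b q \<le> b q'" if "q \<le> q'" "q' \<le> r" for q q'
    using that b(1) by (cases "q = q'") (auto simp: strict_mono_on_def intro: less_imp_le)
  show "(\<Union>q\<in>{1..r}. {b (q - 1) + 1..b q}) = {1..s}"
  proof
    show "(\<Union>q\<in>{1..r}. {b (q - 1) + 1..b q}) \<subseteq> {1..s}" using mono[of _ r] b(3) by fastforce
    show "{1..s} \<subseteq> (\<Union>q\<in>{1..r}. {b (q - 1) + 1..b q})"
    proof
      fix t assume t: "t \<in> {1..s}"
      define q where "q = (LEAST q. t \<le> b q)"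
      have q: "t \<le> b q" "q \<le> r"
        unfolding q_def using t b(3) by (auto intro: LeastI[of "\<lambda>q. t \<le> b q" r] Least_le)
      have "q \<noteq> 0" using q(1) t b(2) by (intro notI) auto
      moreover have "\<not> t \<le> b (q - 1)"
        using not_less_Least[of "q - 1" "\<lambda>q. t \<le> b q"] \<open>q \<noteq> 0\<close> by (auto simp: q_def[symmetric])
      ultimately show "t \<in> (\<Union>q\<in>{1..r}. {b (q - 1) + 1..b q})"
        using q by (intro UN_I[of q]) auto
    qed
  qed
  have "{b (q - 1) + 1..b q} \<inter> {b (q' - 1) + 1..b q'} = {}" if "q < q'" "q' \<le> r" for q q'
  proof -
    have "b q \<le> b (q' - 1)" using that by (intro mono) auto
    then show ?thesis unfolding disjoint_iff by fastforce
  qed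
  then show "\<And>q q'. q \<in> {1..r} \<Longrightarrow> q' \<in> {1..r} \<Longrightarrow> q \<noteq> q' \<Longrightarrow>
      {b (q - 1) + 1..b q} \<inter> {b (q' - 1) + 1..b q'} = {}"
    by (metis atLeastAtMost_iff inf_commute linorder_neqE_nat)
qed

text \<open>As all weights are positive, an equation of degree zero in a factor does not contain its variables.\<close>

lemma mpeval_independent:
  assumes a: "\<And>l. l \<in> {1..m i} \<Longrightarrow> 1 \<le> a i l" and i: "i \<in> {1..N}"
    and f: "multihomogeneous N n m a D f" and D: "\<And>j. j \<in> {1..n i} \<Longrightarrow> D i j = 0"
    and x: "\<And>v. fst v \<noteq> i \<Longrightarrow> x v = x' v"
  shows "mpeval x f = mpeval x' f"
proof -
  have "meval x \<mu> = meval x' \<mu>" if mu: "\<mu> \<in> Poly_Mapping.keys f" for \<mu>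
    unfolding meval_def
  proof (rule prod.cong[OF refl])
    fix v assume v: "v \<in> Poly_Mapping.keys \<mu>"
    then have "v \<in> coords N n m" using f mu by (auto simp: multihomogeneous_def mvars_iff)
    then obtain i' j l where ijl: "v = (i', j, l)" "j \<in> {1..n i'}" "l \<in> {1..m i'}"
      unfolding coords_def by blast
    have "i' \<noteq> i"
    proof
      assume ii: "i' = i"
      have "(\<Sum>l=1..m i. a i l * Poly_Mapping.lookup \<mu> (i, j, l)) = 0"
        using f mu i ijl D unfolding multihomogeneous_def ii by auto
      then have "a i l * Poly_Mapping.lookup \<mu> (i, j, l) = 0" using ijl(3) ii by simp
      then show False using a[of l] ijl v ii by (auto simp: in_keys_iff)
    qed
    then show "x v ^ Poly_Mapping.lookup \<mu> v = x' v ^ Poly_Mapping.lookup \<mu> v" using x[of v] ijl(1) by simp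
  qed
  then show ?thesis unfolding mpeval_def meval_def[symmetric] by simp
qed

theorem proposition7p6:
  fixes \<iota> :: "'k::field \<Rightarrow> 'a::field"
    and N :: nat and n m :: "nat \<Rightarrow> nat" and a :: "nat \<Rightarrow> nat \<Rightarrow> nat"
    and \<pi> :: "('a \<Rightarrow> 'a) \<Rightarrow> nat \<Rightarrow> nat \<Rightarrow> nat"
    and X :: "(coord, 'a) mpoly set set"
    and s r :: nat and f :: "nat \<Rightarrow> (coord, 'a) mpoly" and H :: "nat \<Rightarrow> (coord, 'a) mpoly set"
    and d :: "nat \<Rightarrow> nat \<Rightarrow> nat \<Rightarrow> nat" and b :: "nat \<Rightarrow> nat"
  assumes "C1_field TYPE('k)" and "admits_normic_forms TYPE('k)"
    and "separable_closure \<iota>"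
    and "1 \<le> N"
    and "\<And>i. i \<in> {1..N} \<Longrightarrow> 1 \<le> n i"
    and "\<And>i. i \<in> {1..N} \<Longrightarrow> 1 \<le> m i"
    and "\<And>i l. i \<in> {1..N} \<Longrightarrow> l \<in> {1..m i} \<Longrightarrow> 1 \<le> a i l"
    and "factor_action \<iota> N n \<pi>"
    and "X \<subseteq> wproj_points N n m a" and "galois_stable \<iota> \<pi> X"
    and "\<And>t. t \<in> {1..s} \<Longrightarrow> hypersurface_eq N n m a (\<lambda>i j. d i j t) (f t)"
    and "\<And>t. t \<in> {1..s} \<Longrightarrow> H t = PIdl\<^bsub>coord_ring N n m\<^esub> (f t)"
    and "X = (\<Inter>t\<in>{1..s}. hypersurface_points N n m a (H t))"
    and "\<And>i j. i \<in> {1..N} \<Longrightarrow> j \<in> {1..n i} \<Longrightarrow>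
           (\<Sum>t=1..s. d i j t) < (\<Sum>l=1..m i. a i l)"
    and "1 \<le> r" and "strict_mono_on {0..r} b" and "b 0 = 0" and "b r = s"
    and "\<And>q. q \<in> {1..r} \<Longrightarrow> galois_orbit \<iota> \<pi> (H ` {b (q - 1) + 1..b q})"
  shows "rational_points \<iota> N n m a \<pi> X \<noteq> {}"
proof -
  note C1 = assms(1) and ad = assms(2) and sc = assms(3) and n1 = assms(5) and a1 = assms(7)
    and act = assms(8) and f = assms(11) and H = assms(12) and Xeq = assms(13) and lt = assms(14)
    and b = assms(16-18) and orb = assms(19)
  define B where "B q = {b (q - 1) + 1..b q}" for q
  have Bs: "(\<Union>q\<in>{1..r}. B q) = {1..s}" unfolding B_def by (rule consecutive_blocks(1)[OF b])
  have Bd: "B q \<inter> B q' = {}" if "q \<in> {1..r}" "q' \<in> {1..r}" "q \<noteq> q'" for q q'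
    unfolding B_def by (rule consecutive_blocks(2)[OF b that])
  have Bin: "t \<in> {1..s}" if "q \<in> {1..r}" "t \<in> B q" for q t using Bs that by blast
  \<comment> \<open>The conclusion of \<open>galois_orbit_product\<close> for the \<open>q\<close>-th orbit of hypersurfaces.\<close>
  define good where "good q T \<longleftrightarrow> T \<subseteq> B q \<and> T \<noteq> {} \<and>
    (\<forall>i\<in>{1..N}. \<forall>j\<in>{1..n i}. \<forall>j'\<in>{1..n i}. (\<Sum>t\<in>T. d i j t) = (\<Sum>t\<in>T. d i j' t)) \<and>
    (\<forall>\<sigma>\<in>Gal \<iota>. \<exists>C. C \<noteq> 0 \<and> (\<forall>x. equivariant \<iota> N n m \<pi> x \<longrightarrow>
          (\<Prod>t\<in>T. mpeval x (f t)) = C * \<sigma> (\<Prod>t\<in>T. mpeval x (f t)))) \<and>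
    (\<forall>x. equivariant \<iota> N n m \<pi> x \<longrightarrow> (\<Prod>t\<in>T. mpeval x (f t)) = 0 \<longrightarrow> (\<forall>t\<in>B q. mpeval x (f t) = 0))"
    for q T
  have "\<exists>T. good q T" if q: "q \<in> {1..r}" for q
    unfolding good_def
  proof (rule galois_orbit_product[OF act, where a = a and H = H and d = "\<lambda>t i j. d i j t"])
    show "finite (B q)" by (simp add: B_def)
    show "galois_orbit \<iota> \<pi> (H ` B q)" unfolding B_def by (rule orb[OF q])
  qed (use a1 f H Bin[OF q] in \<open>blast+\<close>)
  then obtain T where good: "\<And>q. q \<in> {1..r} \<Longrightarrow> good q (T q)" by metis
  have T: "T q \<subseteq> B q" "T q \<noteq> {}" if "q \<in> {1..r}" for q
    using good[OF that] unfolding good_def by auto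
  have Tj: "(\<Sum>t\<in>T q. d i j t) = (\<Sum>t\<in>T q. d i j' t)"
    if "q \<in> {1..r}" "i \<in> {1..N}" "j \<in> {1..n i}" "j' \<in> {1..n i}" for q i j j'
    using good[OF that(1)] that(2-) unfolding good_def by blast
  have TC: "\<exists>C. C \<noteq> 0 \<and> (\<forall>x. equivariant \<iota> N n m \<pi> x \<longrightarrow>
          (\<Prod>t\<in>T q. mpeval x (f t)) = C * \<sigma> (\<Prod>t\<in>T q. mpeval x (f t)))"
    if "q \<in> {1..r}" "\<sigma> \<in> Gal \<iota>" for q \<sigma>
    using good[OF that(1)] that(2) unfolding good_def by blast
  have T0: "mpeval x (f t) = 0"
    if "q \<in> {1..r}" "equivariant \<iota> N n m \<pi> x" "(\<Prod>t\<in>T q. mpeval x (f t)) = 0" "t \<in> B q" for q x t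
    using good[OF that(1)] that(2-) unfolding good_def by blast
  have finT: "finite (T q)" if "q \<in> {1..r}" for q
    using T(1)[OF that] finite_subset by (auto simp: B_def)
  have Tin: "t \<in> {1..s}" if "q \<in> {1..r}" "t \<in> T q" for q t using Bin T(1) that by blast
  have mh: "multihomogeneous N n m a (\<lambda>i j. d i j t) (f t)" if "t \<in> {1..s}" for t
    using f[OF that] by (simp add: hypersurface_eq_def)
  \<comment> \<open>The degree in any factor of the \<open>i\<close>-th orbit; the first factor is a representative.\<close>
  define D where "D q i = (\<Sum>t\<in>T q. d i 1 t)" for q i
  have Dj: "(\<Sum>t\<in>T q. d i j t) = D q i" if "q \<in> {1..r}" "i \<in> {1..N}" "j \<in> {1..n i}" for q i j
    unfolding D_def using Tj[OF that(1,2,3)] n1[OF that(2)] by auto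
  have D0: "d i j t = 0" if "q \<in> {1..r}" "i \<in> {1..N}" "j \<in> {1..n i}" "t \<in> T q" "D q i = 0" for q i j t
    using Dj[OF that(1-3)] that finT by simp
  have Dlt: "(\<Sum>q\<in>Q. D q i) < (\<Sum>l=1..m i. a i l)" if i: "i \<in> {1..N}" and Q: "Q \<subseteq> {1..r}" for i Q
  proof -
    have "(\<Sum>q\<in>Q. D q i) \<le> (\<Sum>q\<in>{1..r}. D q i)" using Q by (intro sum_mono2) auto
    also have "\<dots> \<le> (\<Sum>q\<in>{1..r}. \<Sum>t\<in>B q. d i 1 t)"
      unfolding D_def using T(1) by (intro sum_mono sum_mono2) (auto simp: B_def)
    also have "\<dots> = (\<Sum>t\<in>(\<Union>q\<in>{1..r}. B q). d i 1 t)"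
      using Bd by (intro sum.UNION_disjoint[symmetric]) (auto simp: B_def)
    also have "\<dots> < (\<Sum>l=1..m i. a i l)" unfolding Bs using lt[OF i, of 1] n1[OF i] by simp
    finally show ?thesis .
  qed
  \<comment> \<open>The first \<open>I\<close> orbits of factors have been treated, without any condition on the later
    coordinates; solved are the orbits of equations without variables from the later factors.\<close>
  have "\<exists>x. equivariant \<iota> N n m \<pi> x \<and>
      (\<forall>i\<in>{1..I}. \<exists>j\<in>{1..n i}. \<exists>l\<in>{1..m i}. x (i, j, l) \<noteq> 0) \<and>
      (\<forall>q\<in>{1..r}. (\<forall>i\<in>{I+1..N}. D q i = 0) \<longrightarrow> (\<Prod>t\<in>T q. mpeval x (f t)) = 0)"
    if "I \<le> N" for I
    using that
  proof (induction I)
    case 0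
    \<comment> \<open>There is nothing to solve at the beginning since no equation is constant.\<close>
    have "equivariant \<iota> N n m \<pi> (\<lambda>_. 0)"
      unfolding equivariant_def by (auto simp: field_embedding_0[OF Gal_emb])
    moreover have False if q: "q \<in> {1..r}" and z: "\<forall>i\<in>{0+1..N}. D q i = 0" for q
    proof -
      obtain t where t: "t \<in> T q" using T(2)[OF q] by blast
      obtain i j where "i \<in> {1..N}" "j \<in> {1..n i}" "d i j t \<noteq> 0"
        using nonconstant_degree[where a = a and m = m and N = N, OF a1 f[OF Tin[OF q t]]] by blast
      then show False using D0[OF q _ _ t] z by simp
    qed
    moreover have "\<forall>i\<in>{1..0}. \<exists>j\<in>{1..n i}. \<exists>l\<in>{1..m i}. (0::'a) \<noteq> 0" by simp
    ultimately show ?case by blast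
  next
    case (Suc I)
    define i where "i = Suc I"
    have i: "i \<in> {1..N}" using Suc.prems by (simp add: i_def)
    obtain x0 where x0: "equivariant \<iota> N n m \<pi> x0"
      "\<And>i. i \<in> {1..I} \<Longrightarrow> \<exists>j\<in>{1..n i}. \<exists>l\<in>{1..m i}. x0 (i, j, l) \<noteq> 0"
      "\<And>q. q \<in> {1..r} \<Longrightarrow> (\<And>i. i \<in> {I+1..N} \<Longrightarrow> D q i = 0) \<Longrightarrow> (\<Prod>t\<in>T q. mpeval x0 (f t)) = 0"
      using Suc.IH Suc.prems by (meson Suc_leD)
    \<comment> \<open>Only orbits of equations containing variables of the \<open>i\<close>-th factors have to be solved; for the
      others the change of these coordinates has no effect.\<close>
    define Q where "Q = {q \<in> {1..r}. 1 \<le> D q i}"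
    have "\<exists>x. equivariant \<iota> N n m \<pi> x \<and> (\<forall>v. fst v \<noteq> i \<longrightarrow> x v = x0 v) \<and>
     (\<exists>j\<in>{1..n i}. \<exists>l\<in>{1..m i}. x (i, j, l) \<noteq> 0) \<and> (\<forall>q\<in>Q. (\<Prod>t\<in>T q. mpeval x (f t)) = 0)"
    proof (rule solve_factor[where n = n and m = m and a = a and T = T and f = f and Q = Q and d = "\<lambda>t i j. d i j t"
          and D = "\<lambda>q. D q i", OF C1 ad sc act i n1[OF i] a1[OF i] x0(1)])
      show "finite Q" by (simp add: Q_def)
      show "multihomogeneous N n m a (\<lambda>i j. d i j t) (f t)" if "q \<in> Q" "t \<in> T q" for q t
        using that(1) by (intro mh Tin[OF _ that(2)]) (simp add: Q_def)
      show "(\<Sum>t\<in>T q. d i j t) = D q i" if "q \<in> Q" "j \<in> {1..n i}" for q j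
        using that Dj[OF _ i] by (simp add: Q_def)
      show "1 \<le> D q i" if "q \<in> Q" for q using that by (simp add: Q_def)
      show "(\<Sum>q\<in>Q. D q i) < (\<Sum>l=1..m i. a i l)" by (rule Dlt[OF i]) (auto simp: Q_def)
      show "\<exists>C. C \<noteq> 0 \<and> (\<forall>x. equivariant \<iota> N n m \<pi> x \<longrightarrow>
          (\<Prod>t\<in>T q. mpeval x (f t)) = C * \<sigma> (\<Prod>t\<in>T q. mpeval x (f t)))" if "q \<in> Q" "\<sigma> \<in> Gal \<iota>" for q \<sigma>
        using TC that by (simp add: Q_def)
    qed
    then obtain x where x: "equivariant \<iota> N n m \<pi> x" "\<And>v. fst v \<noteq> i \<Longrightarrow> x v = x0 v"
      "\<exists>j\<in>{1..n i}. \<exists>l\<in>{1..m i}. x (i, j, l) \<noteq> 0" "\<And>q. q \<in> Q \<Longrightarrow> (\<Prod>t\<in>T q. mpeval x (f t)) = 0"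
      by blast
    have nz: "\<exists>j\<in>{1..n i'}. \<exists>l\<in>{1..m i'}. x (i', j, l) \<noteq> 0" if "i' \<in> {1..Suc I}" for i'
    proof (cases "i' = i")
      case True
      then show ?thesis using x(3) by simp
    next
      case False
      then show ?thesis using x0(2)[of i'] that x(2) by (auto simp: i_def)
    qed
    have z: "(\<Prod>t\<in>T q. mpeval x (f t)) = 0" if q: "q \<in> {1..r}" and Dz: "\<forall>i\<in>{Suc I+1..N}. D q i = 0" for q
    proof (cases "D q i = 0")
      case False
      then show ?thesis using x(4)[of q] q by (simp add: Q_def)
    next
      case True
      have "D q i' = 0" if "i' \<in> {I+1..N}" for i'
        using Dz True that by (cases "i' = i") (auto simp: i_def)
      then have "(\<Prod>t\<in>T q. mpeval x0 (f t)) = 0" by (rule x0(3)[OF q])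
      moreover have "mpeval x (f t) = mpeval x0 (f t)" if t: "t \<in> T q" for t
        using D0[OF q i _ t True] x(2)
        by (intro mpeval_independent[where m = m and a = a, OF a1[OF i] i mh[OF Tin[OF q t]]]) auto
      ultimately show ?thesis by simp
    qed
    show ?case using x(1) nz z by blast
  qed
  from this[of N] obtain x where x: "equivariant \<iota> N n m \<pi> x"
    "\<And>i. i \<in> {1..N} \<Longrightarrow> \<exists>j\<in>{1..n i}. \<exists>l\<in>{1..m i}. x (i, j, l) \<noteq> 0"
    "\<And>q. q \<in> {1..r} \<Longrightarrow> (\<Prod>t\<in>T q. mpeval x (f t)) = 0" by auto
  have xz: "mpeval x (f t) = 0" if "t \<in> {1..s}" for t
  proof -
    obtain q where "q \<in> {1..r}" "t \<in> B q" using Bs \<open>t \<in> {1..s}\<close> by blast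
    then show ?thesis using T0 x(1,3) by blast
  qed
  \<comment> \<open>A nonzero coordinate in one factor gives one in every factor of the orbit, by transitivity.\<close>
  have nz: "\<exists>l\<in>{1..m i}. x (i, j, l) \<noteq> 0" if ij: "i \<in> {1..N}" "j \<in> {1..n i}" for i j
  proof -
    obtain j' l where jl: "j' \<in> {1..n i}" "l \<in> {1..m i}" "x (i, j', l) \<noteq> 0" using x(2)[OF ij(1)] by blast
    obtain \<sigma> where s: "\<sigma> \<in> Gal \<iota>" "\<pi> \<sigma> i j' = j" using action_trans[OF act ij(1) jl(1) ij(2)] by blast
    have "(i, j', l) \<in> coords N n m" using ij(1) jl by (simp add: coords_def)
    then have "x (permute_coord (\<pi> \<sigma>) (i, j', l)) = \<sigma> (x (i, j', l))"
      using x(1) s(1) unfolding equivariant_def by blast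
    then have "x (i, j, l) \<noteq> 0"
      using jl(3) s(2) field_embedding_eq_0_iff[OF Gal_emb[OF s(1)]] by (simp add: permute_coord_def)
    then show ?thesis using jl(2) by blast
  qed
  let ?P = "point_ideal N n m a x"
  have wp: "?P \<in> wproj_points N n m a" by (rule point_ideal_wproj) (rule nz)
  have "H t \<subseteq> ?P" if t: "t \<in> {1..s}" for t
  proof -
    have "f t \<in> ?P" using point_ideal_iff[OF mh[OF t]] xz[OF t] by blast
    then show ?thesis unfolding H[OF t]
      by (intro ring.cgenideal_minimal[OF cring.axioms(1)[OF cring_coord_ring]]
          primeideal.axioms(1)[OF point_ideal_primeideal])
  qed
  then have "?P \<in> X" unfolding Xeq hypersurface_points_def using wp by blast
  then have "?P \<in> rational_points \<iota> N n m a \<pi> X"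
    unfolding rational_points_def
    using point_ideal_rational_at point_ideal_Gal[OF act x(1)] by blast
  then show ?thesis by blast
qed

end
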